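(* Let $\tilde G=(\tilde V,\tilde E)$ be a finite simple $\Gamma$-symmetric graph with respect to an action $\theta:\Gamma\to\mathrm{Aut}(\tilde G)$ that is free on $\tilde V$, let $\tau:\Gamma\to O(\mathbb{R}^2)$ be a homomorphism such that $\tau(\Gamma)$ is $\mathcal{C}_s$ or $\mathcal{C}_2$ (so $\Gamma=\mathbb{Z}_2$), and let $(\tilde G,p)$ be a $\Gamma$-generic framework in $\mathbb{R}^2$ (with respect to $\theta$ and $\tau$). Let $\tilde E_\ell\subseteq\tilde E$ be the set of edges of $\tilde G$ that are fixed by the non-trivial element of $\Gamma$, and let $\tilde G_\ell=\tilde G-\tilde E_\ell$. If $\tilde G_\ell$ is 7-mixed-connected, then $(\tilde G,p)$ is infinitesimally rigid.
   Context: Symmetric graphs. An action of a group $\Gamma$ on a finite simple graph $\tilde G=(\tilde V,\tilde E)$ is a homomorphism $\theta:\Gamma\to\mathrm{Aut}(\tilde G)$; write $\gamma i$ for $\theta(\gamma)(i)$. It is free on $\tilde V$ if $\gamma i\ne i$ for all $i\in\tilde V$ and all $\gamma\neq\mathrm{id}$. $\tilde G$ is then called $\Gamma$-symmetric (with respect to $\theta$). An edge $\{i,j\}$ is fixed by $\gamma$ if $\gamma i=j$ and $\gamma j=i$. Frameworks. A framework in $\mathbb{R}^2$ is a pair $(\tilde G,p)$ with $p:\tilde V\to\mathbb{R}^2$ injective. It is $\Gamma$-symmetric (with respect to $\theta$ and $\tau$) if $\tau(\gamma)p(i)=p(\gamma i)$ for all $\gamma\in\Gamma$, $i\in\tilde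 V$. It is $\Gamma$-generic if it is $\Gamma$-symmetric and the coordinates of the points $p(i)$, $i$ ranging over one representative of each vertex orbit, are algebraically independent over the field $\mathbb{Q}_\Gamma$ generated by $\mathbb{Q}$ and the entries of the matrices in $\tau(\Gamma)$. Groups. $\mathcal{C}_s$ is the group of order 2 generated by a reflection in a line through the origin; $\mathcal{C}_2$ is the group of order 2 generated by the rotation by $\pi$ about the origin. Rigidity. An infinitesimal motion of $(\tilde G,p)$ is $u:\tilde V\to\mathbb{R}^2$ with $\langle p_i-p_j,u_i-u_j\rangle=0$ for all $\{i,j\}\in\tilde E$. It is trivial if there are a skew-symmetric matrix $S$ and a vector $t$ with $u_i=Sp_i+t$ for all $i$. $(\tilde G,p)$ is infinitesimally rigid if every infinitesimal motion is trivial. Mixed connectivity. A graph $H=(V_H,E_H)$ is $n$-mixed-connected if $H-W-F$ is connected for all $W\subseteq V_H$ and $F\subseteq E_H$ with $2|W|+|F|\le n-1$. *)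

theory Defs
  imports
    "HOL-Analysis.Analysis"
    "HOL-Algebra.Group_Action"
    "HOL-Algebra.Generated_Fields"
    "HOL-Algebra.Algebraic_Closure_Type"
    "HOL-Library.Poly_Mapping"
begin

section \<open>Finite simple graphs\<close>

definition finite_simple_graph :: "'v set \<Rightarrow> 'v set set \<Rightarrow> bool" where
  "finite_simple_graph V E \<longleftrightarrow> finite V \<and> (\<forall>e\<in>E. e \<subseteq> V \<and> card e = 2)"

text \<open>The graph without vertices counts as connected.\<close>

definition connected_graph :: "'v set \<Rightarrow> 'v set set \<Rightarrow> bool" where
  "connected_graph V E \<longleftrightarrow> (\<forall>x\<in>V. \<forall>y\<in>V. (x, y) \<in> {(a, b). {a, b} \<in> E}\<^sup>*)"

text \<open>The bound \<open>2|W| + |F| \<le> n - 1\<close> is written with \<open><\<close>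
  to avoid truncated subtraction.\<close>

definition mixed_connected :: "nat \<Rightarrow> 'v set \<Rightarrow> 'v set set \<Rightarrow> bool" where
  "mixed_connected n V E \<longleftrightarrow>
     (\<forall>W F. W \<subseteq> V \<and> F \<subseteq> E \<and> finite W \<and> finite F \<and> 2 * card W + card F < n \<longrightarrow>
        connected_graph (V - W) ({e \<in> E. e \<inter> W = {}} - F))"

section \<open>Group actions on graphs\<close>

definition graph_aut_group :: "'v set \<Rightarrow> 'v set set \<Rightarrow> ('v \<Rightarrow> 'v) monoid" where
  "graph_aut_group V E =
     BijGroup V \<lparr>carrier := {f \<in> Bij V. \<forall>i\<in>V. \<forall>j\<in>V. {f i, f j} \<in> E \<longleftrightarrow> {i, j} \<in> E}\<rparr>"

definition graph_action ::
    "('g, 'm) monoid_scheme \<Rightarrow> 'v set \<Rightarrow> 'v set set \<Rightarrow> ('g \<Rightarrow> 'v \<Rightarrow> 'v) \<Rightarrow> bool" where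
  "graph_action \<Gamma> V E \<theta> \<longleftrightarrow> \<theta> \<in> hom \<Gamma> (graph_aut_group V E)"

definition free_on ::
    "('g, 'm) monoid_scheme \<Rightarrow> 'v set \<Rightarrow> ('g \<Rightarrow> 'v \<Rightarrow> 'v) \<Rightarrow> bool" where
  "free_on \<Gamma> V \<theta> \<longleftrightarrow> (\<forall>i\<in>V. \<forall>\<gamma>\<in>carrier \<Gamma>. \<gamma> \<noteq> \<one>\<^bsub>\<Gamma>\<^esub> \<longrightarrow> \<theta> \<gamma> i \<noteq> i)"

definition fixed_edges :: "('g \<Rightarrow> 'v \<Rightarrow> 'v) \<Rightarrow> 'g \<Rightarrow> 'v set set \<Rightarrow> 'v set set" where
  "fixed_edges \<theta> \<gamma> E = {e \<in> E. \<exists>i j. e = {i, j} \<and> \<theta> \<gamma> i = j \<and> \<theta> \<gamma> j = i}"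

section \<open>Point groups in the plane\<close>

definition orthogonal_group :: "(real^2^2) monoid" where
  "orthogonal_group = \<lparr>carrier = {A. orthogonal_matrix A}, mult = (**), one = mat 1\<rparr>"

text \<open>Reflection in the line spanned by \<open>d \<noteq> 0\<close>: twice the orthogonal projection
  onto the line, minus the identity.\<close>

definition reflection_in_line :: "real^2 \<Rightarrow> real^2^2" where
  "reflection_in_line d = matrix (\<lambda>x. (2 * ((x \<bullet> d) / (d \<bullet> d))) *\<^sub>R d - x)"

definition rotation :: "real \<Rightarrow> real^2^2" where
  "rotation t = vector [vector [cos t, - sin t], vector [sin t, cos t]]"

definition is_Cs :: "(real^2^2) set \<Rightarrow> bool" where
  "is_Cs T \<longleftrightarrow> (\<exists>d. d \<noteq> 0 \<and> T = generate orthogonal_group {reflection_in_line d})"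

definition is_C2 :: "(real^2^2) set \<Rightarrow> bool" where
  "is_C2 T \<longleftrightarrow> T = generate orthogonal_group {rotation pi}"

section \<open>Algebraic independence\<close>

text \<open>A polynomial in variables indexed by \<open>'i\<close> is a finitely supported map from monomials
  (finitely supported exponent maps) to coefficients.\<close>

definition mpoly_eval :: "('i \<Rightarrow> real) \<Rightarrow> (('i \<Rightarrow>\<^sub>0 nat) \<Rightarrow>\<^sub>0 real) \<Rightarrow> real" where
  "mpoly_eval a P = (\<Sum>m\<in>Poly_Mapping.keys P.
     Poly_Mapping.lookup P m * (\<Prod>i\<in>Poly_Mapping.keys m. a i ^ Poly_Mapping.lookup m i))"

definition algebraically_independent :: "real set \<Rightarrow> 'i set \<Rightarrow> ('i \<Rightarrow> real) \<Rightarrow> bool" where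
  "algebraically_independent K I a \<longleftrightarrow>
     (\<forall>P. (\<forall>m\<in>Poly_Mapping.keys P. Poly_Mapping.lookup P m \<in> K \<and> Poly_Mapping.keys m \<subseteq> I)
          \<and> mpoly_eval a P = 0 \<longrightarrow> P = 0)"

text \<open>As a subfield of the reals, the generated field contains the rationals.\<close>

definition symmetry_field :: "('g, 'm) monoid_scheme \<Rightarrow> ('g \<Rightarrow> real^2^2) \<Rightarrow> real set" where
  "symmetry_field \<Gamma> \<tau> =
     generate_field ring_of_type_algebra {\<tau> \<gamma> $ a $ b | \<gamma> a b. \<gamma> \<in> carrier \<Gamma>}"

section \<open>Frameworks and rigidity\<close>

definition framework :: "'v set \<Rightarrow> ('v \<Rightarrow> real^2) \<Rightarrow> bool" where
  "framework V p \<longleftrightarrow> inj_on p V"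

definition symmetric_framework ::
    "('g, 'm) monoid_scheme \<Rightarrow> 'v set \<Rightarrow> ('g \<Rightarrow> 'v \<Rightarrow> 'v) \<Rightarrow> ('g \<Rightarrow> real^2^2)
      \<Rightarrow> ('v \<Rightarrow> real^2) \<Rightarrow> bool" where
  "symmetric_framework \<Gamma> V \<theta> \<tau> p \<longleftrightarrow>
     framework V p \<and> (\<forall>\<gamma>\<in>carrier \<Gamma>. \<forall>i\<in>V. \<tau> \<gamma> *v p i = p (\<theta> \<gamma> i))"

definition orbit_representatives ::
    "('g, 'm) monoid_scheme \<Rightarrow> 'v set \<Rightarrow> ('g \<Rightarrow> 'v \<Rightarrow> 'v) \<Rightarrow> 'v set \<Rightarrow> bool" where
  "orbit_representatives \<Gamma> V \<theta> R \<longleftrightarrow>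
     R \<subseteq> V \<and> (\<forall>C\<in>orbits \<Gamma> V \<theta>. \<exists>!r. r \<in> R \<inter> C)"

text \<open>The choice of representatives is immaterial: the coordinates of \<open>p (\<theta> \<gamma> i)\<close> arise from
  those of \<open>p i\<close> by an invertible linear map over the symmetry field.\<close>

definition generic_framework ::
    "('g, 'm) monoid_scheme \<Rightarrow> 'v set \<Rightarrow> ('g \<Rightarrow> 'v \<Rightarrow> 'v) \<Rightarrow> ('g \<Rightarrow> real^2^2)
      \<Rightarrow> ('v \<Rightarrow> real^2) \<Rightarrow> bool" where
  "generic_framework \<Gamma> V \<theta> \<tau> p \<longleftrightarrow>
     symmetric_framework \<Gamma> V \<theta> \<tau> p \<and>
     (\<exists>R. orbit_representatives \<Gamma> V \<theta> R \<and>
        algebraically_independent (symmetry_field \<Gamma> \<tau>) (R \<times> (UNIV :: 2 set))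
          (\<lambda>(i, k). p i $ k))"

definition infinitesimal_motion ::
    "'v set set \<Rightarrow> ('v \<Rightarrow> real^2) \<Rightarrow> ('v \<Rightarrow> real^2) \<Rightarrow> bool" where
  "infinitesimal_motion E p u \<longleftrightarrow> (\<forall>i j. {i, j} \<in> E \<longrightarrow> (p i - p j) \<bullet> (u i - u j) = 0)"

definition trivial_motion ::
    "'v set \<Rightarrow> ('v \<Rightarrow> real^2) \<Rightarrow> ('v \<Rightarrow> real^2) \<Rightarrow> bool" where
  "trivial_motion V p u \<longleftrightarrow>
     (\<exists>(S :: real^2^2) t. transpose S = - S \<and> (\<forall>i\<in>V. u i = S *v p i + t))"

definition infinitesimally_rigid ::
    "'v set \<Rightarrow> 'v set set \<Rightarrow> ('v \<Rightarrow> real^2) \<Rightarrow> bool" where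
  "infinitesimally_rigid V E p \<longleftrightarrow>
     (\<forall>u. infinitesimal_motion E p u \<longrightarrow> trivial_motion V p u)"

end

theory Submission
  imports Defs
begin

text \<open>
  Let \<open>s\<close> be the non-trivial symmetry, acting on the vertices as a free involution and on the plane as
  \<open>\<rho>\<close>, a reflection or the half-turn. An infinitesimal motion \<open>u\<close> is the sum of a symmetric part, with
  \<open>u (s v) = \<rho> (u v)\<close>, and an antisymmetric part, with \<open>u (s v) = - \<rho> (u v)\<close>, and both are motions of the
  graph without the fixed edges. So there are four kinds of motion to control.

  Two of them are parallel redrawings. For symmetric motions under the half-turn and antisymmetric motions
  under a reflection, the velocities turned by a right angle have the same symmetry as the
  configuration, and the motion condition says that \<open>w i - w j\<close> is a multiple of \<open>p i - p j\<close> on every edge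
  \<open>{i, j}\<close>. The claim is that such a \<open>w\<close> is a dilation followed by a translation (\<open>redrawing_trivial\<close>).
  The argument follows Lovasz and Yemini. Call the multiplier of an edge its slope, and split the
  edges into blocks, the connected pieces of the classes of edges on which all redrawings have equal
  slopes. A load on a block is a system of vectors on its vertices, respecting the symmetry, that
  annihilates every redrawing of the block with one slope: its total is zero and it is orthogonal to
  \<open>p\<close>. Genericity makes the loads on different blocks independent
  (\<open>balanced_loads_zero\<close>): a redrawing of \<open>p\<close> extends to a polynomial family of redrawings with the same
  blocks (\<open>redrawing_family\<close>), and pairing a relation between loads with this family, while \<open>p\<close> moves in
  an arbitrary direction, shows that multiplying each load by the slope of its block
  gives another relation; such relations separate the blocks. As every load is orthogonal to \<open>p\<close>, the
  dimensions of the spaces of loads add up to less than the number of coordinates of a symmetric configuration.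
  On the other hand, a discharging argument (\<open>block_count\<close>) shows that in a 7-mixed-connected graph
  the dimensions add up to at least this number, unless some block contains all vertices. Then all
  of the graph is redrawn with a single slope.

  The other two kinds, symmetric motions under a reflection and antisymmetric motions under the
  half-turn, reduce to these. In coordinates along and across the mirror, the projective map
  \<open>(a, b) \<mapsto> (a / b, 1 / b)\<close> conjugates the reflection into the half-turn, and it carries
  infinitesimal motions of a framework to infinitesimal motions of its image, preserving their
  symmetry type. Hence the motions in question are constant at the image of a generic configuration. That only
  constant motions exist is the non-vanishing of a polynomial, so it passes from this one
  configuration to every generic one (\<open>kernel_trivial_at_generic\<close>).
\<close>

(* The notation of the n-th coefficient of a power series would make vector components ambiguous. *)
no_notation fps_nth (infixl \<open>$\<close> 75)

section \<open>Polynomial functions of a configuration and generic configurations\<close>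

text \<open>Functions instead of formal polynomials: only values are ever compared, and closure under sums and
  products becomes part of the definition. The set \<open>K\<close> holds the admitted constants and \<open>R\<close> the vertices
  whose coordinates may occur.\<close>

inductive_set polynomial_functions ::
    "real set \<Rightarrow> 'v set \<Rightarrow> (('v \<Rightarrow> real^2) \<Rightarrow> real) set" for K R where
  const: "c \<in> K \<Longrightarrow> (\<lambda>_. c) \<in> polynomial_functions K R"
| coord: "i \<in> R \<Longrightarrow> (\<lambda>x. x i $ k) \<in> polynomial_functions K R"
| add: "f \<in> polynomial_functions K R \<Longrightarrow> g \<in> polynomial_functions K R
    \<Longrightarrow> (\<lambda>x. f x + g x) \<in> polynomial_functions K R"
| mult: "f \<in> polynomial_functions K R \<Longrightarrow> g \<in> polynomial_functions K R
    \<Longrightarrow> (\<lambda>x. f x * g x) \<in> polynomial_functions K R"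

definition generic_over :: "real set \<Rightarrow> 'v set \<Rightarrow> ('v \<Rightarrow> real^2) \<Rightarrow> bool" where
  "generic_over K R a \<longleftrightarrow> (\<forall>f\<in>polynomial_functions K R. f a = 0 \<longrightarrow> (\<forall>x. f x = 0))"

lemma polynomial_functions_diff:
  assumes "-1 \<in> K" "f \<in> polynomial_functions K R" "g \<in> polynomial_functions K R"
  shows "(\<lambda>x. f x - g x) \<in> polynomial_functions K R"
proof -
  have "(\<lambda>x. f x + (-1) * g x) \<in> polynomial_functions K R"
    by (intro polynomial_functions.add polynomial_functions.mult polynomial_functions.const assms)
  then show ?thesis by simp
qed

lemma polynomial_functions_sum:
  assumes "0 \<in> K" "\<And>i. i \<in> A \<Longrightarrow> f i \<in> polynomial_functions K R"
  shows "(\<lambda>x. \<Sum>i\<in>A. f i x) \<in> polynomial_functions K R"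
  using assms(2)
proof (induction A rule: infinite_finite_induct)
  case (insert i A)
  then have "(\<lambda>x. f i x + (\<Sum>i\<in>A. f i x)) \<in> polynomial_functions K R"
    by (intro polynomial_functions.add) auto
  with insert show ?case by simp
qed (auto intro: polynomial_functions.const assms)

lemma polynomial_functions_mono:
  assumes "f \<in> polynomial_functions K R" "K \<subseteq> L"
  shows "f \<in> polynomial_functions L R"
  using assms by (induction) (auto intro: polynomial_functions.intros)

lemma polynomial_functions_continuous_line:
  assumes "f \<in> polynomial_functions K R"
  shows "continuous_on UNIV (\<lambda>t::real. f (\<lambda>i. a i + t *\<^sub>R d i))"
  using assms
  by induction (auto intro!: continuous_intros)

subsection \<open>Algebraic independence\<close>

definition monomial_value :: "('i \<Rightarrow> real) \<Rightarrow> ('i \<Rightarrow>\<^sub>0 nat) \<Rightarrow> real" where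
  "monomial_value a m = (\<Prod>i\<in>Poly_Mapping.keys m. a i ^ Poly_Mapping.lookup m i)"

lemma monomial_value_superset:
  assumes "finite S" "Poly_Mapping.keys m \<subseteq> S"
  shows "monomial_value a m = (\<Prod>i\<in>S. a i ^ Poly_Mapping.lookup m i)"
  unfolding monomial_value_def
  by (rule prod.mono_neutral_left) (use assms in \<open>auto simp: in_keys_iff\<close>)

lemma monomial_value_add:
  "monomial_value a (m + n) = monomial_value a m * monomial_value a n"
proof -
  let ?S = "Poly_Mapping.keys m \<union> Poly_Mapping.keys n"
  have "Poly_Mapping.keys (m + n) \<subseteq> ?S" by (rule keys_add)
  then show ?thesis
    by (simp add: monomial_value_superset[of ?S] lookup_add power_add prod.distrib)
qed

lemma mpoly_eval_superset:
  assumes "finite S" "Poly_Mapping.keys P \<subseteq> S"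
  shows "mpoly_eval a P = (\<Sum>m\<in>S. Poly_Mapping.lookup P m * monomial_value a m)"
  unfolding mpoly_eval_def monomial_value_def
  by (rule sum.mono_neutral_left) (use assms in \<open>auto simp: in_keys_iff\<close>)

lemma mpoly_eval_add: "mpoly_eval a (P + Q) = mpoly_eval a P + mpoly_eval a Q"
proof -
  let ?S = "Poly_Mapping.keys P \<union> Poly_Mapping.keys Q"
  have "Poly_Mapping.keys (P + Q) \<subseteq> ?S" by (rule keys_add)
  then show ?thesis
    by (simp add: mpoly_eval_superset[of ?S] lookup_add distrib_right sum.distrib)
qed

lemma mpoly_eval_zero: "mpoly_eval a 0 = 0"
  by (simp add: mpoly_eval_def)

lemma mpoly_eval_sum: "mpoly_eval a (\<Sum>i\<in>A. P i) = (\<Sum>i\<in>A. mpoly_eval a (P i))"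
  by (induction A rule: infinite_finite_induct) (auto simp: mpoly_eval_add mpoly_eval_zero)

lemma mpoly_eval_single:
  "mpoly_eval a (Poly_Mapping.single m c) = c * monomial_value a m"
  by (cases "c = 0") (auto simp: mpoly_eval_def monomial_value_def)

lemma poly_mapping_eq_sum_single:
  "P = (\<Sum>m\<in>Poly_Mapping.keys P. Poly_Mapping.single m (Poly_Mapping.lookup P m))"
  by (rule poly_mapping_eqI) (auto simp: lookup_sum lookup_single when_def in_keys_iff)

text \<open>The product written out over pairs of monomials; reading off values and coefficients of a product
  from this form avoids the convolution in its definition.\<close>

lemma poly_mapping_mult_eq_sum_single:
  fixes P Q :: "('i \<Rightarrow>\<^sub>0 nat) \<Rightarrow>\<^sub>0 real"
  shows "P * Q = (\<Sum>m\<in>Poly_Mapping.keys P. \<Sum>n\<in>Poly_Mapping.keys Q.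
    Poly_Mapping.single (m + n) (Poly_Mapping.lookup P m * Poly_Mapping.lookup Q n))"
  by (subst poly_mapping_eq_sum_single[of P], subst poly_mapping_eq_sum_single[of Q])
     (simp only: sum_product mult_single)

lemma mpoly_eval_mult: "mpoly_eval a (P * Q) = mpoly_eval a P * mpoly_eval a Q"
  by (subst poly_mapping_mult_eq_sum_single)
     (simp add: mpoly_eval_sum mpoly_eval_single monomial_value_add sum_product
       mpoly_eval_superset[of "Poly_Mapping.keys P"]
       mpoly_eval_superset[of "Poly_Mapping.keys Q"] mult_ac)

text \<open>The link to formal polynomials: evaluation is a ring homomorphism, so induction over the
  construction of the function yields a representing polynomial. Closure of \<open>K\<close> keeps its coefficients in \<open>K\<close>.\<close>

lemma polynomial_functions_mpoly:
  assumes K: "0 \<in> K" "1 \<in> K"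
    "\<And>c d. c \<in> K \<Longrightarrow> d \<in> K \<Longrightarrow> c + d \<in> K" "\<And>c d. c \<in> K \<Longrightarrow> d \<in> K \<Longrightarrow> c * d \<in> K"
    and f: "f \<in> polynomial_functions K R"
  shows "\<exists>P. (\<forall>m. Poly_Mapping.lookup P m \<in> K) \<and>
     (\<forall>m\<in>Poly_Mapping.keys P. Poly_Mapping.keys m \<subseteq> R \<times> (UNIV :: 2 set)) \<and>
     (\<forall>x. f x = mpoly_eval (\<lambda>(i, k). x i $ k) P)"
  using f
proof induction
  case (const c)
  then show ?case using K
    by (intro exI[of _ "Poly_Mapping.single 0 c"])
       (auto simp: mpoly_eval_single monomial_value_def lookup_single when_def split: if_splits)
next
  case (coord i k)
  then show ?case using K
    by (intro exI[of _ "Poly_Mapping.single (Poly_Mapping.single (i, k) 1) 1"])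
       (auto simp: mpoly_eval_single monomial_value_def lookup_single when_def split: if_splits)
next
  case (add f g)
  then obtain P Q where
    P: "\<forall>m. Poly_Mapping.lookup P m \<in> K"
      "\<forall>m\<in>Poly_Mapping.keys P. Poly_Mapping.keys m \<subseteq> R \<times> (UNIV :: 2 set)"
      "\<forall>x. f x = mpoly_eval (\<lambda>(i, k). x i $ k) P" and
    Q: "\<forall>m. Poly_Mapping.lookup Q m \<in> K"
      "\<forall>m\<in>Poly_Mapping.keys Q. Poly_Mapping.keys m \<subseteq> R \<times> (UNIV :: 2 set)"
      "\<forall>x. g x = mpoly_eval (\<lambda>(i, k). x i $ k) Q"
    by blast
  have "\<forall>m\<in>Poly_Mapping.keys (P + Q). Poly_Mapping.keys m \<subseteq> R \<times> (UNIV :: 2 set)"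
    using P(2) Q(2) keys_add[of P Q] by blast
  then show ?case using P Q K
    by (intro exI[of _ "P + Q"]) (auto simp: mpoly_eval_add lookup_add)
next
  case (mult f g)
  then obtain P Q where
    P: "\<forall>m. Poly_Mapping.lookup P m \<in> K"
      "\<forall>m\<in>Poly_Mapping.keys P. Poly_Mapping.keys m \<subseteq> R \<times> (UNIV :: 2 set)"
      "\<forall>x. f x = mpoly_eval (\<lambda>(i, k). x i $ k) P" and
    Q: "\<forall>m. Poly_Mapping.lookup Q m \<in> K"
      "\<forall>m\<in>Poly_Mapping.keys Q. Poly_Mapping.keys m \<subseteq> R \<times> (UNIV :: 2 set)"
      "\<forall>x. g x = mpoly_eval (\<lambda>(i, k). x i $ k) Q"
    by blast
  have "\<forall>m\<in>Poly_Mapping.keys (P * Q). Poly_Mapping.keys m \<subseteq> R \<times> (UNIV :: 2 set)"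
  proof
    fix m assume "m \<in> Poly_Mapping.keys (P * Q)"
    then obtain m1 m2 where m: "m = m1 + m2" "m1 \<in> Poly_Mapping.keys P" "m2 \<in> Poly_Mapping.keys Q"
      using keys_mult[of P Q] by blast
    then show "Poly_Mapping.keys m \<subseteq> R \<times> (UNIV :: 2 set)"
      using P(2) Q(2) keys_add[of m1 m2] by blast
  qed
  moreover have sumK: "sum h A \<in> K" if "\<And>i. i \<in> A \<Longrightarrow> h i \<in> K" for A and h :: "_ \<Rightarrow> real"
    using that by (induction A rule: infinite_finite_induct) (auto intro: K)
  have "Poly_Mapping.lookup (P * Q) m \<in> K" for m
    using P(1) Q(1) unfolding poly_mapping_mult_eq_sum_single lookup_sum
    by (intro sumK) (auto simp: lookup_single when_def intro: K)
  ultimately show ?case using P Q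
    by (intro exI[of _ "P * Q"]) (auto simp: mpoly_eval_mult)
qed

lemma generic_over_if_algebraically_independent:
  assumes "0 \<in> K" "1 \<in> K"
    "\<And>c d. c \<in> K \<Longrightarrow> d \<in> K \<Longrightarrow> c + d \<in> K" "\<And>c d. c \<in> K \<Longrightarrow> d \<in> K \<Longrightarrow> c * d \<in> K"
    and "algebraically_independent K (R \<times> (UNIV :: 2 set)) (\<lambda>(i, k). p i $ k)"
  shows "generic_over K R p"
  unfolding generic_over_def
proof (intro ballI impI allI)
  fix f :: "('a \<Rightarrow> real^2) \<Rightarrow> real" and x
  assume f: "f \<in> polynomial_functions K R" "f p = 0"
  obtain P where P: "\<forall>m. Poly_Mapping.lookup P m \<in> K"
    "\<forall>m\<in>Poly_Mapping.keys P. Poly_Mapping.keys m \<subseteq> R \<times> (UNIV :: 2 set)"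
    "\<forall>x. f x = mpoly_eval (\<lambda>(i, k). x i $ k) P"
    using polynomial_functions_mpoly[OF assms(1-4) f(1)] by blast
  then have "P = 0"
    using assms(5) f(2) unfolding algebraically_independent_def by metis
  then show "f x = 0"
    using P(3) by (simp add: mpoly_eval_zero)
qed

section \<open>Linear systems with polynomial coefficients\<close>

text \<open>Gaussian elimination without division. At a generic point, an entry that vanishes
  vanishes identically; hence the elimination steps that are legitimate at \<open>a\<close> are legitimate for the matrix of
  polynomials, and every kernel vector at \<open>a\<close> is the value of a polynomial family of kernel vectors.
  The real coefficients of the given vector enter the family, which explains the
  coefficient set \<open>UNIV\<close> in the conclusion.\<close>

lemma kernel_extension:
  fixes r :: "'y \<Rightarrow> 'c \<Rightarrow> ('v \<Rightarrow> real^2) \<Rightarrow> real"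
  assumes K: "{0, 1, -1} \<subseteq> K" and a: "generic_over K R a"
    and "finite Y" "finite C"
    and "\<And>y c. y \<in> Y \<Longrightarrow> c \<in> C \<Longrightarrow> r y c \<in> polynomial_functions K R"
    and "\<And>y. y \<in> Y \<Longrightarrow> (\<Sum>c\<in>C. r y c a * u c) = 0"
  shows "\<exists>U. (\<forall>c\<in>C. U c \<in> polynomial_functions UNIV R) \<and>
     (\<forall>y\<in>Y. \<forall>x. (\<Sum>c\<in>C. r y c x * U c x) = 0) \<and> (\<forall>c\<in>C. U c a = u c)"
  using assms(3-)
proof (induction Y arbitrary: C r rule: finite_induct)
  case empty
  show ?case
    by (intro exI[of _ "\<lambda>c _. u c"]) (auto intro: polynomial_functions.const)
next
  case (insert y Y)
  have rP: "r z c \<in> polynomial_functions K R" if "z \<in> insert y Y" "c \<in> C" for z c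
    using insert.prems(2) that by blast
  show ?case
  proof (cases "\<forall>c\<in>C. r y c a = 0")
    case True
    then have "r y c x = 0" if "c \<in> C" for c x
      using a rP[of y c] that unfolding generic_over_def by blast
    moreover obtain U where "\<forall>c\<in>C. U c \<in> polynomial_functions UNIV R"
      "\<forall>y\<in>Y. \<forall>x. (\<Sum>c\<in>C. r y c x * U c x) = 0" "\<forall>c\<in>C. U c a = u c"
      using insert.IH[of C r] insert.prems by auto
    ultimately show ?thesis by (intro exI[of _ U]) auto
  next
    case False
    then obtain j where j: "j \<in> C" "r y j a \<noteq> 0" by blast
    \<comment> \<open>The row \<open>y\<close> has a pivot in column \<open>j\<close>. Cross-multiplication clears this column in the other rows.\<close>
    let ?C = "C - {j}"
    let ?r = "\<lambda>z c x. r y j x * r z c x - r z j x * r y c x"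
    have split: "(\<Sum>c\<in>C. h c) = h j + (\<Sum>c\<in>?C. h c)" for h :: "'c \<Rightarrow> real"
      using j insert.prems(1) by (simp add: sum.remove)
    have "\<exists>U. (\<forall>c\<in>?C. U c \<in> polynomial_functions UNIV R) \<and>
     (\<forall>y\<in>Y. \<forall>x. (\<Sum>c\<in>?C. ?r y c x * U c x) = 0) \<and> (\<forall>c\<in>?C. U c a = u c)"
    proof (rule insert.IH)
      show "?r z c \<in> polynomial_functions K R" if "z \<in> Y" "c \<in> ?C" for z c
        using that rP j K
        by (intro polynomial_functions_diff polynomial_functions.mult) auto
      show "(\<Sum>c\<in>?C. ?r z c a * u c) = 0" if "z \<in> Y" for z
      proof -
        have 1: "(\<Sum>c\<in>?C. r z c a * u c) = - r z j a * u j"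
          using insert.prems(3)[of z] that split[of "\<lambda>c. r z c a * u c"] by simp
        have 2: "(\<Sum>c\<in>?C. r y c a * u c) = - r y j a * u j"
          using insert.prems(3)[of y] split[of "\<lambda>c. r y c a * u c"] by simp
        have "(\<Sum>c\<in>?C. ?r z c a * u c) =
          r y j a * (\<Sum>c\<in>?C. r z c a * u c) - r z j a * (\<Sum>c\<in>?C. r y c a * u c)"
          by (simp add: left_diff_distrib sum_subtractf sum_distrib_left mult.assoc)
        then show ?thesis unfolding 1 2 by simp
      qed
    qed (use insert.prems in auto)
    then obtain U where U: "\<forall>c\<in>?C. U c \<in> polynomial_functions UNIV R"
      "\<forall>y\<in>Y. \<forall>x. (\<Sum>c\<in>?C. ?r y c x * U c x) = 0" "\<forall>c\<in>?C. U c a = u c"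
      by blast
    let ?k = "1 / r y j a"
    \<comment> \<open>Solving row \<open>y\<close> for column \<open>j\<close> needs a division by the pivot. Multiplying the other
      coordinates by the pivot avoids it, and the constant \<open>?k\<close> restores the values at \<open>a\<close>.\<close>
    define W where "W c x = (if c = j then (- ?k) * (\<Sum>c\<in>?C. r y c x * U c x)
      else ?k * (r y j x * U c x))" for c x
    have rP': "r z c \<in> polynomial_functions UNIV R" if "z \<in> insert y Y" "c \<in> C" for z c
      using rP that polynomial_functions_mono[of _ K R UNIV] by blast
    have Wj: "W j = (\<lambda>x. (- ?k) * (\<Sum>c\<in>?C. r y c x * U c x))"
      and Wc: "\<And>c. c \<noteq> j \<Longrightarrow> W c = (\<lambda>x. ?k * (r y j x * U c x))"
      by (auto simp: W_def fun_eq_iff)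
    have sums: "(\<Sum>c\<in>C. r z c x * W c x) = ?k * (\<Sum>c\<in>?C. ?r z c x * U c x)" for z x
    proof -
      have "(\<Sum>c\<in>?C. r z c x * W c x) = (\<Sum>c\<in>?C. r z c x * (?k * (r y j x * U c x)))"
        by (rule sum.cong) (auto simp: W_def)
      then have "(\<Sum>c\<in>C. r z c x * W c x) = r z j x * ((- ?k) * (\<Sum>c\<in>?C. r y c x * U c x))
          + (\<Sum>c\<in>?C. r z c x * (?k * (r y j x * U c x)))"
        by (simp add: split Wj)
      also have "\<dots> = ?k * (\<Sum>c\<in>?C. ?r z c x * U c x)"
        by (simp add: left_diff_distrib right_diff_distrib sum_subtractf sum_distrib_left mult_ac
            sum_divide_distrib sum_negf)
      finally show ?thesis .
    qed
    show ?thesis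
    proof (intro exI[of _ W] conjI ballI allI)
      fix c assume c: "c \<in> C"
      show "W c \<in> polynomial_functions UNIV R"
      proof (cases "c = j")
        case True
        then show ?thesis unfolding True Wj
          by (intro polynomial_functions.mult polynomial_functions_sum
              polynomial_functions.const) (use rP' U(1) in auto)
      next
        case False
        then show ?thesis unfolding Wc[OF False]
          by (intro polynomial_functions.mult polynomial_functions.const) (use rP' U(1) c j in auto)
      qed
      show "W c a = u c"
      proof (cases "c = j")
        case True
        have "(\<Sum>c\<in>?C. r y c a * U c a) = (\<Sum>c\<in>?C. r y c a * u c)"
          by (rule sum.cong) (use U(3) in auto)
        also have "\<dots> = - r y j a * u j"
          using insert.prems(3)[of y] split[of "\<lambda>c. r y c a * u c"] by simp
        finally show ?thesis using True j by (simp add: Wj)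
      next
        case False
        then show ?thesis using U(3) c j by (simp add: Wc)
      qed
    next
      fix z x assume "z \<in> insert y Y"
      then show "(\<Sum>c\<in>C. r z c x * W c x) = 0"
        unfolding sums using U(2) by (auto simp: mult_ac)
    qed
  qed
qed

text \<open>Triviality of the kernel at a single point \<open>x\<close> forces it at the generic point \<open>a\<close>: this is lower
  semicontinuity of the rank. The proof eliminates one column at a time. A pivot exists at
  \<open>x\<close>, as otherwise a unit vector would lie in the kernel there, and a polynomial that is non-zero at
  \<open>x\<close> is non-zero at \<open>a\<close>.\<close>

lemma kernel_trivial_at_generic:
  fixes r :: "'y \<Rightarrow> 'c \<Rightarrow> ('v \<Rightarrow> real^2) \<Rightarrow> real"
  assumes K: "{0, 1, -1} \<subseteq> K" and a: "generic_over K R a"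
    and "finite C"
    and "\<And>y c. y \<in> Y \<Longrightarrow> c \<in> C \<Longrightarrow> r y c \<in> polynomial_functions K R"
    and "\<And>w. (\<And>y. y \<in> Y \<Longrightarrow> (\<Sum>c\<in>C. r y c x * w c) = 0) \<Longrightarrow> \<forall>c\<in>C. w c = 0"
    and "\<And>y. y \<in> Y \<Longrightarrow> (\<Sum>c\<in>C. r y c a * u c) = 0"
  shows "\<forall>c\<in>C. u c = 0"
  using assms(3-)
proof (induction C arbitrary: r rule: finite_induct)
  case empty
  then show ?case by simp
next
  case (insert j C)
  have rP: "r z c \<in> polynomial_functions K R" if "z \<in> Y" "c \<in> insert j C" for z c
    using insert.prems(1) that by blast
  have "\<exists>y\<in>Y. r y j x \<noteq> 0"
  proof (rule ccontr)
    assume "\<not> ?thesis"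
    then have "(\<Sum>c\<in>insert j C. r y c x * (if c = j then 1 else 0)) = 0" if "y \<in> Y" for y
      using that insert.hyps by (auto intro!: sum.neutral)
    then show False
      using insert.prems(2)[of "\<lambda>c. if c = j then 1 else 0"] by auto
  qed
  then obtain y where y: "y \<in> Y" "r y j x \<noteq> 0" by blast
  then have ya: "r y j a \<noteq> 0"
    using a rP[of y j] unfolding generic_over_def by blast
  let ?r = "\<lambda>z c x. r y j x * r z c x - r z j x * r y c x"
  have lin: "(\<Sum>c\<in>C. ?r z c x * w c) =
    r y j x * (\<Sum>c\<in>C. r z c x * w c) - r z j x * (\<Sum>c\<in>C. r y c x * w c)" for z x w
    by (simp add: left_diff_distrib sum_subtractf sum_distrib_left mult.assoc)
  have "\<forall>c\<in>C. u c = 0"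
  proof (rule insert.IH)
    show "?r z c \<in> polynomial_functions K R" if "z \<in> Y" "c \<in> C" for z c
      using that rP y K by (intro polynomial_functions_diff polynomial_functions.mult) auto
    show "\<forall>c\<in>C. w c = 0" if w: "\<And>z. z \<in> Y \<Longrightarrow> (\<Sum>c\<in>C. ?r z c x * w c) = 0" for w
    proof -
      let ?w = "\<lambda>c. if c = j then - (\<Sum>c\<in>C. r y c x * w c) / r y j x else w c"
      have eq: "(\<Sum>c\<in>C. r z c x * ?w c) = (\<Sum>c\<in>C. r z c x * w c)" for z
        by (rule sum.cong) (use insert.hyps in auto)
      have "(\<Sum>c\<in>insert j C. r z c x * ?w c) = 0" if "z \<in> Y" for z
        using w[OF that] y insert.hyps unfolding lin
        by (simp add: eq field_simps)
      then have "\<forall>c\<in>insert j C. ?w c = 0"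
        by (rule insert.prems(2))
      then show ?thesis using insert.hyps by (auto split: if_splits)
    qed
    show "(\<Sum>c\<in>C. ?r z c a * u c) = 0" if "z \<in> Y" for z
    proof -
      have "(\<Sum>c\<in>C. r z c a * u c) = - r z j a * u j" "(\<Sum>c\<in>C. r y c a * u c) = - r y j a * u j"
        using insert.prems(3)[OF that] insert.prems(3)[OF y(1)] insert.hyps by auto
      then show ?thesis unfolding lin by simp
    qed
  qed
  moreover from this have "u j = 0"
    using insert.prems(3)[OF y(1)] insert.hyps ya by auto
  ultimately show ?case by simp
qed

definition unit_velocity :: "'v \<times> 2 \<Rightarrow> 'v \<Rightarrow> real^2" where
  "unit_velocity c i = (if i = fst c then axis (snd c) 1 else 0)"

text \<open>The last conjunct says that the form depends on the values on \<open>R\<close> only; so for finite \<open>R\<close> it is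
  determined by its values on unit velocities.\<close>

definition linear_form_on :: "'v set \<Rightarrow> (('v \<Rightarrow> real^2) \<Rightarrow> real) \<Rightarrow> bool" where
  "linear_form_on R L \<longleftrightarrow>
     (\<forall>u w. L (\<lambda>i. u i + w i) = L u + L w) \<and> (\<forall>k u. L (\<lambda>i. k *\<^sub>R u i) = k * L u) \<and>
     (\<forall>u w. (\<forall>i\<in>R. u i = w i) \<longrightarrow> L u = L w)"

lemma linear_form_on_simps:
  assumes "linear_form_on R L"
  shows "L (\<lambda>i. u i + w i) = L u + L w" "L (\<lambda>i. k *\<^sub>R u i) = k * L u" "L (\<lambda>i. 0) = 0"
proof -
  show "L (\<lambda>i. u i + w i) = L u + L w" using assms unfolding linear_form_on_def by blast
  have scale: "L (\<lambda>i. k *\<^sub>R u i) = k * L u" for k u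
    using assms unfolding linear_form_on_def by blast
  then show "L (\<lambda>i. k *\<^sub>R u i) = k * L u" .
  show "L (\<lambda>i. 0) = 0" using scale[of 0 "\<lambda>_. 0"] by simp
qed

lemma linear_form_on_cong:
  assumes "linear_form_on R L" "\<And>i. i \<in> R \<Longrightarrow> u i = w i"
  shows "L u = L w"
  using assms unfolding linear_form_on_def by blast

lemma linear_form_on_sum:
  assumes "linear_form_on R L"
  shows "L (\<lambda>i. \<Sum>c\<in>A. h c *\<^sub>R u c i) = (\<Sum>c\<in>A. h c * L (u c))"
  by (induction A rule: infinite_finite_induct)
     (simp_all add: linear_form_on_simps[OF assms])

lemma sum_unit_velocity:
  assumes "finite R" "i \<in> R"
  shows "(\<Sum>c\<in>R \<times> UNIV. (w (fst c) $ snd c) *\<^sub>R unit_velocity c i) = w i"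
proof -
  have "(\<Sum>c\<in>R \<times> UNIV. (w (fst c) $ snd c) *\<^sub>R unit_velocity c i) =
      (\<Sum>v\<in>R. \<Sum>k\<in>UNIV. (w v $ k) *\<^sub>R (if i = v then axis k 1 else 0))"
    by (simp add: sum.cartesian_product unit_velocity_def case_prod_beta)
  also have "\<dots> = (\<Sum>v\<in>R. if v = i then \<Sum>k\<in>UNIV. (w v $ k) *\<^sub>R axis k 1 else 0)"
    by (rule sum.cong) auto
  also have "\<dots> = (\<Sum>k\<in>UNIV. (w i $ k) *\<^sub>R axis k 1)"
    using assms by simp
  also have "\<dots> = w i"
    by (simp add: vec_eq_iff axis_def sum_2 forall_2)
  finally show ?thesis .
qed

lemma linear_form_on_expand:
  assumes "linear_form_on R L" "finite R"
  shows "L w = (\<Sum>c\<in>R \<times> UNIV. L (unit_velocity c) * w (fst c) $ snd c)"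
proof -
  have "L w = L (\<lambda>i. \<Sum>c\<in>R \<times> UNIV. (w (fst c) $ snd c) *\<^sub>R unit_velocity c i)"
    using sum_unit_velocity[OF assms(2), of _ w] by (intro linear_form_on_cong[OF assms(1)]) simp
  then show ?thesis by (simp add: linear_form_on_sum[OF assms(1)] mult.commute)
qed

lemma kernel_extension_forms:
  fixes L :: "'y \<Rightarrow> ('v \<Rightarrow> real^2) \<Rightarrow> ('v \<Rightarrow> real^2) \<Rightarrow> real"
  assumes K: "{0, 1, -1} \<subseteq> K" and a: "generic_over K R a" and "finite Y" "finite R"
    and L: "\<And>y x. y \<in> Y \<Longrightarrow> linear_form_on R (L y x)"
    and LP: "\<And>y c. y \<in> Y \<Longrightarrow> (\<lambda>x. L y x (unit_velocity c)) \<in> polynomial_functions K R"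
    and w: "\<And>y. y \<in> Y \<Longrightarrow> L y a w = 0"
  obtains U where "\<And>v k. v \<in> R \<Longrightarrow> (\<lambda>x. U x v $ k) \<in> polynomial_functions UNIV R"
    and "\<And>y x. y \<in> Y \<Longrightarrow> L y x (U x) = 0" and "\<And>v. v \<in> R \<Longrightarrow> U a v = w v"
proof -
  let ?C = "R \<times> (UNIV :: 2 set)"
  have "\<exists>U. (\<forall>c\<in>?C. U c \<in> polynomial_functions UNIV R) \<and>
     (\<forall>y\<in>Y. \<forall>x. (\<Sum>c\<in>?C. L y x (unit_velocity c) * U c x) = 0) \<and>
     (\<forall>c\<in>?C. U c a = w (fst c) $ snd c)"
    using assms by (intro kernel_extension[OF K a]) (auto simp: linear_form_on_expand[symmetric])
  then obtain U where U: "\<forall>c\<in>?C. U c \<in> polynomial_functions UNIV R"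
    "\<forall>y\<in>Y. \<forall>x. (\<Sum>c\<in>?C. L y x (unit_velocity c) * U c x) = 0"
    "\<forall>c\<in>?C. U c a = w (fst c) $ snd c" by blast
  show ?thesis
  proof (rule that[of "\<lambda>x v. \<chi> k. U (v, k) x"])
    show "L y x (\<lambda>v. \<chi> k. U (v, k) x) = 0" if "y \<in> Y" for y x
      using U(2) that by (subst linear_form_on_expand[OF L[OF that] \<open>finite R\<close>]) simp
  qed (use U in \<open>auto simp: vec_eq_iff\<close>)
qed

lemma kernel_trivial_at_generic_forms:
  fixes L :: "'y \<Rightarrow> ('v \<Rightarrow> real^2) \<Rightarrow> ('v \<Rightarrow> real^2) \<Rightarrow> real"
  assumes K: "{0, 1, -1} \<subseteq> K" and a: "generic_over K R a" and "finite R"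
    and L: "\<And>y x. y \<in> Y \<Longrightarrow> linear_form_on R (L y x)"
    and LP: "\<And>y c. y \<in> Y \<Longrightarrow> (\<lambda>x. L y x (unit_velocity c)) \<in> polynomial_functions K R"
    and triv: "\<And>w. (\<And>y. y \<in> Y \<Longrightarrow> L y x w = 0) \<Longrightarrow> \<forall>v\<in>R. w v = 0"
    and w: "\<And>y. y \<in> Y \<Longrightarrow> L y a w = 0"
  shows "\<forall>v\<in>R. w v = 0"
proof -
  let ?C = "R \<times> (UNIV :: 2 set)"
  have "\<forall>c\<in>?C. (\<lambda>c. w (fst c) $ snd c) c = 0"
  proof (rule kernel_trivial_at_generic[OF K a, where Y = Y and x = x
        and r = "\<lambda>y c x. L y x (unit_velocity c)"])
    show "\<forall>c\<in>?C. u c = 0"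
      if u: "\<And>y. y \<in> Y \<Longrightarrow> (\<Sum>c\<in>?C. L y x (unit_velocity c) * u c) = 0" for u
    proof -
      have "L y x (\<lambda>v. \<chi> k. u (v, k)) = 0" if "y \<in> Y" for y
        using u[OF that] by (subst linear_form_on_expand[OF L[OF that] \<open>finite R\<close>]) simp
      from triv[OF this] show ?thesis by (auto simp: vec_eq_iff)
    qed
  qed (use assms in \<open>auto simp: linear_form_on_expand[symmetric]\<close>)
  then show ?thesis by (auto simp: vec_eq_iff)
qed

text \<open>More unknowns than equations, in the only form needed here: equations are given as linear
  functionals of the unknowns and not as coefficient matrices. In the induction step, two solutions of the smaller system that avoid
  different unknowns are combined so as to satisfy the additional equation.\<close>

lemma homogeneous_system_nontrivial_solution:
  fixes Y :: "(('x \<Rightarrow> real) \<Rightarrow> real) set"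
  assumes "finite Y" "finite S" "card Y < card S"
    and "\<And>f c d. f \<in> Y \<Longrightarrow> f (\<lambda>x. c x + d x) = f c + f d"
    and "\<And>f c k. f \<in> Y \<Longrightarrow> f (\<lambda>x. k * c x) = k * f c"
  shows "\<exists>c. (\<exists>x\<in>S. c x \<noteq> 0) \<and> (\<forall>x. x \<notin> S \<longrightarrow> c x = 0) \<and> (\<forall>f\<in>Y. f c = 0)"
  using assms
proof (induction Y arbitrary: S rule: finite_induct)
  case empty
  then obtain x where "x \<in> S" by fastforce
  then show ?case
    by (intro exI[of _ "\<lambda>y. if y = x then 1 else 0"]) auto
next
  case (insert f Y)
  have IH: "\<exists>c. (\<exists>x\<in>S - {x0}. c x \<noteq> 0) \<and> (\<forall>x. x \<notin> S - {x0} \<longrightarrow> c x = 0) \<and> (\<forall>f\<in>Y. f c = 0)"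
    if "x0 \<in> S" for x0
    by (rule insert.IH) (use insert.prems insert.hyps that in auto)
  obtain x0 where "x0 \<in> S" using insert.prems by fastforce
  from IH[OF this] obtain c x1 where
    c: "x1 \<in> S" "c x1 \<noteq> 0" "\<forall>x. x \<notin> S \<longrightarrow> c x = 0" "\<forall>f\<in>Y. f c = 0"
    by blast
  from IH[OF c(1)] obtain d x2 where
    d: "x2 \<in> S" "d x2 \<noteq> 0" "d x1 = 0" "\<forall>x. x \<notin> S \<longrightarrow> d x = 0" "\<forall>f\<in>Y. f d = 0"
    by blast
  show ?case
  proof (cases "f d = 0")
    case True
    then show ?thesis using d by (intro exI[of _ d]) auto
  next
    case False
    let ?e = "\<lambda>x. c x + (- f c / f d) * d x"
    have lin: "G ?e = G c + (- f c / f d) * G d" if "G \<in> insert f Y" for G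
      using insert.prems(3)[OF that, of c "\<lambda>x. (- f c / f d) * d x"]
        insert.prems(4)[OF that, of "- f c / f d" d] by simp
    have "\<forall>G\<in>insert f Y. G ?e = 0"
    proof
      fix G assume G: "G \<in> insert f Y"
      have "G c + (- f c / f d) * G d = 0" using False c d G by auto
      with lin[OF G] show "G ?e = 0" by simp
    qed
    moreover have "\<exists>x\<in>S. ?e x \<noteq> 0" using c d by (intro bexI[of _ x1]) auto
    ultimately show ?thesis using c d by (intro exI[of _ ?e]) auto
  qed
qed

section \<open>Counting in mixed-connected graphs with a free involution\<close>

text \<open>A choice of one element from each two-element orbit, built up orbit by orbit.\<close>

lemma involution_transversal:
  assumes "finite A" "\<And>x. x \<in> A \<Longrightarrow> f x \<in> A" "\<And>x. x \<in> A \<Longrightarrow> f (f x) = x"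
    "\<And>x. x \<in> A \<Longrightarrow> f x \<noteq> x"
  shows "\<exists>T\<subseteq>A. A = T \<union> f ` T \<and> T \<inter> f ` T = {} \<and> card A = 2 * card T"
  using assms
proof (induction A rule: finite_psubset_induct)
  case (psubset A)
  show ?case
  proof (cases "A = {}")
    case False
    then obtain x where x: "x \<in> A" by blast
    let ?A = "A - {x, f x}"
    have fx: "f x \<in> A" "f (f x) = x" "f x \<noteq> x" using psubset.prems x by auto
    have "f y \<noteq> x" "f y \<noteq> f x" if "y \<in> ?A" for y
      using psubset.prems(2)[of y] fx that by auto
    then have "\<exists>T\<subseteq>?A. ?A = T \<union> f ` T \<and> T \<inter> f ` T = {} \<and> card ?A = 2 * card T"
      using x psubset.prems by (intro psubset.IH) auto
    then obtain T where T: "T \<subseteq> ?A" "?A = T \<union> f ` T" "T \<inter> f ` T = {}" "card ?A = 2 * card T"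
      by blast
    have "finite T" using T(1) psubset.hyps(1) finite_subset by blast
    moreover have A: "A = insert x (insert (f x) ?A)" using x fx by auto
    moreover have "card ?A = card A - 2" "2 \<le> card A"
      using card_Diff_subset[of "{x, f x}" A] card_mono[of A "{x, f x}"] psubset.hyps(1) x fx by auto
    moreover from this have "card A = Suc (Suc (card ?A))" by simp
    moreover have "A = insert x T \<union> f ` insert x T" using T(2) A by auto
    moreover have "insert x T \<inter> f ` insert x T = {}" using T(1-3) fx by auto
    moreover have "x \<notin> T" using T(1) by auto
    ultimately show ?thesis using T x
      by (intro exI[of _ "insert x T"]) auto
  qed simp
qed

lemma even_card_involution:
  assumes "finite A" "\<And>x. x \<in> A \<Longrightarrow> f x \<in> A" "\<And>x. x \<in> A \<Longrightarrow> f (f x) = x"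
    "\<And>x. x \<in> A \<Longrightarrow> f x \<noteq> x"
  shows "even (card A)"
  using involution_transversal[OF assms] by auto

lemma sum_incidences:
  fixes w :: "'v \<Rightarrow> real"
  assumes "finite \<C>" "finite V" "\<And>B. B \<in> \<C> \<Longrightarrow> N B \<subseteq> V"
  shows "(\<Sum>B\<in>\<C>. \<Sum>v\<in>N B. w v) = (\<Sum>v\<in>V. real (card {B\<in>\<C>. v \<in> N B}) * w v)"
proof -
  have "(\<Sum>B\<in>\<C>. \<Sum>v\<in>N B. w v) = (\<Sum>B\<in>\<C>. \<Sum>v\<in>V. if v \<in> N B then w v else 0)"
  proof (rule sum.cong[OF refl])
    fix B assume "B \<in> \<C>"
    then show "(\<Sum>v\<in>N B. w v) = (\<Sum>v\<in>V. if v \<in> N B then w v else 0)"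
      by (intro sum.mono_neutral_cong_left) (use assms in auto)
  qed
  also have "\<dots> = (\<Sum>v\<in>V. \<Sum>B\<in>\<C>. if v \<in> N B then w v else 0)"
    by (rule sum.swap)
  also have "\<dots> = (\<Sum>v\<in>V. real (card {B\<in>\<C>. v \<in> N B}) * w v)"
    using assms(1) by (intro sum.cong) (auto simp: sum.If_cases Int_def)
  finally show ?thesis .
qed

text \<open>The graph to which connectivity applies: fixed edges are removed, so the involution acts freely on
  the edges as well.\<close>

locale free_involution_graph =
  fixes V :: "'v set" and E :: "'v set set" and s :: "'v \<Rightarrow> 'v"
  assumes finite_V: "finite V"
    and edge: "e \<in> E \<Longrightarrow> e \<subseteq> V \<and> card e = 2"
    and s_in: "v \<in> V \<Longrightarrow> s v \<in> V"
    and s_s: "v \<in> V \<Longrightarrow> s (s v) = v"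
    and s_free: "v \<in> V \<Longrightarrow> s v \<noteq> v"
    and s_edge: "e \<in> E \<Longrightarrow> s ` e \<in> E"
    and s_no_fixed_edge: "e \<in> E \<Longrightarrow> s ` e \<noteq> e"
begin

lemma finite_E: "finite E"
  using finite_V edge by (meson PowI finite_Pow_iff finite_subset subsetI)

lemma edge_cases:
  assumes "e \<in> E"
  obtains i j where "e = {i, j}" "i \<noteq> j" "j \<noteq> s i" "i \<in> V" "j \<in> V"
proof -
  obtain i j where ij: "e = {i, j}" "i \<noteq> j"
    using edge[OF assms] by (auto simp: card_2_iff)
  then have "i \<in> V" "j \<in> V" using edge[OF assms] by auto
  moreover have "j \<noteq> s i"
    using s_no_fixed_edge[OF assms] ij s_s \<open>i \<in> V\<close> by auto
  ultimately show ?thesis using that ij by blast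
qed

lemma s_s_edge: "e \<in> E \<Longrightarrow> s ` s ` e = e"
proof -
  assume "e \<in> E"
  then have "\<forall>v\<in>e. s (s v) = v" using edge s_s by blast
  then show ?thesis by (force simp: image_image)
qed

end

locale mixed_7_connected_graph = free_involution_graph +
  assumes mixed: "mixed_connected 7 V E"
begin

text \<open>How mixed connectivity is used: a non-empty set \<open>S\<close> that no edge leaves after deleting \<open>W\<close> and \<open>F\<close>,
  and that does not exhaust the remaining vertices, makes the deletion expensive.\<close>

lemma mixed_cut:
  assumes "W \<subseteq> V" "F \<subseteq> E" "S \<subseteq> V - W" "x \<in> S" "y \<in> V - W - S"
    and closed: "\<And>a b. a \<in> S \<Longrightarrow> {a, b} \<in> E \<Longrightarrow> {a, b} \<inter> W = {} \<Longrightarrow> {a, b} \<notin> F \<Longrightarrow> b \<in> S"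
  shows "7 \<le> 2 * card W + card F"
proof (rule ccontr)
  assume "\<not> ?thesis"
  moreover have "finite W" "finite F"
    using assms(1,2) finite_V finite_E finite_subset by blast+
  ultimately have "connected_graph (V - W) ({e \<in> E. e \<inter> W = {}} - F)"
    using mixed assms(1,2) unfolding mixed_connected_def by auto
  then have "(x, y) \<in> {(a, b). {a, b} \<in> {e \<in> E. e \<inter> W = {}} - F}\<^sup>*"
    using assms(3-5) unfolding connected_graph_def by blast
  then have "y \<in> S"
    using assms(4) by induction (use closed in auto)
  then show False using assms(5) by simp
qed

lemma degree_ge_7:
  assumes "v \<in> V"
  shows "7 \<le> card {e \<in> E. v \<in> e}"
proof -
  have "7 \<le> 2 * card ({} :: 'a set) + card {e \<in> E. v \<in> e}"
    by (rule mixed_cut[of "{}" _ "{v}" v "s v"]) (use assms s_in s_free in auto)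
  then show ?thesis by simp
qed

end

text \<open>The abstract situation of the count. A block and its mirror image are equal or
  vertex-disjoint; blocks with the first property are called invariant.\<close>

locale symmetric_edge_partition = mixed_7_connected_graph +
  fixes \<B> :: "'a set set set"
  assumes Union_\<B>: "\<Union>\<B> = E"
    and \<B>_disjoint: "B \<in> \<B> \<Longrightarrow> C \<in> \<B> \<Longrightarrow> e \<in> B \<Longrightarrow> e \<in> C \<Longrightarrow> B = C"
    and \<B>_nonempty: "B \<in> \<B> \<Longrightarrow> B \<noteq> {}"
    and \<B>_image: "B \<in> \<B> \<Longrightarrow> (`) s ` B \<in> \<B>"
    and \<B>_separated: "B \<in> \<B> \<Longrightarrow> (`) s ` B \<noteq> B \<Longrightarrow> \<Union>B \<inter> \<Union>((`) s ` B) = {}"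
begin

lemma block_edge: "B \<in> \<B> \<Longrightarrow> e \<in> B \<Longrightarrow> e \<in> E"
  using Union_\<B> by blast

lemma finite_\<B>: "finite \<B>"
  using finite_E Union_\<B> finite_UnionD by blast

lemma block_vertices: "B \<in> \<B> \<Longrightarrow> \<Union>B \<subseteq> V"
  using block_edge edge by blast

lemma finite_block_vertices: "B \<in> \<B> \<Longrightarrow> finite (\<Union>B)"
  using block_vertices finite_V finite_subset by blast

lemma block_image_image: "B \<in> \<B> \<Longrightarrow> (`) s ` (`) s ` B = B"
  using s_s_edge block_edge by (force simp: image_image)

lemma block_image_vertices: "\<Union>((`) s ` B) = s ` \<Union>B"
  by blast

definition big :: "'a set set \<Rightarrow> bool" where
  "big B \<longleftrightarrow> B \<in> \<B> \<and> card B \<noteq> 1"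

definition invariant :: "'a set set \<Rightarrow> bool" where
  "invariant B \<longleftrightarrow> (`) s ` B = B"

definition big_degree :: "'a \<Rightarrow> nat" where
  "big_degree v = card {B \<in> \<B>. card B \<noteq> 1 \<and> v \<in> \<Union>B}"

definition single_degree :: "'a \<Rightarrow> nat" where
  "single_degree v = card {B \<in> \<B>. card B = 1 \<and> v \<in> \<Union>B}"

text \<open>The discharging scheme behind the count. A vertex in \<open>d\<close> blocks has the budget \<open>2 * (d - 1)\<close>, and
  each block has to collect \<open>3\<close> from its vertices, or \<open>4\<close> if it is invariant. A vertex pays \<open>3/2\<close> to every
  single-edge block, which settles these blocks, and the charge below to every larger
  block. A vertex in one larger block pays half for each single edge at it, a vertex in
  several of them pays \<open>1\<close>: half of the price of the edges, respectively of the vertex, in a mixed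
  cut that separates the block from the rest of the graph.\<close>

definition charge :: "'a \<Rightarrow> real" where
  "charge v = (if big_degree v \<ge> 2 then 1 else real (single_degree v) / 2)"

lemma single_degree_card:
  "single_degree v = card {e \<in> E. {e} \<in> \<B> \<and> v \<in> e}"
proof -
  have "{B \<in> \<B>. card B = 1 \<and> v \<in> \<Union>B} = (\<lambda>e. {e}) ` {e \<in> E. {e} \<in> \<B> \<and> v \<in> e}"
    using block_edge by (auto simp: card_1_singleton_iff)
  then show ?thesis unfolding single_degree_def by (simp add: card_image)
qed

lemma degree_split:
  "card {B \<in> \<B>. v \<in> \<Union>B} = single_degree v + big_degree v"
proof -
  have "{B \<in> \<B>. v \<in> \<Union>B} =
    {B \<in> \<B>. card B = 1 \<and> v \<in> \<Union>B} \<union> {B \<in> \<B>. card B \<noteq> 1 \<and> v \<in> \<Union>B}" (is "?A = ?B \<union> ?C")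
    by blast
  moreover have "card (?B \<union> ?C) = card ?B + card ?C"
    by (rule card_Un_disjoint) (use finite_\<B> in auto)
  ultimately show ?thesis
    unfolding single_degree_def big_degree_def by simp
qed

text \<open>The payments stay within the budget. Only vertices without larger blocks are
  critical, and these lie in at least seven single-edge blocks, one for each edge at them.\<close>

lemma vertex_charge:
  assumes "v \<in> V"
  shows "3/2 * real (single_degree v) + real (big_degree v) * charge v
    \<le> 2 * real (card {B \<in> \<B>. v \<in> \<Union>B}) - 2"
proof -
  consider "big_degree v = 0" | "big_degree v = 1" | "big_degree v \<ge> 2" by linarith
  then show ?thesis
  proof cases
    case 1
    have "{e} \<in> \<B>" if e: "e \<in> E" "v \<in> e" for e
    proof -
      obtain B where B: "B \<in> \<B>" "e \<in> B" using e Union_\<B> by blast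
      then have "card B = 1"
        using 1 e finite_\<B> unfolding big_degree_def by auto
      then show ?thesis using B by (auto simp: card_1_singleton_iff)
    qed
    then have "{e \<in> E. {e} \<in> \<B> \<and> v \<in> e} = {e \<in> E. v \<in> e}" by blast
    then have "7 \<le> single_degree v"
      using degree_ge_7[OF assms] by (simp add: single_degree_card)
    then show ?thesis using 1 unfolding degree_split by simp
  next
    case 2
    then show ?thesis unfolding degree_split by (simp add: charge_def)
  next
    case 3
    then show ?thesis unfolding degree_split by (simp add: charge_def)
  qed
qed

text \<open>Deleting the boundary vertices of a block and the single edges attached to its other vertices
  isolates these other vertices.\<close>

definition boundary :: "'a set set \<Rightarrow> 'a set" where
  "boundary B = {v \<in> \<Union>B. big_degree v \<ge> 2}"

lemma boundary_subset: "boundary B \<subseteq> \<Union>B"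
  by (auto simp: boundary_def)

definition attached :: "'a set set \<Rightarrow> 'a set set" where
  "attached B = {e \<in> E. {e} \<in> \<B> \<and> e \<inter> (\<Union>B - boundary B) \<noteq> {}}"

lemma block_charge_ge:
  assumes "B \<in> \<B>"
  shows "real (2 * card (boundary B) + card (attached B)) / 2 \<le> (\<Sum>v\<in>\<Union>B. charge v)"
proof -
  let ?I = "\<Union>B - boundary B"
  have fin: "finite ?I" "finite (boundary B)"
    using finite_block_vertices[OF assms] finite_subset[OF boundary_subset] by auto
  have "attached B = (\<Union>v\<in>?I. {e \<in> E. {e} \<in> \<B> \<and> v \<in> e})"
    by (auto simp: attached_def)
  then have "card (attached B) \<le> (\<Sum>v\<in>?I. single_degree v)"
    using fin by (simp add: single_degree_card card_UN_le)
  then have "real (card (attached B)) / 2 \<le> (\<Sum>v\<in>?I. real (single_degree v) / 2)"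
    by (simp add: sum_divide_distrib[symmetric] flip: of_nat_sum)
  also have "\<dots> = (\<Sum>v\<in>?I. charge v)"
    by (rule sum.cong) (auto simp: charge_def boundary_def)
  finally have 1: "real (card (attached B)) / 2 \<le> (\<Sum>v\<in>?I. charge v)" .
  have 2: "(\<Sum>v\<in>boundary B. charge v) = real (card (boundary B))"
    by (simp add: charge_def boundary_def)
  have "(\<Sum>v\<in>\<Union>B. charge v) = (\<Sum>v\<in>boundary B. charge v) + (\<Sum>v\<in>?I. charge v)"
    using finite_block_vertices[OF assms]
    by (subst sum.subset_diff[of "boundary B"]) (auto simp: boundary_def)
  with 1 2 show ?thesis by simp
qed

text \<open>A vertex outside the boundary lies in no other larger block; hence an edge at it
  that is not attached belongs to the block and ends inside it.\<close>

lemma block_cut: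
  assumes "big B" "\<Union>B \<noteq> boundary B" "\<Union>B \<noteq> V"
  shows "7 \<le> 2 * card (boundary B) + card (attached B)"
proof -
  have B: "B \<in> \<B>" "card B \<noteq> 1" using assms(1) by (auto simp: big_def)
  have bsub: "boundary B \<subseteq> \<Union>B" by (auto simp: boundary_def)
  obtain x where x: "x \<in> \<Union>B - boundary B" using assms(2) bsub by blast
  obtain y where y: "y \<in> V - \<Union>B" using assms(3) block_vertices[OF B(1)] by blast
  show ?thesis
  proof (rule mixed_cut[of _ _ "\<Union>B - boundary B" x y])
    fix a b assume a: "a \<in> \<Union>B - boundary B" and ab: "{a, b} \<in> E"
      "{a, b} \<inter> boundary B = {}" "{a, b} \<notin> attached B"
    obtain C where C: "C \<in> \<B>" "{a, b} \<in> C" using ab(1) Union_\<B> by blast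
    have "{{a, b}} \<notin> \<B>" using ab a by (auto simp: attached_def)
    then have "card C \<noteq> 1" using C by (auto simp: card_1_singleton_iff)
    have "big_degree a \<le> 1" using a by (auto simp: boundary_def)
    then have "card {B \<in> \<B>. card B \<noteq> 1 \<and> a \<in> \<Union>B} \<le> Suc 0" by (simp add: big_degree_def)
    then have "\<forall>C\<in>{B \<in> \<B>. card B \<noteq> 1 \<and> a \<in> \<Union>B}. \<forall>D\<in>{B \<in> \<B>. card B \<noteq> 1 \<and> a \<in> \<Union>B}. C = D"
      using finite_\<B> by (subst (asm) card_le_Suc0_iff_eq) auto
    moreover have "B \<in> {B \<in> \<B>. card B \<noteq> 1 \<and> a \<in> \<Union>B}" using B a by blast
    moreover have "C \<in> {B \<in> \<B>. card B \<noteq> 1 \<and> a \<in> \<Union>B}" using C \<open>card C \<noteq> 1\<close> by blast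
    ultimately have "C = B" by blast
    with C ab show "b \<in> \<Union>B - boundary B" by auto
  qed (use x y bsub block_vertices[OF B(1)] in \<open>auto simp: attached_def\<close>)
qed

lemma big_block_vertices:
  assumes "big B"
  shows "3 \<le> card (\<Union>B)"
proof (rule ccontr)
  assume "\<not> ?thesis"
  then have le: "card (\<Union>B) \<le> 2" by simp
  have B: "B \<in> \<B>" "card B \<noteq> 1" using assms by (auto simp: big_def)
  have "e = \<Union>B" if "e \<in> B" for e
  proof (rule card_seteq)
    show "card (\<Union>B) \<le> card e" using le edge[OF block_edge[OF B(1) that]] by simp
  qed (use that finite_block_vertices[OF B(1)] in auto)
  then have "B \<subseteq> {\<Union>B}" by blast
  then have "B = {\<Union>B}" using \<B>_nonempty[OF B(1)] by blast
  then show False using B(2) by (metis is_singletonI is_singleton_altdef)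
qed

lemma invariant_block_big:
  assumes "B \<in> \<B>" "invariant B"
  shows "big B"
proof (rule ccontr)
  assume "\<not> big B"
  then obtain e where "B = {e}" using assms by (auto simp: big_def card_1_singleton_iff)
  then show False
    using assms s_no_fixed_edge[OF block_edge[OF assms(1)], of e] by (auto simp: invariant_def)
qed

lemma invariant_block_vertices_s:
  assumes "B \<in> \<B>" "invariant B" "v \<in> \<Union>B"
  shows "s v \<in> \<Union>B"
  using assms block_image_vertices[of B] unfolding invariant_def by (metis imageI)

lemma big_degree_s:
  assumes "v \<in> V"
  shows "big_degree (s v) = big_degree v"
proof -
  have inj: "inj_on s V" using s_s by (metis inj_onI)
  have card: "card ((`) s ` B) = card B" if "B \<in> \<B>" for B
    using card_image[of "(`) s" B] inj_on_image_Pow[OF inj] block_edge[OF that] edge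
    by (metis PowI inj_on_subset subsetI)
  have sub: "(`) ((`) s) ` {B \<in> \<B>. card B \<noteq> 1 \<and> v \<in> \<Union>B} \<subseteq> {B \<in> \<B>. card B \<noteq> 1 \<and> s v \<in> \<Union>B}"
    for v using card \<B>_image by (force simp: block_image_vertices)
  have injB: "inj_on ((`) ((`) s)) \<B>"
    by (rule inj_on_inverseI[of _ "(`) ((`) s)"]) (rule block_image_image)
  have le: "big_degree v \<le> big_degree (s v)" for v
    unfolding big_degree_def
    by (rule card_inj_on_le[OF _ sub]) (auto intro: inj_on_subset[OF injB] simp: finite_\<B>)
  from le[of v] le[of "s v"] show ?thesis using s_s[OF assms] by simp
qed

text \<open>On an invariant block the involution acts freely on vertices, boundary vertices and attached
  edges. This parity improves the bound \<open>7\<close> of a cut to \<open>8\<close>.\<close>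

lemma invariant_block_even:
  assumes "B \<in> \<B>" "invariant B"
  shows "even (card (boundary B))" "even (card (attached B))" "even (card (\<Union>B))"
proof -
  have V: "v \<in> V" if "v \<in> \<Union>B" for v using block_vertices[OF assms(1)] that by blast
  have bd: "s v \<in> boundary B" if "v \<in> boundary B" for v
    using that invariant_block_vertices_s[OF assms] V by (auto simp: boundary_def big_degree_s)
  show "even (card (\<Union>B))"
    by (rule even_card_involution[of _ s])
      (use finite_block_vertices[OF assms(1)] invariant_block_vertices_s[OF assms] V s_s s_free in auto)
  have bV: "v \<in> V" if "v \<in> boundary B" for v
    using that V boundary_subset by blast
  show "even (card (boundary B))"
    by (rule even_card_involution[of _ s])
      (use finite_subset[OF boundary_subset finite_block_vertices[OF assms(1)]]
        bd bV s_s s_free in auto)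
  show "even (card (attached B))"
  proof (rule even_card_involution[of _ "(`) s"])
    show "finite (attached B)" using finite_E by (auto simp: attached_def)
    fix e assume e: "e \<in> attached B"
    then have eE: "e \<in> E" "{e} \<in> \<B>" by (auto simp: attached_def)
    then show "s ` s ` e = e" "s ` e \<noteq> e" using s_s_edge s_no_fixed_edge by auto
    obtain v where v: "v \<in> e" "v \<in> \<Union>B" "v \<notin> boundary B" using e by (auto simp: attached_def)
    then have "s v \<in> \<Union>B" "s v \<notin> boundary B"
      using invariant_block_vertices_s[OF assms] bd[of "s v"] V s_s by auto
    moreover have "{s ` e} \<in> \<B>" using \<B>_image[OF eE(2)] by simp
    ultimately show "s ` e \<in> attached B"
      using v(1) s_edge[OF eE(1)] by (auto simp: attached_def)
  qed
qed

text \<open>A block with a vertex off the boundary collects half of the cost of a cut, at least \<open>7/2\<close>, or \<open>4\<close> if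
  it is invariant. A block without such a vertex collects \<open>1\<close> from every vertex.\<close>

lemma block_charge:
  assumes "big B" "\<not> (invariant B \<and> \<Union>B = V)"
  shows "(if invariant B then 4 else 3) \<le> (\<Sum>v\<in>\<Union>B. charge v)"
proof -
  have B: "B \<in> \<B>" using assms(1) by (simp add: big_def)
  \<comment> \<open>A block that is not invariant misses the vertices of its mirror image, so the cut separates it from something.\<close>
  have neq: "\<Union>B \<noteq> V" if "\<not> invariant B"
  proof
    assume "\<Union>B = V"
    moreover have "\<Union>B \<inter> s ` \<Union>B = {}"
      using \<B>_separated[OF B] that by (simp add: invariant_def block_image_vertices)
    moreover have "s ` \<Union>B \<subseteq> V" using block_vertices[OF B] s_in by blast
    ultimately have "\<Union>B = {}" by blast
    then have "card (\<Union>B) = 0" by (simp only: card.empty)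
    then show False using big_block_vertices[OF assms(1)] by linarith
  qed
  define k where "k = 2 * card (boundary B) + card (attached B)"
  have k: "real k / 2 \<le> (\<Sum>v\<in>\<Union>B. charge v)"
    unfolding k_def by (rule block_charge_ge[OF B])
  have card3: "3 \<le> card (\<Union>B)" by (rule big_block_vertices[OF assms(1)])
  show ?thesis
  proof (cases "\<Union>B = boundary B")
    case True
    then have "2 * card (\<Union>B) \<le> k" by (simp add: k_def)
    moreover have "4 \<le> card (\<Union>B)" if "invariant B"
      using card3 invariant_block_even(3)[OF B that] by presburger
    ultimately show ?thesis using k card3 by auto
  next
    case False
    then have 7: "7 \<le> k"
      using block_cut[OF assms(1)] assms(2) neq unfolding k_def by blast
    moreover have "8 \<le> k" if "invariant B"
      using 7 invariant_block_even(1,2)[OF B that] unfolding k_def by presburger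
    ultimately show ?thesis using k by auto
  qed
qed

text \<open>Mirror blocks with \<open>n\<close> vertices each will contribute dimension \<open>2 * n - 3\<close> together, and an
  invariant block with \<open>n\<close> vertices dimension \<open>n - 2\<close>; the inequality bounds twice the total from
  below. It holds because the budgets of the vertices cover the deductions. A spanning invariant
  block has to be excluded, as no cut separates it from anything.\<close>

proposition block_count:
  assumes "\<And>B. B \<in> \<B> \<Longrightarrow> invariant B \<Longrightarrow> \<Union>B \<noteq> V"
  shows "2 * card V + 3 * card {B \<in> \<B>. \<not> invariant B} + 4 * card {B \<in> \<B>. invariant B}
    \<le> 2 * (\<Sum>B\<in>\<B>. card (\<Union>B))"
proof -
  let ?S = "{B \<in> \<B>. card B = 1}" and ?L = "{B \<in> \<B>. card B \<noteq> 1}"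
  have singles: "(\<Sum>v\<in>V. real (single_degree v)) = 2 * real (card ?S)"
  proof -
    have "(\<Sum>v\<in>V. real (single_degree v)) = (\<Sum>B\<in>?S. \<Sum>v\<in>\<Union>B. 1)"
      using sum_incidences[of ?S V Union "\<lambda>_. 1"] finite_\<B> finite_V block_vertices
      by (simp add: single_degree_def)
    also have "\<dots> = (\<Sum>B\<in>?S. 2)"
    proof (rule sum.cong)
      fix B assume B: "B \<in> ?S"
      then obtain e where "B = {e}" by (auto simp: card_1_singleton_iff)
      moreover have "e \<in> E" using block_edge[of B e] B \<open>B = {e}\<close> by blast
      then have "card e = 2" using edge by blast
      ultimately show "(\<Sum>v\<in>\<Union>B. 1) = (2 :: real)" by simp
    qed simp
    finally show ?thesis by simp
  qed
  have bigs: "(\<Sum>v\<in>V. real (big_degree v) * charge v) = (\<Sum>B\<in>?L. \<Sum>v\<in>\<Union>B. charge v)"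
    using sum_incidences[of ?L V Union charge] finite_\<B> finite_V block_vertices
    by (simp add: big_degree_def)
  have all: "(\<Sum>v\<in>V. real (card {B \<in> \<B>. v \<in> \<Union>B})) = real (\<Sum>B\<in>\<B>. card (\<Union>B))"
    using sum_incidences[of \<B> V Union "\<lambda>_. 1"] finite_\<B> finite_V block_vertices by simp
  have "3/2 * (\<Sum>v\<in>V. real (single_degree v)) + (\<Sum>v\<in>V. real (big_degree v) * charge v)
    = (\<Sum>v\<in>V. 3/2 * real (single_degree v) + real (big_degree v) * charge v)"
    by (simp add: sum.distrib sum_distrib_left)
  also have "\<dots> \<le> (\<Sum>v\<in>V. 2 * real (card {B \<in> \<B>. v \<in> \<Union>B}) - 2)"
    by (rule sum_mono) (rule vertex_charge)
  also have "\<dots> = 2 * real (\<Sum>B\<in>\<B>. card (\<Union>B)) - 2 * real (card V)"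
    by (simp only: sum_subtractf sum_distrib_left[symmetric] all) simp
  finally have main: "3 * real (card ?S) + (\<Sum>B\<in>?L. \<Sum>v\<in>\<Union>B. charge v)
    \<le> 2 * real (\<Sum>B\<in>\<B>. card (\<Union>B)) - 2 * real (card V)"
    unfolding singles bigs by simp
  let ?I = "{B \<in> \<B>. invariant B}" and ?N = "{B \<in> \<B>. \<not> invariant B}" and ?M = "{B \<in> ?L. \<not> invariant B}"
  have inv_sub: "card B \<noteq> 1" if "B \<in> \<B>" "invariant B" for B
    using invariant_block_big[OF that] by (simp add: big_def)
  have L: "?L = ?I \<union> ?M" "?I \<inter> ?M = {}" and N: "?N = ?S \<union> ?M" "?S \<inter> ?M = {}"
    using inv_sub by blast+
  let ?c = "\<lambda>B. if invariant B then 4 else 3 :: real"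
  have "(\<Sum>B\<in>?I. ?c B) = (\<Sum>B\<in>?I. 4)" "(\<Sum>B\<in>?M. ?c B) = (\<Sum>B\<in>?M. 3)"
    by (rule sum.cong, simp, simp)+
  then have "4 * real (card ?I) + 3 * real (card ?M) = (\<Sum>B\<in>?I. ?c B) + (\<Sum>B\<in>?M. ?c B)"
    by (simp only: sum_constant)
  also have "\<dots> = (\<Sum>B\<in>?I \<union> ?M. ?c B)"
    by (rule sum.union_disjoint[symmetric]) (use finite_\<B> L(2) in auto)
  also have "\<dots> = (\<Sum>B\<in>?L. ?c B)"
    by (simp only: L(1)[symmetric])
  also have "\<dots> \<le> (\<Sum>B\<in>?L. \<Sum>v\<in>\<Union>B. charge v)"
    by (rule sum_mono) (use block_charge assms in \<open>auto simp: big_def\<close>)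
  finally have "4 * real (card ?I) + 3 * real (card ?M) \<le> (\<Sum>B\<in>?L. \<Sum>v\<in>\<Union>B. charge v)" .
  moreover have "card ?N = card ?S + card ?M"
    unfolding N(1) by (rule card_Un_disjoint) (use N(2) finite_\<B> in auto)
  ultimately have "real (2 * card V + 3 * card ?N + 4 * card ?I) \<le> real (2 * (\<Sum>B\<in>\<B>. card (\<Union>B)))"
    using main by simp
  then show ?thesis by (simp only: of_nat_le_iff)
qed

end

section \<open>Parallel redrawings of generic symmetric configurations\<close>

definition cross :: "real^2 \<Rightarrow> real^2 \<Rightarrow> real" where
  "cross x y = x $ 1 * y $ 2 - x $ 2 * y $ 1"

lemma inner_2: "x \<bullet> y = x $ 1 * y $ 1 + x $ 2 * y $ 2" for x y :: "real^2"
  by (simp add: inner_vec_def sum_2)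

lemma cross_eq_0_iff_scaleR:
  assumes "cross u z = 0" "z \<noteq> 0"
  shows "u = ((u \<bullet> z) / (z \<bullet> z)) *\<^sub>R z"
proof -
  have "z \<bullet> z \<noteq> 0" using assms(2) by simp
  then show ?thesis
    using assms(1) unfolding vec_eq_iff forall_2 cross_def inner_2
    by (simp add: field_simps)
qed

lemma polynomial_functions_cross:
  fixes f g :: "('v \<Rightarrow> real^2) \<Rightarrow> real^2"
  assumes "-1 \<in> K" "\<And>k. (\<lambda>x. f x $ k) \<in> polynomial_functions K R"
    "\<And>k. (\<lambda>x. g x $ k) \<in> polynomial_functions K R"
  shows "(\<lambda>x. cross (f x) (g x)) \<in> polynomial_functions K R"
  unfolding cross_def
  by (intro polynomial_functions_diff polynomial_functions.mult assms)

lemma polynomial_functions_inner: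
  fixes f g :: "('v \<Rightarrow> real^2) \<Rightarrow> real^2"
  assumes "\<And>k. (\<lambda>x. f x $ k) \<in> polynomial_functions K R"
    "\<And>k. (\<lambda>x. g x $ k) \<in> polynomial_functions K R"
  shows "(\<lambda>x. f x \<bullet> g x) \<in> polynomial_functions K R"
  unfolding inner_2
  by (intro polynomial_functions.add polynomial_functions.mult assms)

lemma polynomial_functions_vector_diff:
  fixes f g :: "('v \<Rightarrow> real^2) \<Rightarrow> real^2"
  assumes "-1 \<in> K" "\<And>k. (\<lambda>x. f x $ k) \<in> polynomial_functions K R"
    "\<And>k. (\<lambda>x. g x $ k) \<in> polynomial_functions K R"
  shows "(\<lambda>x. (f x - g x) $ k) \<in> polynomial_functions K R"
  using polynomial_functions_diff[OF assms(1) assms(2)[of k] assms(3)[of k]] by simp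

text \<open>An arbitrary order of the ends of an edge. Quantities like the slope below do not depend on it.\<close>

definition endpoints :: "'v set \<Rightarrow> 'v \<times> 'v" where
  "endpoints e = (SOME p. e = {fst p, snd p})"

definition slope :: "('v \<Rightarrow> real^2) \<Rightarrow> ('v \<Rightarrow> real^2) \<Rightarrow> 'v set \<Rightarrow> real" where
  "slope w x e = (case endpoints e of (i, j) \<Rightarrow>
     ((w i - w j) \<bullet> (x i - x j)) / ((x i - x j) \<bullet> (x i - x j)))"

lemma endpoints_cases:
  "endpoints {i, j} = (i, j) \<or> endpoints {i, j} = (j, i)"
proof -
  have "{i, j} = {fst (endpoints {i, j}), snd (endpoints {i, j})}"
    unfolding endpoints_def by (rule someI[of _ "(i, j)"]) simp
  then show ?thesis by (auto simp: doubleton_eq_iff prod_eq_iff)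
qed

lemma inner_minus_commute2: "(a - b) \<bullet> (c - d) = (b - a) \<bullet> (d - c)"
  for a b c d :: "'a :: real_inner"
  by (simp add: inner_diff)

lemma slope_eq:
  "slope w x {i, j} = ((w i - w j) \<bullet> (x i - x j)) / ((x i - x j) \<bullet> (x i - x j))"
  using endpoints_cases[of i j]
  by (auto simp: slope_def inner_minus_commute2[of "w j"] inner_minus_commute2[of "x j"])

definition symmetric_extension ::
    "('v \<Rightarrow> 'v) \<Rightarrow> 'v set \<Rightarrow> real^2^2 \<Rightarrow> ('v \<Rightarrow> real^2) \<Rightarrow> 'v \<Rightarrow> real^2" where
  "symmetric_extension s R \<rho> x v = (if v \<in> R then x v else \<rho> *v x (s v))"

lemma extend_R: "v \<in> R \<Longrightarrow> symmetric_extension s R \<rho> x v = x v"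
  by (simp add: symmetric_extension_def)

lemma extend_add: "symmetric_extension s R \<rho> (\<lambda>i. x i + y i) v =
    symmetric_extension s R \<rho> x v + symmetric_extension s R \<rho> y v"
  by (simp add: symmetric_extension_def matrix_vector_right_distrib)

lemma extend_scaleR:
  "symmetric_extension s R \<rho> (\<lambda>i. k *\<^sub>R x i) v = k *\<^sub>R symmetric_extension s R \<rho> x v"
  by (simp add: symmetric_extension_def matrix_vector_mult_scaleR)

lemma matrix_vector_2: "(A *v x) $ k = A $ k $ 1 * x $ 1 + A $ k $ 2 * x $ 2" for A :: "real^2^2"
  by (simp add: matrix_vector_mult_def sum_2)

text \<open>The set \<open>R\<close> contains one vertex of each orbit; a symmetric configuration is freely determined by
  its values on \<open>R\<close>.\<close>

locale transversal_graph = free_involution_graph V E s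
  for V :: "'v set" and E s +
  fixes R :: "'v set"
  assumes V_eq: "V = R \<union> s ` R" and R_disjoint: "R \<inter> s ` R = {}"
begin

lemma R_subset: "R \<subseteq> V"
  using V_eq by blast

lemma finite_R: "finite R"
  using R_subset finite_V finite_subset by blast

lemma s_notin_R: "v \<in> R \<Longrightarrow> s v \<notin> R"
  using R_disjoint by blast

lemma s_in_R: "v \<in> V \<Longrightarrow> v \<notin> R \<Longrightarrow> s v \<in> R"
  using V_eq R_subset s_s by auto

lemma inj_s: "inj_on s V"
  using s_s by (metis inj_onI)

lemma extend_s:
  assumes "v \<in> V" "\<And>x. \<rho> *v (\<rho> *v x) = x"
  shows "symmetric_extension s R \<rho> x (s v) = \<rho> *v symmetric_extension s R \<rho> x v"
  using assms s_notin_R s_in_R by (auto simp: symmetric_extension_def s_s)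

lemma extend_cong:
  "(\<And>i. i \<in> R \<Longrightarrow> x i = y i) \<Longrightarrow> v \<in> V \<Longrightarrow>
    symmetric_extension s R \<rho> x v = symmetric_extension s R \<rho> y v"
  using s_in_R by (auto simp: symmetric_extension_def)

lemma extend_equivariant:
  assumes "v \<in> V" "\<And>v. v \<in> V \<Longrightarrow> w (s v) = \<rho> *v w v"
  shows "symmetric_extension s R \<rho> w v = w v"
proof (cases "v \<in> R")
  case False
  have "w (s (s v)) = \<rho> *v w (s v)" using assms s_in by blast
  then show ?thesis using False s_s[OF assms(1)] by (simp add: symmetric_extension_def)
qed (simp add: symmetric_extension_def)

lemma extend_polynomial:
  assumes "v \<in> V" "\<And>v k. v \<in> R \<Longrightarrow> (\<lambda>x. U x v $ k) \<in> polynomial_functions L R"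
    and "\<And>i j. \<rho> $ i $ j \<in> L"
  shows "(\<lambda>x. symmetric_extension s R \<rho> (U x) v $ k) \<in> polynomial_functions L R"
proof (cases "v \<in> R")
  case False
  then show ?thesis
    using assms s_in_R[OF assms(1)]
    by (auto simp: symmetric_extension_def matrix_vector_2
        intro!: polynomial_functions.add polynomial_functions.mult polynomial_functions.const)
qed (use assms in \<open>simp add: symmetric_extension_def\<close>)

lemma extend_coord_polynomial:
  assumes "v \<in> V" "\<And>i j. \<rho> $ i $ j \<in> K"
  shows "(\<lambda>x. symmetric_extension s R \<rho> x v $ k) \<in> polynomial_functions K R"
  using assms by (intro extend_polynomial) (auto intro: polynomial_functions.coord)

lemma extend_unit_velocity_polynomial:
  assumes "v \<in> V" "\<And>i j. \<rho> $ i $ j \<in> K" "{0, 1} \<subseteq> K"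
  shows "(\<lambda>x. symmetric_extension s R \<rho> (unit_velocity c) v $ k) \<in> polynomial_functions K R"
  using assms by (intro extend_polynomial polynomial_functions.const)
    (auto simp: unit_velocity_def axis_def)

end

locale mixed_7_transversal_graph =
  mixed_7_connected_graph V E s + transversal_graph V E s R for V :: "'v set" and E s R

text \<open>The matrix \<open>\<rho>\<close> stands for the half-turn or a reflection. The assumption on the vector \<open>n\<close> says that
  \<open>1 + \<rho>\<close> has rank at most one; this makes the zero-sum condition for
  loads on an invariant block a single equation.\<close>

locale generic_symmetric_configuration = mixed_7_transversal_graph V E s R
  for V :: "'a set" and E s R +
  fixes \<rho> :: "real^2^2" and K :: "real set" and a :: "'a \<Rightarrow> real^2"
  assumes K: "{0, 1, -1} \<subseteq> K" and \<rho>_K: "\<And>i j. \<rho> $ i $ j \<in> K"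
    and \<rho>_\<rho>: "\<And>x. \<rho> *v (\<rho> *v x) = x"
    and \<rho>_inner: "\<And>x y. (\<rho> *v x) \<bullet> (\<rho> *v y) = x \<bullet> y"
    and \<rho>_normal: "\<exists>n. \<forall>z. n \<bullet> z = 0 \<longrightarrow> z + \<rho> *v z = 0"
    and generic: "generic_over K R a"
begin

abbreviation extend :: "('a \<Rightarrow> real^2) \<Rightarrow> 'a \<Rightarrow> real^2" where
  "extend \<equiv> symmetric_extension s R \<rho>"

abbreviation q :: "'a \<Rightarrow> real^2" where "q \<equiv> extend a"

lemmas extend_s = extend_s[OF _ \<rho>_\<rho>]
lemmas extend_coord_polynomial = extend_coord_polynomial[OF _ \<rho>_K]

definition equivariant :: "('a \<Rightarrow> real^2) \<Rightarrow> bool" where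
  "equivariant w \<longleftrightarrow> (\<forall>v\<in>V. w (s v) = \<rho> *v w v)"

lemma extend_equivariant: "equivariant w \<Longrightarrow> v \<in> V \<Longrightarrow> extend w v = w v"
  by (rule extend_equivariant) (auto simp: equivariant_def)

lemma extend_unit_velocity_polynomial:
  "v \<in> V \<Longrightarrow> (\<lambda>x. extend (unit_velocity c) v $ k) \<in> polynomial_functions K R"
  using K \<rho>_K by (intro extend_unit_velocity_polynomial) auto

lemma \<rho>_diff: "\<rho> *v x - \<rho> *v y = \<rho> *v (x - y)"
  by (simp add: matrix_vector_mult_diff_distrib)

lemma \<rho>_eq_iff: "\<rho> *v x = \<rho> *v y \<longleftrightarrow> x = y"
  using \<rho>_\<rho> by metis

lemma generic_zero:
  assumes "f \<in> polynomial_functions K R" "f a = 0"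
  shows "f x = 0"
  using generic assms unfolding generic_over_def by blast

lemma generic_coordinate:
  assumes "v \<in> R"
  shows "a v $ k \<noteq> 0"
proof -
  have "(\<lambda>x. x v $ k) \<in> polynomial_functions K R"
    using assms by (rule polynomial_functions.coord)
  from generic_zero[OF this, of "\<lambda>_. axis k 1"] show ?thesis by auto
qed

text \<open>Coinciding points would satisfy a polynomial equation, hence coincide in every
  symmetric configuration; but one vertex orbit can be placed away from the origin with all others at the origin.\<close>

lemma generic_distinct:
  assumes "i \<in> V" "j \<in> V" "i \<noteq> j" "j \<noteq> s i"
  shows "q i \<noteq> q j"
proof
  assume eq: "q i = q j"
  have zero: "extend x i - extend x j = 0" for x
  proof -
    have "(extend x i - extend x j) $ k = 0" for k
    proof -
      have "(\<lambda>x. (extend x i - extend x j) $ k) \<in> polynomial_functions K R"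
        using K assms by (intro polynomial_functions_vector_diff extend_coord_polynomial) auto
      from generic_zero[OF this, of x] show ?thesis using eq by simp
    qed
    then show ?thesis by (simp add: vec_eq_iff)
  qed
  let ?x = "\<lambda>v. if v = i \<or> v = s i then axis 1 1 else 0 :: real^2"
  have "s j \<noteq> i" "s j \<noteq> s i"
    using assms s_s by metis+
  then have "extend ?x j = 0"
    using assms by (auto simp: symmetric_extension_def)
  moreover have "extend ?x i \<noteq> 0"
    using \<rho>_eq_iff[of "axis 1 1" 0] by (auto simp: symmetric_extension_def)
  ultimately show False using zero[of ?x] by simp
qed

lemma edge_distinct: "{i, j} \<in> E \<Longrightarrow> q i \<noteq> q j"
  by (erule edge_cases) (auto simp: doubleton_eq_iff dest: generic_distinct)

text \<open>Symmetric displacements of the vertices that keep the direction of every edge.\<close>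

definition redrawing :: "('a \<Rightarrow> real^2) \<Rightarrow> bool" where
  "redrawing w \<longleftrightarrow> equivariant w \<and> (\<forall>i j. {i, j} \<in> E \<longrightarrow> cross (w i - w j) (q i - q j) = 0)"

lemma redrawing_slope:
  assumes "redrawing w" "{i, j} \<in> E"
  shows "w i - w j = slope w q {i, j} *\<^sub>R (q i - q j)"
  using assms cross_eq_0_iff_scaleR[of "w i - w j" "q i - q j"] edge_distinct[OF assms(2)]
  by (simp add: redrawing_def slope_eq)

subsection \<open>Blocks\<close>

definition same_slope :: "'a set \<Rightarrow> 'a set \<Rightarrow> bool" where
  "same_slope e f \<longleftrightarrow> (\<forall>w. redrawing w \<longrightarrow> slope w q e = slope w q f)"

text \<open>Blocks are the connected pieces of the classes of edges of equal slope. Connectedness within a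
  class is what makes distinct blocks of one class vertex-disjoint.\<close>

definition adjacent :: "('a set \<times> 'a set) set" where
  "adjacent = {(e, f). e \<in> E \<and> f \<in> E \<and> same_slope e f \<and> e \<inter> f \<noteq> {}}"

definition block :: "'a set \<Rightarrow> 'a set set" where
  "block e = {f. (e, f) \<in> adjacent\<^sup>*}"

definition blocks :: "'a set set set" where
  "blocks = block ` E"

lemma same_slope_sym: "same_slope e f \<Longrightarrow> same_slope f e"
  by (simp add: same_slope_def)

lemma same_slope_trans: "same_slope e f \<Longrightarrow> same_slope f g \<Longrightarrow> same_slope e g"
  by (simp add: same_slope_def)

lemma adjacent_rtrancl_sym: "(e, f) \<in> adjacent\<^sup>* \<Longrightarrow> (f, e) \<in> adjacent\<^sup>*"
proof -
  have "sym adjacent" by (auto simp: sym_def adjacent_def same_slope_sym)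
  then show "(e, f) \<in> adjacent\<^sup>* \<Longrightarrow> (f, e) \<in> adjacent\<^sup>*"
    by (meson sym_rtrancl symD)
qed

lemma in_block_self: "e \<in> block e"
  by (simp add: block_def)

lemma block_D:
  assumes "e \<in> E" "f \<in> block e"
  shows "f \<in> E" "same_slope e f"
proof -
  have "(e, f) \<in> adjacent\<^sup>*" using assms by (simp add: block_def)
  then have "f \<in> E \<and> same_slope e f"
    by induction (use assms(1) in \<open>auto simp: adjacent_def same_slope_def\<close>)
  then show "f \<in> E" "same_slope e f" by auto
qed

lemma block_eq: "f \<in> block e \<Longrightarrow> block f = block e"
  using adjacent_rtrancl_sym by (auto simp: block_def intro: rtrancl_trans)

lemma block_eqI:
  assumes "e \<in> E" "f \<in> E" "same_slope e f" "v \<in> \<Union>(block e)" "v \<in> \<Union>(block f)"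
  shows "block e = block f"
proof -
  obtain e' f' where e': "e' \<in> block e" "v \<in> e'" and f': "f' \<in> block f" "v \<in> f'"
    using assms(4,5) by blast
  have "same_slope e' f'"
    using block_D(2)[OF assms(1) e'(1)] block_D(2)[OF assms(2) f'(1)] assms(3)
      same_slope_sym same_slope_trans by blast
  then have "(e', f') \<in> adjacent"
    using e' f' block_D(1) assms by (auto simp: adjacent_def)
  then have "f' \<in> block e'" by (auto simp: block_def)
  then show ?thesis using block_eq e' f' by metis
qed

lemma slope_image:
  assumes "redrawing w" "e \<in> E"
  shows "slope w q (s ` e) = slope w q e"
proof -
  obtain i j where e: "e = {i, j}" "i \<in> V" "j \<in> V" using edge_cases[OF assms(2)] by metis
  have "w (s i) = \<rho> *v w i" "w (s j) = \<rho> *v w j"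
    using assms(1) e by (auto simp: redrawing_def equivariant_def)
  then show ?thesis
    using e by (simp add: slope_eq extend_s \<rho>_diff \<rho>_inner)
qed

lemma adjacent_image: "(e, f) \<in> adjacent \<Longrightarrow> (s ` e, s ` f) \<in> adjacent"
  by (auto simp: adjacent_def same_slope_def slope_image s_edge)

lemma block_image_subset: "(`) s ` block e \<subseteq> block (s ` e)"
proof -
  have "(s ` e, s ` f) \<in> adjacent\<^sup>*" if "(e, f) \<in> adjacent\<^sup>*" for f
    using that by induction (auto intro: rtrancl.rtrancl_into_rtrancl adjacent_image)
  then show ?thesis by (auto simp: block_def)
qed

lemma block_image:
  assumes "e \<in> E"
  shows "(`) s ` block e = block (s ` e)"
proof
  show "block (s ` e) \<subseteq> (`) s ` block e"
  proof
    fix f assume f: "f \<in> block (s ` e)"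
    then have "s ` f \<in> block (s ` s ` e)" using block_image_subset by blast
    then have "s ` f \<in> block e" using s_s_edge[OF assms] by simp
    moreover have "f \<in> E" using block_D(1)[OF s_edge[OF assms] f] .
    then have "f = s ` s ` f" using s_s_edge by simp
    ultimately show "f \<in> (`) s ` block e" by blast
  qed
qed (rule block_image_subset)

sublocale blocks: symmetric_edge_partition V E s blocks
proof unfold_locales
  show "\<Union>blocks = E"
    using block_D(1) in_block_self by (auto simp: blocks_def)
  show "B = C" if "B \<in> blocks" "C \<in> blocks" "e \<in> B" "e \<in> C" for B C e
    using that unfolding blocks_def by (metis block_eq imageE)
  show "B \<noteq> {}" if "B \<in> blocks" for B
    using that in_block_self by (auto simp: blocks_def)
  show "(`) s ` B \<in> blocks" if "B \<in> blocks" for B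
    using that block_image s_edge by (auto simp: blocks_def)
  show "\<Union>B \<inter> \<Union>((`) s ` B) = {}" if B: "B \<in> blocks" "(`) s ` B \<noteq> B" for B
  proof (rule ccontr)
    assume ne: "\<not> ?thesis"
    obtain e where e: "e \<in> E" "B = block e" using B by (auto simp: blocks_def)
    have "same_slope e (s ` e)" using slope_image e by (auto simp: same_slope_def)
    moreover obtain v where "v \<in> \<Union>(block e)" "v \<in> \<Union>(block (s ` e))"
      using ne e block_image[OF e(1)] by auto
    ultimately have "block e = block (s ` e)"
      using block_eqI e s_edge by blast
    then show False using B(2) e block_image by metis
  qed
qed

lemma finite_blocks: "finite blocks"
  by (rule blocks.finite_\<B>)

lemma bij_betw_block_image: "bij_betw ((`) ((`) s)) blocks blocks"
  by (rule bij_betw_byWitness[where f' = "(`) ((`) s)"])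
    (use blocks.block_image_image blocks.\<B>_image in auto)

text \<open>Along a chain of adjacent edges with one slope, \<open>w - l x\<close> does not change.\<close>

lemma block_affine:
  fixes w x :: "'a \<Rightarrow> real^2"
  assumes "e \<in> E" and l: "\<And>i j. {i, j} \<in> block e \<Longrightarrow> w i - w j = l *\<^sub>R (x i - x j)"
  shows "\<exists>c. \<forall>v\<in>\<Union>(block e). w v = l *\<^sub>R x v + c"
proof -
  obtain i j where e: "e = {i, j}" using edge_cases[OF assms(1)] by metis
  define c where "c = w i - l *\<^sub>R x i"
  have edge: "w k - l *\<^sub>R x k = w m - l *\<^sub>R x m" if "f \<in> block e" "k \<in> f" "m \<in> f" for f k m
  proof -
    have fE: "f \<in> E" using block_D(1)[OF assms(1) that(1)] .
    obtain g h where "f = {g, h}" using edge_cases[OF fE] by metis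
    then have "k = m \<or> f = {k, m}" using that by auto
    then have "k = m \<or> w k = w m + l *\<^sub>R (x k - x m)"
      using l[of k m] that(1) by (metis add.commute diff_add_cancel)
    then show ?thesis by (auto simp: scaleR_diff_right)
  qed
  have "\<forall>v\<in>f. w v - l *\<^sub>R x v = c" if "(e, f) \<in> adjacent\<^sup>*" for f
    using that
  proof induction
    case base
    then show ?case using edge[OF in_block_self, of i] e c_def by auto
  next
    case (step f g)
    then obtain v where v: "v \<in> f" "v \<in> g" by (auto simp: adjacent_def)
    have "g \<in> block e" using step.hyps by (auto simp: block_def)
    then show ?case using step.IH v edge by metis
  qed
  then have "\<forall>v\<in>\<Union>(block e). w v = l *\<^sub>R x v + c"
    unfolding block_def by (auto simp: algebra_simps)
  then show ?thesis by blast
qed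

subsection \<open>Independence of the blocks\<close>

definition block_slope :: "('a \<Rightarrow> real^2) \<Rightarrow> ('a \<Rightarrow> real^2) \<Rightarrow> 'a set set \<Rightarrow> real" where
  "block_slope w x B = slope w x (SOME e. e \<in> B)"

lemma block_slope_eq:
  assumes "redrawing w" "B \<in> blocks" "e \<in> B"
  shows "block_slope w q B = slope w q e"
proof -
  obtain f where f: "f \<in> E" "B = block f" using assms(2) by (auto simp: blocks_def)
  have "(SOME e. e \<in> B) \<in> B" using assms(3) by (rule someI)
  then show ?thesis
    using assms f block_D(2)[OF f(1)] unfolding block_slope_def same_slope_def by metis
qed

lemma block_slope_image:
  assumes "redrawing w" "B \<in> blocks"
  shows "block_slope w q ((`) s ` B) = block_slope w q B"
proof -
  obtain e where e: "e \<in> E" "B = block e" using assms(2) by (auto simp: blocks_def)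
  have "block_slope w q ((`) s ` B) = slope w q (s ` e)"
    using e assms blocks.\<B>_image in_block_self by (intro block_slope_eq) auto
  also have "\<dots> = block_slope w q B"
    using slope_image[OF assms(1) e(1)] block_slope_eq[OF assms, of e] e in_block_self by simp
  finally show ?thesis .
qed

text \<open>A family of loads, one on each block, that add up to zero. The load on a block annihilates the
  vectors \<open>l q + c\<close> with \<open>l\<close> and \<open>c\<close> constant on the block, which include the restrictions of all
  redrawings to it.\<close>

definition balanced_loads :: "('a set set \<Rightarrow> 'a \<Rightarrow> real^2) \<Rightarrow> bool" where
  "balanced_loads x \<longleftrightarrow>
     (\<forall>B\<in>blocks. (\<forall>v. v \<notin> \<Union>B \<longrightarrow> x B v = 0) \<and> (\<Sum>v\<in>\<Union>B. x B v) = 0 \<and>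
        (\<Sum>v\<in>\<Union>B. x B v \<bullet> q v) = 0 \<and> (\<forall>v\<in>V. x ((`) s ` B) (s v) = \<rho> *v x B v)) \<and>
     (\<forall>v\<in>V. (\<Sum>B\<in>blocks. x B v) = 0)"

lemma sum_block_vertices:
  assumes "B \<in> blocks" "\<And>v. v \<notin> \<Union>B \<Longrightarrow> f v = 0"
  shows "(\<Sum>v\<in>\<Union>B. f v) = (\<Sum>v\<in>V. f v)"
  by (rule sum.mono_neutral_left)
     (use assms finite_V blocks.block_vertices[OF assms(1)] in auto)

text \<open>Vanishing of the two forms says that the edges keep their directions, and that two edges have equal
  slopes. Denominators are cleared, so the coefficients are polynomials in the configuration \<open>x\<close>.\<close>

definition edge_form :: "'a set \<Rightarrow> ('a \<Rightarrow> real^2) \<Rightarrow> ('a \<Rightarrow> real^2) \<Rightarrow> real" where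
  "edge_form e x w = (case endpoints e of (i, j) \<Rightarrow>
     cross (extend w i - extend w j) (extend x i - extend x j))"

definition edge_pair_form ::
    "'a set \<Rightarrow> 'a set \<Rightarrow> ('a \<Rightarrow> real^2) \<Rightarrow> ('a \<Rightarrow> real^2) \<Rightarrow> real" where
  "edge_pair_form e f x w = (case endpoints e of (i, j) \<Rightarrow> case endpoints f of (k, l) \<Rightarrow>
     ((extend w i - extend w j) \<bullet> (extend x i - extend x j)) *
        ((extend x k - extend x l) \<bullet> (extend x k - extend x l)) -
     ((extend w k - extend w l) \<bullet> (extend x k - extend x l)) *
        ((extend x i - extend x j) \<bullet> (extend x i - extend x j)))"

lemma endpoints_E:
  assumes "e \<in> E"
  obtains i j where "endpoints e = (i, j)" "e = {i, j}" "i \<in> V" "j \<in> V"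
proof -
  obtain i j where e: "e = {i, j}" "i \<in> V" "j \<in> V" using edge_cases[OF assms] by metis
  from endpoints_cases[of i j] show ?thesis
  proof
    assume "endpoints {i, j} = (i, j)"
    then show ?thesis using that[of i j] e by simp
  next
    assume "endpoints {i, j} = (j, i)"
    then show ?thesis using that[of j i] e by (simp add: insert_commute)
  qed
qed

lemma linear_form_edge_form:
  assumes "e \<in> E"
  shows "linear_form_on R (edge_form e x)"
proof -
  obtain i j where e: "endpoints e = (i, j)" "i \<in> V" "j \<in> V" using endpoints_E[OF assms] by metis
  show ?thesis
    unfolding linear_form_on_def edge_form_def e prod.case
  proof (intro conjI allI impI)
    fix u w :: "'a \<Rightarrow> real^2" assume "\<forall>i\<in>R. u i = w i"
    then have "extend u i = extend w i" "extend u j = extend w j"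
      using e extend_cong[of u w] by auto
    then show "cross (extend u i - extend u j) (extend x i - extend x j) =
      cross (extend w i - extend w j) (extend x i - extend x j)" by simp
  qed (simp_all add: extend_add extend_scaleR cross_def algebra_simps)
qed

lemma linear_form_edge_pair_form:
  assumes "e \<in> E" "f \<in> E"
  shows "linear_form_on R (edge_pair_form e f x)"
proof -
  obtain i j where e: "endpoints e = (i, j)" "i \<in> V" "j \<in> V"
    using endpoints_E[OF assms(1)] by metis
  obtain k l where f: "endpoints f = (k, l)" "k \<in> V" "l \<in> V"
    using endpoints_E[OF assms(2)] by metis
  show ?thesis
    unfolding linear_form_on_def edge_pair_form_def e f prod.case
  proof (intro conjI allI impI)
    fix u w :: "'a \<Rightarrow> real^2" assume "\<forall>i\<in>R. u i = w i"
    then have "extend u v = extend w v" if "v \<in> V" for v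
      using that extend_cong[of u w] by auto
    then show "(extend u i - extend u j) \<bullet> (extend x i - extend x j) *
        ((extend x k - extend x l) \<bullet> (extend x k - extend x l)) -
      (extend u k - extend u l) \<bullet> (extend x k - extend x l) *
        ((extend x i - extend x j) \<bullet> (extend x i - extend x j)) =
      (extend w i - extend w j) \<bullet> (extend x i - extend x j) *
        ((extend x k - extend x l) \<bullet> (extend x k - extend x l)) -
      (extend w k - extend w l) \<bullet> (extend x k - extend x l) *
        ((extend x i - extend x j) \<bullet> (extend x i - extend x j))" using e f by simp
  next
    fix u w :: "'a \<Rightarrow> real^2" and c :: real
    have add: "(a + b - (c + d)) = (a - c) + (b - d)" and scale: "r *\<^sub>R a - r *\<^sub>R c = r *\<^sub>R (a - c)"
      for a b c d :: "real^2" and r by (simp_all add: algebra_simps)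
    show "(extend (\<lambda>v. u v + w v) i - extend (\<lambda>v. u v + w v) j) \<bullet> (extend x i - extend x j) *
        ((extend x k - extend x l) \<bullet> (extend x k - extend x l)) -
      (extend (\<lambda>v. u v + w v) k - extend (\<lambda>v. u v + w v) l) \<bullet> (extend x k - extend x l) *
        ((extend x i - extend x j) \<bullet> (extend x i - extend x j)) =
      (extend u i - extend u j) \<bullet> (extend x i - extend x j) *
        ((extend x k - extend x l) \<bullet> (extend x k - extend x l)) -
      (extend u k - extend u l) \<bullet> (extend x k - extend x l) *
        ((extend x i - extend x j) \<bullet> (extend x i - extend x j)) +
      ((extend w i - extend w j) \<bullet> (extend x i - extend x j) *
        ((extend x k - extend x l) \<bullet> (extend x k - extend x l)) -
      (extend w k - extend w l) \<bullet> (extend x k - extend x l) *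
        ((extend x i - extend x j) \<bullet> (extend x i - extend x j)))"
      by (simp add: extend_add add inner_add_left distrib_right)
    show "(extend (\<lambda>v. c *\<^sub>R u v) i - extend (\<lambda>v. c *\<^sub>R u v) j) \<bullet> (extend x i - extend x j) *
        ((extend x k - extend x l) \<bullet> (extend x k - extend x l)) -
      (extend (\<lambda>v. c *\<^sub>R u v) k - extend (\<lambda>v. c *\<^sub>R u v) l) \<bullet> (extend x k - extend x l) *
        ((extend x i - extend x j) \<bullet> (extend x i - extend x j)) =
      c * ((extend u i - extend u j) \<bullet> (extend x i - extend x j) *
        ((extend x k - extend x l) \<bullet> (extend x k - extend x l)) -
      (extend u k - extend u l) \<bullet> (extend x k - extend x l) *
        ((extend x i - extend x j) \<bullet> (extend x i - extend x j)))"
      by (simp add: extend_scaleR scale right_diff_distrib mult.assoc)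
  qed
qed

lemma edge_form_polynomial:
  assumes "e \<in> E"
  shows "(\<lambda>x. edge_form e x (unit_velocity c)) \<in> polynomial_functions K R"
proof -
  obtain i j where e: "endpoints e = (i, j)" "i \<in> V" "j \<in> V" using endpoints_E[OF assms] by metis
  have "-1 \<in> K" using K by simp
  then show ?thesis unfolding edge_form_def e prod.case
    by (intro polynomial_functions_cross polynomial_functions_vector_diff
        extend_coord_polynomial extend_unit_velocity_polynomial e)
qed

lemma edge_pair_form_polynomial:
  assumes "e \<in> E" "f \<in> E"
  shows "(\<lambda>x. edge_pair_form e f x (unit_velocity c)) \<in> polynomial_functions K R"
proof -
  obtain i j where e: "endpoints e = (i, j)" "i \<in> V" "j \<in> V"
    using endpoints_E[OF assms(1)] by metis
  obtain k l where f: "endpoints f = (k, l)" "k \<in> V" "l \<in> V"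
    using endpoints_E[OF assms(2)] by metis
  have "-1 \<in> K" using K by simp
  then show ?thesis unfolding edge_pair_form_def e f prod.case
    by (intro polynomial_functions_inner polynomial_functions_vector_diff polynomial_functions_diff
        polynomial_functions.mult extend_coord_polynomial extend_unit_velocity_polynomial e f)
qed

lemma edge_pair_form_zero_iff:
  assumes "e \<in> E" "f \<in> E" "\<And>i j. {i, j} \<in> E \<Longrightarrow> extend x i \<noteq> extend x j"
  shows "edge_pair_form e f x w = 0 \<longleftrightarrow>
    slope (extend w) (extend x) e = slope (extend w) (extend x) f"
proof -
  obtain i j where e: "endpoints e = (i, j)" "e = {i, j}" using endpoints_E[OF assms(1)] by metis
  obtain k l where f: "endpoints f = (k, l)" "f = {k, l}" using endpoints_E[OF assms(2)] by metis
  have "extend x i - extend x j \<noteq> 0" "extend x k - extend x l \<noteq> 0" using assms e f by auto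
  then show ?thesis
    unfolding edge_pair_form_def slope_def e(1) f(1) prod.case
    by (subst frac_eq_eq) auto
qed

text \<open>At the generic point, redrawings satisfy the equations for edges and for pairs of edges with equal
  slopes. So they extend to solutions of all these equations: in the family, the edges of
  a block keep a common slope when the configuration moves.\<close>

lemma redrawing_family:
  assumes w: "redrawing w"
  obtains U where "\<And>v k. v \<in> R \<Longrightarrow> (\<lambda>x. U x v $ k) \<in> polynomial_functions UNIV R"
    and "\<And>e x. e \<in> E \<Longrightarrow> edge_form e x (U x) = 0"
    and "\<And>e f x. e \<in> E \<Longrightarrow> f \<in> E \<Longrightarrow> same_slope e f \<Longrightarrow> edge_pair_form e f x (U x) = 0"
    and "\<And>v. v \<in> V \<Longrightarrow> extend (U a) v = w v"
proof -
  let ?P = "{(e, f). e \<in> E \<and> f \<in> E \<and> same_slope e f}"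
  let ?Y = "(\<lambda>e. edge_form e) ` E \<union> (\<lambda>(e, f). edge_pair_form e f) ` ?P"
  have ext: "extend w v = w v" if "v \<in> V" for v
    using w that extend_equivariant by (simp add: redrawing_def)
  have "finite ?P" by (rule finite_subset[of _ "E \<times> E"]) (use finite_E in auto)
  then have fin: "finite ?Y" using finite_E by simp
  have zero: "edge_form e a w = 0" if e: "e \<in> E" for e
  proof -
    obtain i j where ij: "endpoints e = (i, j)" "e = {i, j}" "i \<in> V" "j \<in> V"
      using endpoints_E[OF e] by metis
    then show ?thesis using w e ext by (simp add: edge_form_def redrawing_def)
  qed
  have slope_ext: "slope (extend w) q e = slope w q e" if e: "e \<in> E" for e
  proof -
    obtain i j where ij: "endpoints e = (i, j)" "e = {i, j}" "i \<in> V" "j \<in> V"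
      using endpoints_E[OF e] by metis
    then show ?thesis using ext by (simp add: slope_def)
  qed
  have zero2: "edge_pair_form e f a w = 0" if "e \<in> E" "f \<in> E" "same_slope e f" for e f
    using that w by (subst edge_pair_form_zero_iff) (auto simp: slope_ext same_slope_def dest: edge_distinct)
  obtain U where U: "\<And>v k. v \<in> R \<Longrightarrow> (\<lambda>x. U x v $ k) \<in> polynomial_functions UNIV R"
    "\<And>y x. y \<in> ?Y \<Longrightarrow> y x (U x) = 0" "\<And>v. v \<in> R \<Longrightarrow> U a v = w v"
    by (rule kernel_extension_forms[where L = "\<lambda>y. y" and Y = ?Y and w = w, OF K generic fin finite_R])
      (auto simp: linear_form_edge_form linear_form_edge_pair_form edge_form_polynomial
        edge_pair_form_polynomial zero zero2)
  show ?thesis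
  proof (rule that[of U])
    show "extend (U a) v = w v" if "v \<in> V" for v
      using extend_cong[of "U a" w v] U(3) that ext by simp
    show "edge_form e x (U x) = 0" if "e \<in> E" for e x
      using U(2)[of "edge_form e"] that by blast
    show "edge_pair_form e f x (U x) = 0" if "e \<in> E" "f \<in> E" "same_slope e f" for e f x
      using U(2)[of "edge_pair_form e f"] that by blast
  qed (rule U(1))
qed

lemma polynomial_line_continuous:
  assumes "\<And>k. (\<lambda>x. f x $ k) \<in> polynomial_functions L R"
  shows "continuous_on UNIV (\<lambda>t::real. f (\<lambda>i. a i + t *\<^sub>R d i) :: real^2)"
proof -
  have "continuous_on UNIV (\<lambda>t::real. f (\<lambda>i. a i + t *\<^sub>R d i) $ k)" for k
    using polynomial_functions_continuous_line[OF assms[of k], of a d] .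
  then have "continuous_on UNIV (\<lambda>t::real. \<chi> k. f (\<lambda>i. a i + t *\<^sub>R d i) $ k)"
    by (rule continuous_on_vec_lambda)
  then show ?thesis by simp
qed

text \<open>The key to independence, a first-order argument. Let the configuration move in a direction \<open>y\<close> and
  the redrawing move along. At time \<open>t\<close>, the load on a block pairs with the redrawing to \<open>t\<close> times
  the slope times the pairing of the load with \<open>y\<close>, because the load annihilates \<open>q\<close> and constants. The
  loads have sum zero, so these numbers have sum zero. Dividing by \<open>t\<close> and letting it
  tend to \<open>0\<close> shows that the sum of the loads, weighted with slopes, is orthogonal to every symmetric \<open>y\<close>;
  taking this sum itself as \<open>y\<close> shows that it vanishes.\<close>

lemma balanced_loads_slope_sum:
  assumes x: "balanced_loads x" and w: "redrawing w" and v: "v \<in> V"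
  shows "(\<Sum>B\<in>blocks. block_slope w q B *\<^sub>R x B v) = 0"
proof -
  obtain U where U: "\<And>v k. v \<in> R \<Longrightarrow> (\<lambda>x. U x v $ k) \<in> polynomial_functions UNIV R"
    "\<And>e x. e \<in> E \<Longrightarrow> edge_form e x (U x) = 0"
    "\<And>e f x. e \<in> E \<Longrightarrow> f \<in> E \<Longrightarrow> same_slope e f \<Longrightarrow> edge_pair_form e f x (U x) = 0"
    "\<And>v. v \<in> V \<Longrightarrow> extend (U a) v = w v"
    using redrawing_family[OF w] by blast
  have xD: "x B v = 0" if "B \<in> blocks" "v \<notin> \<Union>B" for B v
    using x that by (auto simp: balanced_loads_def)
  have x_sum: "(\<Sum>v\<in>\<Union>B. x B v) = 0" "(\<Sum>v\<in>\<Union>B. x B v \<bullet> q v) = 0" if "B \<in> blocks" for B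
    using x that by (auto simp: balanced_loads_def)
  have x_total: "(\<Sum>B\<in>blocks. x B v) = 0" if "v \<in> V" for v
    using x that by (auto simp: balanced_loads_def)
  define y where "y v = (\<Sum>B\<in>blocks. block_slope w q B *\<^sub>R x B v)" for v
  have y_equivariant: "equivariant y"
    unfolding equivariant_def
  proof
    fix v assume v: "v \<in> V"
    have "y (s v) = (\<Sum>B\<in>blocks. block_slope w q ((`) s ` B) *\<^sub>R x ((`) s ` B) (s v))"
      unfolding y_def by (rule sum.reindex_bij_betw[OF bij_betw_block_image, symmetric])
    also have "\<dots> = (\<Sum>B\<in>blocks. \<rho> *v (block_slope w q B *\<^sub>R x B v))"
      using x v by (intro sum.cong)
        (auto simp: balanced_loads_def block_slope_image[OF w] matrix_vector_mult_scaleR)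
    also have "\<dots> = \<rho> *v y v"
      unfolding y_def by (simp add: linear_sum[OF matrix_vector_mul_linear])
    finally show "y (s v) = \<rho> *v y v" .
  qed
  define Q where "Q t = extend (\<lambda>i. a i + t *\<^sub>R y i)" for t
  define W where "W t = extend (U (\<lambda>i. a i + t *\<^sub>R y i))" for t
  have Q_eq: "Q t v = q v + t *\<^sub>R y v" if "v \<in> V" for t v
    using that by (simp add: Q_def extend_add extend_scaleR extend_equivariant[OF y_equivariant])
  have at_0: "Q 0 = q" "\<And>v. v \<in> V \<Longrightarrow> W 0 v = w v"
    using U(4) by (simp_all add: Q_def W_def)
  have cont_Q: "continuous_on UNIV (\<lambda>t. Q t v)" if "v \<in> V" for v
    unfolding Q_def
    by (rule polynomial_line_continuous[where f = "\<lambda>x. extend x v"])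
      (rule extend_coord_polynomial[OF that])
  have cont_W: "continuous_on UNIV (\<lambda>t. W t v)" if "v \<in> V" for v
    unfolding W_def
    by (rule polynomial_line_continuous[where f = "\<lambda>x. extend (U x) v" and L = UNIV])
      (rule extend_polynomial[OF that U(1)], auto)
  have edge_lim: "isCont (\<lambda>t. slope (W t) (Q t) e) 0"
    "\<forall>\<^sub>F t in at 0. \<forall>i j. e = {i, j} \<longrightarrow> Q t i \<noteq> Q t j" if e: "e \<in> E" for e
  proof -
    obtain i j where ij: "endpoints e = (i, j)" "e = {i, j}" "i \<in> V" "j \<in> V"
      using endpoints_E[OF e] by metis
    have c: "isCont (\<lambda>t. Q t v) 0" "isCont (\<lambda>t. W t v) 0" if "v \<in> V" for v
      using cont_Q[OF that] cont_W[OF that] by (auto simp: continuous_on_eq_continuous_at)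
    have ne: "Q 0 i - Q 0 j \<noteq> 0" using edge_distinct e ij by (auto simp: at_0)
    show "isCont (\<lambda>t. slope (W t) (Q t) e) 0"
      unfolding slope_def ij(1) prod.case
      by (intro continuous_intros c ij) (use ne in simp)
    have "isCont (\<lambda>t. Q t i - Q t j) 0" by (intro continuous_intros c ij)
    then have "((\<lambda>t. Q t i - Q t j) \<longlongrightarrow> Q 0 i - Q 0 j) (at 0)" by (simp add: isCont_def)
    then have "\<forall>\<^sub>F t in at 0. Q t i - Q t j \<noteq> 0"
      using ne tendsto_imp_eventually_ne by blast
    then show "\<forall>\<^sub>F t in at 0. \<forall>i j. e = {i, j} \<longrightarrow> Q t i \<noteq> Q t j"
      by eventually_elim (use ij in \<open>auto simp: doubleton_eq_iff\<close>)
  qed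
  \<comment> \<open>The pairing at time \<open>t\<close>, divided by \<open>t\<close>.\<close>
  define g where "g t = (\<Sum>B\<in>blocks. block_slope (W t) (Q t) B * (\<Sum>v\<in>V. x B v \<bullet> y v))" for t
  have pair: "(\<Sum>v\<in>V. x B v \<bullet> W t v) = t * (block_slope (W t) (Q t) B * (\<Sum>v\<in>V. x B v \<bullet> y v))"
    if B: "B \<in> blocks" and ne: "\<And>e i j. e \<in> E \<Longrightarrow> e = {i, j} \<Longrightarrow> Q t i \<noteq> Q t j" for B t
  proof -
    obtain e where e: "e \<in> E" "B = block e" using B by (auto simp: blocks_def)
    let ?l = "block_slope (W t) (Q t) B"
    have slopes: "slope (W t) (Q t) f = slope (W t) (Q t) e" if f: "f \<in> B" for f
      using U(3)[of f e] edge_pair_form_zero_iff[of f e "\<lambda>i. a i + t *\<^sub>R y i" "U (\<lambda>i. a i + t *\<^sub>R y i)"]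
        block_D[OF e(1)] f e ne same_slope_sym unfolding Q_def W_def by blast
    have "(SOME e. e \<in> B) \<in> B" using in_block_self e by (metis someI)
    then have l: "?l = slope (W t) (Q t) e" using slopes by (simp add: block_slope_def)
    have "W t i - W t j = ?l *\<^sub>R (Q t i - Q t j)" if f: "{i, j} \<in> B" for i j
    proof -
      have fE: "{i, j} \<in> E" using f e block_D(1) by blast
      have "cross (W t i - W t j) (Q t i - Q t j) = 0"
        using U(2)[OF fE, of "\<lambda>i. a i + t *\<^sub>R y i"] endpoints_cases[of i j]
        unfolding edge_form_def Q_def W_def by (auto simp: cross_def algebra_simps)
      then show ?thesis
        using cross_eq_0_iff_scaleR[of "W t i - W t j" "Q t i - Q t j"] ne[OF fE] slopes[OF f] l
        by (simp add: slope_eq)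
    qed
    then obtain c where c: "\<And>v. v \<in> \<Union>B \<Longrightarrow> W t v = ?l *\<^sub>R Q t v + c"
      using block_affine[OF e(1), of "W t" ?l "Q t"] e(2) by blast
    have "(\<Sum>v\<in>V. x B v \<bullet> W t v) = (\<Sum>v\<in>\<Union>B. x B v \<bullet> W t v)"
      using xD[OF B] by (intro sum_block_vertices[symmetric] B) auto
    also have "\<dots> = (\<Sum>v\<in>\<Union>B. ?l * (x B v \<bullet> q v) + ?l * t * (x B v \<bullet> y v) + x B v \<bullet> c)"
    proof (rule sum.cong[OF refl])
      fix v assume v: "v \<in> \<Union>B"
      then have "v \<in> V" using blocks.block_vertices[OF B] by blast
      then show "x B v \<bullet> W t v = ?l * (x B v \<bullet> q v) + ?l * t * (x B v \<bullet> y v) + x B v \<bullet> c"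
        using c[OF v] by (simp add: Q_eq inner_add_right algebra_simps)
    qed
    also have "\<dots> = ?l * (\<Sum>v\<in>\<Union>B. x B v \<bullet> q v) + ?l * t * (\<Sum>v\<in>\<Union>B. x B v \<bullet> y v)
        + (\<Sum>v\<in>\<Union>B. x B v) \<bullet> c"
      by (simp add: sum.distrib sum_distrib_left inner_sum_left)
    also have "\<dots> = t * (?l * (\<Sum>v\<in>\<Union>B. x B v \<bullet> y v))"
      using x_sum[OF B] by simp
    also have "(\<Sum>v\<in>\<Union>B. x B v \<bullet> y v) = (\<Sum>v\<in>V. x B v \<bullet> y v)"
      using xD[OF B] by (intro sum_block_vertices B) auto
    finally show ?thesis .
  qed
  have g_zero: "g t = 0" if "t \<noteq> 0" and ne: "\<And>e i j. e \<in> E \<Longrightarrow> e = {i, j} \<Longrightarrow> Q t i \<noteq> Q t j" for t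
  proof -
    have "t * g t = (\<Sum>B\<in>blocks. \<Sum>v\<in>V. x B v \<bullet> W t v)"
      unfolding g_def by (subst sum_distrib_left, rule sum.cong[OF refl], rule pair[symmetric]) (use ne in auto)
    also have "\<dots> = (\<Sum>v\<in>V. (\<Sum>B\<in>blocks. x B v) \<bullet> W t v)"
      by (subst sum.swap) (simp add: inner_sum_left)
    also have "\<dots> = 0" using x_total by simp
    finally show ?thesis using that(1) by simp
  qed
  have "\<forall>\<^sub>F t in at 0. \<forall>e\<in>E. \<forall>i j. e = {i, j} \<longrightarrow> Q t i \<noteq> Q t j"
    using edge_lim(2) finite_E by (simp add: eventually_ball_finite)
  moreover have "\<forall>\<^sub>F t in at (0::real). t \<noteq> 0"
    by (rule eventually_neq_at_within)
  ultimately have "\<forall>\<^sub>F t in at 0. g t = 0"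
    by eventually_elim (use g_zero in blast)
  then have lim0: "(g \<longlongrightarrow> 0) (at 0)" by (rule tendsto_eventually)
  have "isCont g 0"
    unfolding g_def block_slope_def
  proof (intro continuous_intros edge_lim(1))
    fix B assume "B \<in> blocks"
    then obtain e where e: "e \<in> E" "B = block e" by (auto simp: blocks_def)
    then have "(SOME e. e \<in> B) \<in> B" using in_block_self by (metis someI)
    then show "(SOME e. e \<in> B) \<in> E" using e block_D(1) by blast
  qed
  then have "(g \<longlongrightarrow> g 0) (at 0)" by (simp add: isCont_def)
  then have "g 0 = 0" using lim0 by (rule tendsto_unique[OF trivial_limit_at])
  moreover have "block_slope (W 0) (Q 0) B = block_slope w q B" if B: "B \<in> blocks" for B
  proof -
    obtain e where e: "e \<in> E" "B = block e" using B by (auto simp: blocks_def)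
    then have "(SOME e. e \<in> B) \<in> B" using in_block_self by (metis someI)
    then have "(SOME e. e \<in> B) \<in> E" using e block_D(1) by blast
    then obtain i j where "endpoints (SOME e. e \<in> B) = (i, j)" "i \<in> V" "j \<in> V"
      using endpoints_E by metis
    then show ?thesis by (simp add: block_slope_def slope_def at_0)
  qed
  ultimately have "0 = (\<Sum>B\<in>blocks. block_slope w q B * (\<Sum>v\<in>V. x B v \<bullet> y v))"
    by (simp add: g_def)
  also have "\<dots> = (\<Sum>v\<in>V. y v \<bullet> y v)"
    unfolding sum_distrib_left
    by (subst sum.swap) (simp add: y_def inner_sum_left)
  finally have "\<forall>v\<in>V. y v \<bullet> y v = 0"
    using finite_V by (simp add: sum_nonneg_eq_0_iff)
  then show ?thesis using v by (simp add: y_def)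
qed

text \<open>Weighting with slopes minus a constant \<open>l\<close> preserves balance. Choosing \<open>l\<close> as the slope of one
  block removes the load on this block.\<close>

lemma balanced_loads_slope_shift:
  assumes x: "balanced_loads x" and w: "redrawing w"
  shows "balanced_loads (\<lambda>B v. (block_slope w q B - l) *\<^sub>R x B v)"
proof -
  have "(\<Sum>B\<in>blocks. (block_slope w q B - l) *\<^sub>R x B v) = 0" if "v \<in> V" for v
  proof -
    have "(\<Sum>B\<in>blocks. (block_slope w q B - l) *\<^sub>R x B v) =
      (\<Sum>B\<in>blocks. block_slope w q B *\<^sub>R x B v) - l *\<^sub>R (\<Sum>B\<in>blocks. x B v)"
      by (simp add: scaleR_left_diff_distrib sum_subtractf scaleR_sum_right)
    also have "\<dots> = 0"
      using balanced_loads_slope_sum[OF assms that] x that by (simp add: balanced_loads_def)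
    finally show ?thesis .
  qed
  then show ?thesis
    using x by (auto simp: balanced_loads_def block_slope_image[OF w] matrix_vector_mult_scaleR
        simp flip: scaleR_sum_right sum_distrib_left)
qed

lemma balanced_loads_support:
  "balanced_loads x \<Longrightarrow> B \<in> blocks \<Longrightarrow> x B v \<noteq> 0 \<Longrightarrow> v \<in> \<Union>B"
  unfolding balanced_loads_def by blast

text \<open>Independence of the blocks. If two loaded blocks have different slopes in some redrawing,
  then shifting slopes removes one load and keeps the other, and induction on the number of loaded blocks applies.
  Otherwise all loaded blocks belong to one class of slopes, so they are
  vertex-disjoint and their loads cannot cancel.\<close>

lemma balanced_loads_zero:
  assumes "balanced_loads x" "B \<in> blocks"
  shows "x B v = 0"
proof -
  have "\<forall>B\<in>blocks. \<forall>v. x B v = 0"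
    using assms(1)
  proof (induction "card {B \<in> blocks. \<exists>v. x B v \<noteq> 0}" arbitrary: x rule: less_induct)
    case less
    show ?case
    proof (rule ccontr)
      assume "\<not> ?thesis"
      then obtain B v where B: "B \<in> blocks" "x B v \<noteq> 0" by blast
      show False
      proof (cases "\<exists>C\<in>blocks. \<exists>w. (\<exists>v. x C v \<noteq> 0) \<and> redrawing w \<and> block_slope w q C \<noteq> block_slope w q B")
        case True
        then obtain C w u where C: "C \<in> blocks" "x C u \<noteq> 0" "redrawing w"
          "block_slope w q C \<noteq> block_slope w q B" by blast
        define z where "z = (\<lambda>D v. (block_slope w q D - block_slope w q B) *\<^sub>R x D v)"
        have "balanced_loads z"
          unfolding z_def by (rule balanced_loads_slope_shift[OF less.prems C(3)])
        moreover have "{D \<in> blocks. \<exists>v. z D v \<noteq> 0} \<subset> {D \<in> blocks. \<exists>v. x D v \<noteq> 0}"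
        proof
          show "{D \<in> blocks. \<exists>v. z D v \<noteq> 0} \<subseteq> {D \<in> blocks. \<exists>v. x D v \<noteq> 0}"
            by (auto simp: z_def)
          show "{D \<in> blocks. \<exists>v. z D v \<noteq> 0} \<noteq> {D \<in> blocks. \<exists>v. x D v \<noteq> 0}"
            using B by (auto simp: z_def set_eq_iff intro!: exI[of _ B])
        qed
        then have "card {D \<in> blocks. \<exists>v. z D v \<noteq> 0} < card {D \<in> blocks. \<exists>v. x D v \<noteq> 0}"
          using finite_blocks by (intro psubset_card_mono) auto
        ultimately have "z C u = 0" using less.hyps C(1) by blast
        then show False using C by (simp add: z_def)
      next
        case False
        have vB: "v \<in> \<Union>B" using balanced_loads_support[OF less.prems B] .
        then have vV: "v \<in> V" using blocks.block_vertices[OF B(1)] by blast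
        have "x C v = 0" if C: "C \<in> blocks" "C \<noteq> B" for C
        proof (rule ccontr)
          assume ne: "x C v \<noteq> 0"
          then have vC: "v \<in> \<Union>C" using balanced_loads_support[OF less.prems C(1)] by blast
          obtain e f where ef: "e \<in> E" "B = block e" "f \<in> E" "C = block f"
            using B(1) C(1) by (auto simp: blocks_def)
          have "same_slope e f"
            unfolding same_slope_def
          proof (intro allI impI)
            fix w assume w: "redrawing w"
            then have "block_slope w q C = block_slope w q B" using False C ne by blast
            then show "slope w q e = slope w q f"
              using block_slope_eq[OF w B(1), of e] block_slope_eq[OF w C(1), of f] ef in_block_self
              by simp
          qed
          then show False using block_eqI[of e f v] ef vB vC C(2) by simp
        qed
        then have "(\<Sum>C\<in>blocks. x C v) = x B v"
          using B(1) finite_blocks by (subst sum.remove[of _ B]) auto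
        then show False using B less.prems vV by (simp add: balanced_loads_def)
      qed
    qed
  qed
  then show ?thesis using assms(2) by blast
qed

subsection \<open>Counting balanced loads\<close>

text \<open>The family of loads with given values at the vertices of \<open>R\<close>; equivariance determines the
  values at the other vertices. Outside \<open>V\<close> the value is set to zero.\<close>

definition load :: "(('a set set \<times> 'a) \<times> 2 \<Rightarrow> real) \<Rightarrow> 'a set set \<Rightarrow> 'a \<Rightarrow> real^2" where
  "load c B v = (if v \<in> R then \<chi> k. c ((B, v), k)
     else if v \<in> V then \<rho> *v (\<chi> k. c (((`) s ` B, s v), k)) else 0)"

lemma load_add: "load (\<lambda>z. c z + d z) B v = load c B v + load d B v"
proof -
  have "(\<chi> k. c (z, k) + d (z, k)) = (\<chi> k. c (z, k)) + (\<chi> k. d (z, k))" for z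
    by (simp add: vec_eq_iff)
  then show ?thesis by (simp add: load_def matrix_vector_right_distrib)
qed

lemma load_scaleR: "load (\<lambda>z. r * c z) B v = r *\<^sub>R load c B v"
proof -
  have "(\<chi> k. r * c (z, k)) = r *\<^sub>R (\<chi> k. c (z, k))" for z
    by (simp add: vec_eq_iff)
  then show ?thesis by (simp add: load_def matrix_vector_mult_scaleR)
qed

lemma load_image:
  assumes "B \<in> blocks" "v \<in> V"
  shows "load c ((`) s ` B) (s v) = \<rho> *v load c B v"
proof (cases "v \<in> R")
  case True
  then show ?thesis
    using assms s_notin_R[OF True] s_in blocks.block_image_image[OF assms(1)]
    by (simp add: load_def s_s)
next
  case False
  then show ?thesis
    using assms s_in_R by (simp add: load_def \<rho>_\<rho>)
qed

lemma load_outside: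
  assumes "\<And>B v k. v \<notin> \<Union>B \<Longrightarrow> c ((B, v), k) = 0" "B \<in> blocks" "v \<notin> \<Union>B"
  shows "load c B v = 0"
proof -
  have "s v \<notin> \<Union>((`) s ` B)" if "v \<in> V"
  proof
    assume "s v \<in> \<Union>((`) s ` B)"
    then obtain u where u: "u \<in> \<Union>B" "s v = s u" by auto
    then have "u = v"
      using inj_s that blocks.block_vertices[OF assms(2)] by (auto simp: inj_on_def)
    then show False using u assms(3) by blast
  qed
  then have "(\<chi> k. c ((B, v), k)) = 0" "v \<in> V \<Longrightarrow> (\<chi> k. c (((`) s ` B, s v), k)) = 0"
    using assms(1)[of v B] assms(3) assms(1)[of "s v" "(`) s ` B"]
    by (simp_all add: vec_eq_iff)
  then show ?thesis by (simp add: load_def)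
qed

lemma sum_block_image:
  assumes "B \<in> blocks"
  shows "(\<Sum>v\<in>\<Union>((`) s ` B). f v) = (\<Sum>v\<in>\<Union>B. f (s v))"
proof -
  have "inj_on s (\<Union>B)"
    by (rule inj_on_subset[OF inj_s blocks.block_vertices[OF assms]])
  then show ?thesis
    unfolding blocks.block_image_vertices by (simp add: sum.reindex)
qed

lemma card_blocks_vertices:
  "(\<Sum>B\<in>blocks. card (\<Union>B)) = 2 * (\<Sum>B\<in>blocks. card (\<Union>B \<inter> R))"
proof -
  have 1: "card (\<Union>B) = card (\<Union>B \<inter> R) + card (\<Union>B \<inter> s ` R)" if B: "B \<in> blocks" for B
  proof -
    have "\<Union>B = (\<Union>B \<inter> R) \<union> (\<Union>B \<inter> s ` R)"
      using blocks.block_vertices[OF B] V_eq by blast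
    moreover have "card ((\<Union>B \<inter> R) \<union> (\<Union>B \<inter> s ` R)) = card (\<Union>B \<inter> R) + card (\<Union>B \<inter> s ` R)"
      by (rule card_Un_disjoint) (use R_disjoint finite_R in auto)
    ultimately show ?thesis by simp
  qed
  have 2: "card (\<Union>((`) s ` B) \<inter> s ` R) = card (\<Union>B \<inter> R)" if B: "B \<in> blocks" for B
  proof -
    have "\<Union>((`) s ` B) \<inter> s ` R = s ` (\<Union>B \<inter> R)"
      using inj_on_image_Int[OF inj_s blocks.block_vertices[OF B] R_subset]
      by (simp only: blocks.block_image_vertices)
    moreover have "inj_on s (\<Union>B \<inter> R)"
      by (rule inj_on_subset[OF inj_s]) (use R_subset in blast)
    ultimately show ?thesis by (simp add: card_image)
  qed
  have "(\<Sum>B\<in>blocks. card (\<Union>B \<inter> s ` R)) = (\<Sum>B\<in>blocks. card (\<Union>((`) s ` B) \<inter> s ` R))"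
    by (rule sum.reindex_bij_betw[OF bij_betw_block_image, symmetric])
  also have "\<dots> = (\<Sum>B\<in>blocks. card (\<Union>B \<inter> R))"
    by (rule sum.cong) (use 2 in auto)
  finally show ?thesis
    using 1 by (simp add: sum.distrib)
qed

lemma card_V: "card V = 2 * card R"
proof -
  have "card V = card R + card (s ` R)"
    unfolding V_eq by (rule card_Un_disjoint) (use finite_R R_disjoint in auto)
  then show ?thesis
    using card_image[OF inj_on_subset[OF inj_s R_subset]] by simp
qed

text \<open>Otherwise the count leaves more unknowns than equations for a balanced family of loads. The
  unknowns are the values of the loads at the vertices of \<open>R\<close>. By equivariance, the equations for
  a block imply those for its mirror image; so only one block \<open>B \<in> T\<close> of each pair gives
  equations, three of them, and an invariant block gives two.\<close>

lemma exists_invariant_spanning_block: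
  assumes "V \<noteq> {}"
  shows "\<exists>B\<in>blocks. \<Union>B = V"
proof (rule ccontr)
  assume no_span: "\<not> ?thesis"
  let ?N = "{B \<in> blocks. \<not> blocks.invariant B}" and ?I = "{B \<in> blocks. blocks.invariant B}"
  have count: "2 * card V + 3 * card ?N + 4 * card ?I \<le> 2 * (\<Sum>B\<in>blocks. card (\<Union>B))"
    using no_span by (intro blocks.block_count) blast
  obtain T where T: "T \<subseteq> ?N" "?N = T \<union> (`) ((`) s) ` T" "card ?N = 2 * card T"
  proof -
    have "\<exists>T\<subseteq>?N. ?N = T \<union> (`) ((`) s) ` T \<and> T \<inter> (`) ((`) s) ` T = {} \<and> card ?N = 2 * card T"
      by (rule involution_transversal)
        (use finite_blocks blocks.\<B>_image blocks.block_image_image in \<open>auto simp: blocks.invariant_def\<close>)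
    then show ?thesis using that by blast
  qed
  obtain v0 where v0: "v0 \<in> R" using assms V_eq by blast
  obtain n where n: "\<And>z. n \<bullet> z = 0 \<Longrightarrow> z + \<rho> *v z = 0" using \<rho>_normal by blast
  let ?S = "Sigma blocks (\<lambda>B. \<Union>B \<inter> R) \<times> (UNIV :: 2 set)"
  \<comment> \<open>In \<open>Y1\<close> the total is to vanish on \<open>R\<close>. One coordinate is left out: its vanishing follows
    from the others, because all loads are orthogonal to \<open>q\<close>, whose coordinates are non-zero on \<open>R\<close>. The equations in \<open>Y2\<close>, \<open>Y3\<close>
    and \<open>Y4\<close> make the loads annihilate constants and \<open>q\<close>.\<close>
  define Y1 where "Y1 = (\<lambda>(v, k) (c :: _ \<Rightarrow> real). \<Sum>B\<in>blocks. load c B v $ k) ` (R \<times> (UNIV :: 2 set) - {(v0, 1)})"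
  define Y2 where "Y2 = (\<lambda>(B, k) c. (\<Sum>v\<in>\<Union>B. load c B v) $ k) ` (T \<times> (UNIV :: 2 set))"
  define Y3 where "Y3 = (\<lambda>B c. \<Sum>v\<in>\<Union>B. load c B v \<bullet> q v) ` (T \<union> ?I)"
  define Y4 where "Y4 = (\<lambda>B c. n \<bullet> (\<Sum>v\<in>\<Union>B \<inter> R. load c B v)) ` ?I"
  have finT: "finite T" using T(1) finite_blocks finite_subset by fastforce
  have "card Y1 \<le> 2 * card R - 1"
  proof -
    have "card Y1 \<le> card (R \<times> (UNIV :: 2 set) - {(v0, 1)})"
      unfolding Y1_def by (rule card_image_le) (use finite_R in auto)
    also have "\<dots> = 2 * card R - 1"
      using v0 finite_R by (simp add: card_Diff_subset card_cartesian_product mult.commute)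
    finally show ?thesis .
  qed
  moreover have "card Y2 \<le> 2 * card T"
  proof -
    have "card Y2 \<le> card (T \<times> (UNIV :: 2 set))"
      unfolding Y2_def by (rule card_image_le) (use finT in auto)
    then show ?thesis by (simp add: card_cartesian_product mult.commute)
  qed
  moreover have "card Y3 \<le> card T + card ?I"
    unfolding Y3_def
    by (rule order_trans[OF card_image_le card_Un_le]) (use finT finite_blocks in auto)
  moreover have "card Y4 \<le> card ?I"
    unfolding Y4_def by (rule card_image_le) (use finite_blocks in auto)
  moreover have "card (Y1 \<union> Y2 \<union> Y3 \<union> Y4) \<le> card Y1 + card Y2 + card Y3 + card Y4"
    by (meson add_le_mono1 card_Un_le order_trans)
  moreover have "0 < card R" using v0 finite_R by (auto simp: card_gt_0_iff)
  ultimately have "card (Y1 \<union> Y2 \<union> Y3 \<union> Y4) < 2 * card R + 3 * card T + 2 * card ?I"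
    by linarith
  also have "\<dots> \<le> 2 * (\<Sum>B\<in>blocks. card (\<Union>B \<inter> R))"
    using count T(3) by (simp add: card_blocks_vertices card_V)
  also have "\<dots> = card ?S"
    using finite_blocks finite_R by (simp add: card_cartesian_product)
  finally have card: "card (Y1 \<union> Y2 \<union> Y3 \<union> Y4) < card ?S" .
  have "\<exists>c. (\<exists>z\<in>?S. c z \<noteq> 0) \<and> (\<forall>z. z \<notin> ?S \<longrightarrow> c z = 0) \<and> (\<forall>f\<in>Y1 \<union> Y2 \<union> Y3 \<union> Y4. f c = 0)"
  proof (rule homogeneous_system_nontrivial_solution)
    show "finite (Y1 \<union> Y2 \<union> Y3 \<union> Y4)"
      unfolding Y1_def Y2_def Y3_def Y4_def using finT finite_R finite_blocks by simp
    show "finite ?S" using finite_R finite_blocks by simp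
    show "f (\<lambda>x. c x + d x) = f c + f d" if "f \<in> Y1 \<union> Y2 \<union> Y3 \<union> Y4" for f c d
      using that unfolding Y1_def Y2_def Y3_def Y4_def
      by (auto simp: load_add sum.distrib inner_add_left inner_add_right)
    show "f (\<lambda>x. r * c x) = r * f c" if "f \<in> Y1 \<union> Y2 \<union> Y3 \<union> Y4" for f c r
      using that unfolding Y1_def Y2_def Y3_def Y4_def
      by (auto simp: load_scaleR scaleR_sum_right[symmetric] sum_distrib_left[symmetric])
  qed (rule card)
  then obtain c z where c: "z \<in> ?S" "c z \<noteq> 0" "\<And>z. z \<notin> ?S \<Longrightarrow> c z = 0"
    "\<And>f. f \<in> Y1 \<union> Y2 \<union> Y3 \<union> Y4 \<Longrightarrow> f c = 0" by blast
  have outside: "load c B v = 0" if "B \<in> blocks" "v \<notin> \<Union>B" for B v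
    by (rule load_outside[OF _ that]) (use c(3) in auto)
  have total_R: "(\<Sum>B\<in>blocks. load c B v) $ k = 0" if "v \<in> R" "(v, k) \<noteq> (v0, 1)" for v k
  proof -
    have "(\<lambda>c. \<Sum>B\<in>blocks. load c B v $ k) \<in> Y1"
      unfolding Y1_def using that by (intro image_eqI[where x = "(v, k)"]) auto
    then have "(\<Sum>B\<in>blocks. load c B v $ k) = 0" using c(4) by blast
    then show ?thesis by simp
  qed
  have T_sum: "(\<Sum>v\<in>\<Union>B. load c B v) = 0" if "B \<in> T" for B
  proof -
    have "(\<lambda>c. (\<Sum>v\<in>\<Union>B. load c B v) $ k) \<in> Y2" for k
      unfolding Y2_def using that by (intro image_eqI[where x = "(B, k)"]) auto
    then have "(\<Sum>v\<in>\<Union>B. load c B v) $ k = 0" for k using c(4) by blast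
    then show ?thesis by (simp add: vec_eq_iff)
  qed
  have T_inner: "(\<Sum>v\<in>\<Union>B. load c B v \<bullet> q v) = 0" if "B \<in> T \<union> ?I" for B
    using c(4)[of "\<lambda>c. \<Sum>v\<in>\<Union>B. load c B v \<bullet> q v"] that unfolding Y3_def by blast
  \<comment> \<open>The total over an invariant block is \<open>z + \<rho> z\<close> for the total \<open>z\<close> over its vertices in \<open>R\<close>, and \<open>n \<bullet> z = 0\<close>.\<close>
  have I_sum: "(\<Sum>v\<in>\<Union>B. load c B v) = 0" if B: "B \<in> ?I" for B
  proof -
    have BI: "B \<in> blocks" "(`) s ` B = B" using B by (auto simp: blocks.invariant_def)
    have sB: "s ` \<Union>B = \<Union>B" using blocks.block_image_vertices[of B] BI(2) by simp
    have half: "\<Union>B = (\<Union>B \<inter> R) \<union> s ` (\<Union>B \<inter> R)"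
    proof (intro equalityI subsetI)
      fix v assume v: "v \<in> \<Union>B"
      then have "v \<in> V" using blocks.block_vertices[OF BI(1)] by blast
      moreover have "s v \<in> \<Union>B" using sB v by blast
      ultimately show "v \<in> (\<Union>B \<inter> R) \<union> s ` (\<Union>B \<inter> R)"
        using v s_in_R[of v] s_s[of v] by (cases "v \<in> R") (auto intro!: image_eqI[of v s "s v"])
    qed (use sB in blast)
    have "(\<Sum>v\<in>\<Union>B. load c B v) = (\<Sum>v\<in>\<Union>B \<inter> R. load c B v) + (\<Sum>v\<in>s ` (\<Union>B \<inter> R). load c B v)"
      by (subst half, rule sum.union_disjoint) (use R_disjoint finite_R in auto)
    also have "(\<Sum>v\<in>s ` (\<Union>B \<inter> R). load c B v) = (\<Sum>v\<in>\<Union>B \<inter> R. load c ((`) s ` B) (s v))"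
      by (subst sum.reindex) (use inj_on_subset[OF inj_s, of "\<Union>B \<inter> R"] R_subset BI(2) in auto)
    also have "\<dots> = \<rho> *v (\<Sum>v\<in>\<Union>B \<inter> R. load c B v)"
      using load_image[OF BI(1)] R_subset
      by (subst linear_sum[OF matrix_vector_mul_linear]) (auto intro!: sum.cong)
    also have "n \<bullet> (\<Sum>v\<in>\<Union>B \<inter> R. load c B v) = 0"
      using c(4)[of "\<lambda>c. n \<bullet> (\<Sum>v\<in>\<Union>B \<inter> R. load c B v)"] B unfolding Y4_def by blast
    then have "(\<Sum>v\<in>\<Union>B \<inter> R. load c B v) + \<rho> *v (\<Sum>v\<in>\<Union>B \<inter> R. load c B v) = 0" by (rule n)
    finally show ?thesis .
  qed
  have block_cond: "(\<Sum>v\<in>\<Union>B. load c B v) = 0 \<and> (\<Sum>v\<in>\<Union>B. load c B v \<bullet> q v) = 0"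
    if B: "B \<in> blocks" for B
  proof -
    consider "B \<in> T" | "B \<in> ?I" | C where "C \<in> T" "B = (`) s ` C" using T(2) B by blast
    then show ?thesis
    proof cases
      case 3
      have C: "C \<in> blocks" using 3 T(1) by blast
      then have V: "v \<in> V" if "v \<in> \<Union>C" for v using blocks.block_vertices that by blast
      have "(\<Sum>v\<in>\<Union>B. load c B v) = (\<Sum>v\<in>\<Union>C. \<rho> *v load c C v)"
        unfolding 3(2) sum_block_image[OF C] by (rule sum.cong) (use load_image[OF C] V in auto)
      also have "\<dots> = \<rho> *v (\<Sum>v\<in>\<Union>C. load c C v)"
        by (simp add: linear_sum[OF matrix_vector_mul_linear])
      finally have 1: "(\<Sum>v\<in>\<Union>B. load c B v) = 0" using T_sum[OF 3(1)] by simp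
      have "(\<Sum>v\<in>\<Union>B. load c B v \<bullet> q v) = (\<Sum>v\<in>\<Union>C. load c C v \<bullet> q v)"
        unfolding 3(2) sum_block_image[OF C]
        by (rule sum.cong) (use load_image[OF C] V in \<open>auto simp: extend_s \<rho>_inner\<close>)
      then show ?thesis using 1 T_inner[of C] 3(1) by simp
    qed (use T_sum T_inner I_sum in auto)
  qed
  define y where "y v = (\<Sum>B\<in>blocks. load c B v)" for v
  have y_equivariant: "y (s v) = \<rho> *v y v" if v: "v \<in> V" for v
  proof -
    have "y (s v) = (\<Sum>B\<in>blocks. load c ((`) s ` B) (s v))"
      unfolding y_def by (rule sum.reindex_bij_betw[OF bij_betw_block_image, symmetric])
    also have "\<dots> = (\<Sum>B\<in>blocks. \<rho> *v load c B v)"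
      by (rule sum.cong) (use load_image v in auto)
    also have "\<dots> = \<rho> *v y v"
      unfolding y_def by (simp add: linear_sum[OF matrix_vector_mul_linear])
    finally show ?thesis .
  qed
  have y_R: "y v = 0" if "v \<in> R" "v \<noteq> v0" for v
    using total_R that by (simp add: y_def vec_eq_iff)
  have "(\<Sum>v\<in>V. y v \<bullet> q v) = (\<Sum>B\<in>blocks. \<Sum>v\<in>V. load c B v \<bullet> q v)"
    unfolding y_def inner_sum_left by (rule sum.swap)
  also have "\<dots> = 0"
  proof (rule sum.neutral, rule ballI)
    fix B assume B: "B \<in> blocks"
    have "(\<Sum>v\<in>V. load c B v \<bullet> q v) = (\<Sum>v\<in>\<Union>B. load c B v \<bullet> q v)"
      by (rule sum_block_vertices[OF B, symmetric]) (simp add: outside[OF B])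
    then show "(\<Sum>v\<in>V. load c B v \<bullet> q v) = 0" using block_cond[OF B] by simp
  qed
  finally have "0 = (\<Sum>v\<in>R. y v \<bullet> q v) + (\<Sum>v\<in>s ` R. y v \<bullet> q v)"
    unfolding V_eq by (subst (asm) sum.union_disjoint) (use finite_R R_disjoint in auto)
  also have "(\<Sum>v\<in>s ` R. y v \<bullet> q v) = (\<Sum>v\<in>R. y v \<bullet> q v)"
    using inj_on_subset[OF inj_s R_subset] R_subset
    by (subst sum.reindex) (auto intro!: sum.cong simp: y_equivariant extend_s \<rho>_inner)
  finally have "(\<Sum>v\<in>R. y v \<bullet> q v) = 0" by simp
  then have "y v0 \<bullet> q v0 = 0"
    using y_R v0 finite_R by (subst (asm) sum.remove[of _ v0]) auto
  moreover have "y v0 $ 2 = 0" using total_R[OF v0, of 2] by (simp add: y_def)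
  ultimately have "y v0 $ 1 = 0"
    using generic_coordinate[OF v0, of 1] by (simp add: inner_2 extend_R[OF v0])
  with \<open>y v0 $ 2 = 0\<close> have "y v0 = 0" by (simp add: vec_eq_iff forall_2)
  with y_R have y_zero_R: "y v = 0" if "v \<in> R" for v using that by blast
  have y_zero: "y v = 0" if "v \<in> V" for v
  proof (cases "v \<in> R")
    case False
    then show ?thesis
      using y_equivariant[OF s_in[OF that]] y_zero_R[OF s_in_R[OF that]] s_s[OF that] by simp
  qed (rule y_zero_R)
  have "balanced_loads (load c)"
    unfolding balanced_loads_def
  proof (intro conjI ballI allI impI)
    show "load c B v = 0" if "B \<in> blocks" "v \<notin> \<Union>B" for B v using outside that .
    show "(\<Sum>v\<in>\<Union>B. load c B v) = 0" "(\<Sum>v\<in>\<Union>B. load c B v \<bullet> q v) = 0" if "B \<in> blocks" for B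
      using block_cond[OF that] by auto
    show "load c ((`) s ` B) (s v) = \<rho> *v load c B v" if "B \<in> blocks" "v \<in> V" for B v
      using load_image that .
    show "(\<Sum>B\<in>blocks. load c B v) = 0" if "v \<in> V" for v using y_zero that by (simp add: y_def)
  qed
  then have zero: "load c B v = 0" if "B \<in> blocks" for B v
    using balanced_loads_zero that by blast
  obtain B v k where z: "z = ((B, v), k)" "B \<in> blocks" "v \<in> R" using c(1) by auto
  then have "load c B v $ k = c z" by (simp add: load_def)
  then show False using zero[OF z(2), of v] c(2) by simp
qed

proposition redrawing_trivial:
  assumes w: "redrawing w"
  shows "\<exists>l c. \<rho> *v c = c \<and> (\<forall>v\<in>V. w v = l *\<^sub>R q v + c)"
proof (cases "V = {}")
  case True
  then show ?thesis by (intro exI[of _ 0]) auto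
next
  case False
  obtain B where B: "B \<in> blocks" "\<Union>B = V" using exists_invariant_spanning_block[OF False] by blast
  obtain e where e: "e \<in> E" "B = block e" using B by (auto simp: blocks_def)
  have "w i - w j = slope w q e *\<^sub>R (q i - q j)" if "{i, j} \<in> block e" for i j
    using redrawing_slope[OF w] block_D[OF e(1) that] w unfolding same_slope_def by metis
  then have "\<exists>c. \<forall>v\<in>\<Union>(block e). w v = slope w q e *\<^sub>R q v + c"
    by (rule block_affine[OF e(1)])
  then obtain c where "\<forall>v\<in>V. w v = slope w q e *\<^sub>R q v + c"
    using B(2) e(2) by metis
  then have c: "w v = slope w q e *\<^sub>R q v + c" if "v \<in> V" for v using that by blast
  obtain v where v: "v \<in> V" using False by blast
  have "w (s v) = \<rho> *v w v" using w v by (simp add: redrawing_def equivariant_def)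
  then have "c = \<rho> *v c"
    using c[OF v] c[OF s_in[OF v]] extend_s[OF v]
    by (simp add: matrix_vector_right_distrib matrix_vector_mult_scaleR)
  then show ?thesis using c by metis
qed

end

section \<open>Orthonormal frames and reflections\<close>

definition quarter_turn :: "real^2 \<Rightarrow> real^2" where
  "quarter_turn x = vector [- x $ 2, x $ 1]"

lemma quarter_turn_simps [simp]:
  "quarter_turn x $ 1 = - x $ 2" "quarter_turn x $ 2 = x $ 1"
  by (simp_all add: quarter_turn_def)

lemma quarter_turn_linear:
  "quarter_turn (x + y) = quarter_turn x + quarter_turn y"
  "quarter_turn (x - y) = quarter_turn x - quarter_turn y"
  "quarter_turn (- x) = - quarter_turn x"
  "quarter_turn (k *\<^sub>R x) = k *\<^sub>R quarter_turn x"
  "quarter_turn (quarter_turn x) = - x"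
  by (simp_all add: vec_eq_iff forall_2)

lemma quarter_turn_zero: "quarter_turn 0 = 0"
  by (simp add: vec_eq_iff forall_2)

lemma inner_quarter_turn: "quarter_turn x \<bullet> y = cross x y"
  by (simp add: inner_2 cross_def)

lemma frame_inner:
  assumes "d \<bullet> d = 1"
  shows "x \<bullet> y = (x \<bullet> d) * (y \<bullet> d) + (x \<bullet> quarter_turn d) * (y \<bullet> quarter_turn d)"
proof -
  have "(x \<bullet> d) * (y \<bullet> d) + (x \<bullet> quarter_turn d) * (y \<bullet> quarter_turn d) = (d \<bullet> d) * (x \<bullet> y)"
    by (simp add: inner_2 algebra_simps)
  then show ?thesis using assms by simp
qed

lemma frame_expand:
  assumes "d \<bullet> d = 1"
  shows "x = (x \<bullet> d) *\<^sub>R d + (x \<bullet> quarter_turn d) *\<^sub>R quarter_turn d"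
proof -
  have "(x \<bullet> d) *\<^sub>R d + (x \<bullet> quarter_turn d) *\<^sub>R quarter_turn d = (d \<bullet> d) *\<^sub>R x"
    by (simp add: vec_eq_iff forall_2 inner_2 algebra_simps)
  then show ?thesis using assms by simp
qed

lemma frame_eqI:
  assumes "d \<bullet> d = 1" "x \<bullet> d = y \<bullet> d" "x \<bullet> quarter_turn d = y \<bullet> quarter_turn d"
  shows "x = y"
  using frame_expand[OF assms(1), of x] frame_expand[OF assms(1), of y] assms(2,3) by simp

lemma frame_orthonormal:
  assumes "d \<bullet> d = 1"
  shows "quarter_turn d \<bullet> quarter_turn d = 1" "d \<bullet> quarter_turn d = 0" "quarter_turn d \<bullet> d = 0"
    "quarter_turn x \<bullet> d = - (x \<bullet> quarter_turn d)" "quarter_turn x \<bullet> quarter_turn d = x \<bullet> d"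
  using assms by (simp_all add: inner_2 algebra_simps)

lemma reflection_in_line_mult:
  assumes "d \<bullet> d = 1"
  shows "reflection_in_line d *v x = (x \<bullet> d) *\<^sub>R d - (x \<bullet> quarter_turn d) *\<^sub>R quarter_turn d"
proof -
  have "linear (\<lambda>x. (2 * ((x \<bullet> d) / (d \<bullet> d))) *\<^sub>R d - x)"
    by (rule linearI) (auto simp: algebra_simps inner_add_left add_divide_distrib)
  then have "reflection_in_line d *v x = (2 * (x \<bullet> d)) *\<^sub>R d - x"
    unfolding reflection_in_line_def using assms by (simp add: matrix_works)
  also have "\<dots> = (2 * (x \<bullet> d)) *\<^sub>R d - ((x \<bullet> d) *\<^sub>R d + (x \<bullet> quarter_turn d) *\<^sub>R quarter_turn d)"
    using frame_expand[OF assms, of x] by simp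
  also have "\<dots> = (x \<bullet> d) *\<^sub>R d - (x \<bullet> quarter_turn d) *\<^sub>R quarter_turn d"
    by (simp add: algebra_simps flip: scaleR_add_left)
  finally show ?thesis .
qed

lemma reflection_in_line_inner:
  assumes "d \<bullet> d = 1"
  shows "(reflection_in_line d *v x) \<bullet> d = x \<bullet> d"
    "(reflection_in_line d *v x) \<bullet> quarter_turn d = - (x \<bullet> quarter_turn d)"
  using assms by (simp_all add: reflection_in_line_mult inner_diff_left frame_orthonormal[OF assms])

lemma reflection_in_line_involution:
  assumes "d \<bullet> d = 1"
  shows "reflection_in_line d *v (reflection_in_line d *v x) = x"
  by (rule frame_eqI[OF assms]) (simp_all add: reflection_in_line_inner[OF assms])

lemma reflection_in_line_isometry:
  assumes "d \<bullet> d = 1"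
  shows "(reflection_in_line d *v x) \<bullet> (reflection_in_line d *v y) = x \<bullet> y"
  unfolding frame_inner[OF assms, of "_ *v x" "_ *v y"] frame_inner[OF assms, of x y]
  by (simp add: reflection_in_line_inner[OF assms])

lemma reflection_in_line_quarter_turn:
  assumes "d \<bullet> d = 1"
  shows "quarter_turn (reflection_in_line d *v x) = - (reflection_in_line d *v quarter_turn x)"
  by (rule frame_eqI[OF assms])
     (simp_all add: frame_orthonormal[OF assms] reflection_in_line_inner[OF assms])

lemma reflection_in_line_normal:
  assumes "d \<bullet> d = 1" "d \<bullet> z = 0"
  shows "z + reflection_in_line d *v z = 0"
  by (rule frame_eqI[OF assms(1)])
     (use assms(2) in \<open>simp_all add: inner_add_left reflection_in_line_inner[OF assms(1)]
        inner_commute[of d z]\<close>)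

lemma uminus_mat_1_mult: "- mat 1 *v x = - x" for x :: "real^2"
  by (simp add: vec_eq_iff matrix_vector_2 mat_def forall_2)

section \<open>The projective map exchanging a reflection and the half-turn\<close>

text \<open>In the coordinates \<open>(a, b)\<close> along \<open>d\<close> and across, the point map is \<open>(a, b) \<mapsto> (a / b, 1 / b)\<close>: in homogeneous
  coordinates it swaps the second and the third one, so it turns the sign change of the second, a
  reflection, into that of the third, the half-turn. A velocity \<open>u = (f, h)\<close> at \<open>x\<close> corresponds to the
  homogeneous vector \<open>(f, h, - (x \<bullet> u))\<close>, to which the same swap applies.\<close>

definition proj_point :: "real^2 \<Rightarrow> real^2 \<Rightarrow> real^2" where
  "proj_point d x = ((x \<bullet> d) / (x \<bullet> quarter_turn d)) *\<^sub>R d + (1 / (x \<bullet> quarter_turn d)) *\<^sub>R quarter_turn d"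

definition proj_velocity :: "real^2 \<Rightarrow> real^2 \<Rightarrow> real^2 \<Rightarrow> real^2" where
  "proj_velocity d x u =
     ((u \<bullet> d) / (x \<bullet> quarter_turn d)) *\<^sub>R d - ((x \<bullet> u) / (x \<bullet> quarter_turn d)) *\<^sub>R quarter_turn d"

context
  fixes d :: "real^2"
  assumes d: "d \<bullet> d = 1"
begin

lemma proj_point_inner:
  "proj_point d x \<bullet> d = (x \<bullet> d) / (x \<bullet> quarter_turn d)"
  "proj_point d x \<bullet> quarter_turn d = 1 / (x \<bullet> quarter_turn d)"
  using d by (simp_all add: proj_point_def inner_add_left frame_orthonormal[OF d])

lemma proj_velocity_inner:
  "proj_velocity d x u \<bullet> d = (u \<bullet> d) / (x \<bullet> quarter_turn d)"
  "proj_velocity d x u \<bullet> quarter_turn d = - (x \<bullet> u) / (x \<bullet> quarter_turn d)"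
  using d by (simp_all add: proj_velocity_def inner_diff_left frame_orthonormal[OF d] d)

lemma proj_point_involution:
  assumes "x \<bullet> quarter_turn d \<noteq> 0"
  shows "proj_point d (proj_point d x) = x"
  by (rule frame_eqI[OF d]) (use assms in \<open>simp_all add: proj_point_inner\<close>)

lemma proj_velocity_involution:
  assumes "x \<bullet> quarter_turn d \<noteq> 0"
  shows "proj_velocity d (proj_point d x) (proj_velocity d x u) = u"
  by (rule frame_eqI[OF d])
     (use assms in \<open>simp_all add: proj_point_inner proj_velocity_inner
       frame_inner[OF d, of "proj_point d x" "proj_velocity d x u"]
       frame_inner[OF d, of x u] field_simps\<close>)

text \<open>The edge condition is \<open>P i \<bullet> M j + P j \<bullet> M i = 0\<close> in terms of the homogeneous vectors \<open>P\<close> of points and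
  \<open>M\<close> of velocities. It is invariant under swapping coordinates, and rescaling the vectors of a
  vertex only multiplies it.\<close>

lemma proj_edge:
  assumes "x \<bullet> quarter_turn d \<noteq> 0" "y \<bullet> quarter_turn d \<noteq> 0"
  shows "(proj_point d x - proj_point d y) \<bullet> (proj_velocity d x u - proj_velocity d y w) =
    ((x - y) \<bullet> (u - w)) / ((x \<bullet> quarter_turn d) * (y \<bullet> quarter_turn d))"
proof -
  have left: "(proj_point d x - proj_point d y) \<bullet> (proj_velocity d x u - proj_velocity d y w) =
    ((x \<bullet> d) / (x \<bullet> quarter_turn d) - (y \<bullet> d) / (y \<bullet> quarter_turn d)) *
    ((u \<bullet> d) / (x \<bullet> quarter_turn d) - (w \<bullet> d) / (y \<bullet> quarter_turn d)) +
    (1 / (x \<bullet> quarter_turn d) - 1 / (y \<bullet> quarter_turn d)) *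
    (- (x \<bullet> u) / (x \<bullet> quarter_turn d) - (- (y \<bullet> w) / (y \<bullet> quarter_turn d)))"
    by (subst frame_inner[OF d]) (simp only: inner_diff_left proj_point_inner proj_velocity_inner)
  have right: "(x - y) \<bullet> (u - w) = (x \<bullet> d - y \<bullet> d) * (u \<bullet> d - w \<bullet> d) +
    (x \<bullet> quarter_turn d - y \<bullet> quarter_turn d) * (u \<bullet> quarter_turn d - w \<bullet> quarter_turn d)"
    by (subst frame_inner[OF d]) (simp only: inner_diff_left)
  show ?thesis
    unfolding left right frame_inner[OF d, of x u] frame_inner[OF d, of y w]
    using assms by (simp add: field_simps)
qed

lemma proj_point_reflection:
  "proj_point d (reflection_in_line d *v x) = - proj_point d x"
  "proj_point d (- x) = reflection_in_line d *v proj_point d x"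
  by (rule frame_eqI[OF d]; simp add: proj_point_inner reflection_in_line_inner[OF d])+

lemma proj_velocity_reflection:
  "proj_velocity d (reflection_in_line d *v x) (reflection_in_line d *v u) = - proj_velocity d x u"
  "proj_velocity d (- x) u = - (reflection_in_line d *v proj_velocity d x u)"
  by (rule frame_eqI[OF d]; simp add: proj_velocity_inner reflection_in_line_inner[OF d]
      reflection_in_line_isometry[OF d])+

lemma proj_velocity_trivial:
  assumes "x \<bullet> quarter_turn d \<noteq> 0"
  shows "proj_velocity d x (l *\<^sub>R quarter_turn x + k *\<^sub>R quarter_turn d) = (- l) *\<^sub>R d - k *\<^sub>R quarter_turn d"
proof (rule frame_eqI[OF d])
  have "x \<bullet> quarter_turn x = 0" by (simp add: inner_2)
  then show "proj_velocity d x (l *\<^sub>R quarter_turn x + k *\<^sub>R quarter_turn d) \<bullet> quarter_turn d =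
      ((- l) *\<^sub>R d - k *\<^sub>R quarter_turn d) \<bullet> quarter_turn d"
    using assms by (simp add: proj_velocity_inner inner_add_right inner_diff_left frame_orthonormal[OF d] d)
  show "proj_velocity d x (l *\<^sub>R quarter_turn x + k *\<^sub>R quarter_turn d) \<bullet> d =
      ((- l) *\<^sub>R d - k *\<^sub>R quarter_turn d) \<bullet> d"
    using assms by (simp add: proj_velocity_inner inner_add_left inner_diff_left frame_orthonormal[OF d] d)
qed

end

section \<open>Symmetric and antisymmetric motions\<close>

text \<open>A right-angled turn converts motions into redrawings. It commutes with the half-turn and
  anticommutes with reflections; so the assumption covers symmetric motions for the former and
  antisymmetric motions for the latter.\<close>

lemma (in generic_symmetric_configuration) twisted_motion_trivial:
  assumes sym: "\<And>v. v \<in> V \<Longrightarrow> quarter_turn (u (s v)) = \<rho> *v quarter_turn (u v)"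
    and motion: "\<And>i j. {i, j} \<in> E \<Longrightarrow> (q i - q j) \<bullet> (u i - u j) = 0"
  shows "\<exists>l c. \<rho> *v c = c \<and> (\<forall>v\<in>V. u v = l *\<^sub>R quarter_turn (q v) + quarter_turn c)"
proof -
  define w where "w v = - quarter_turn (u v)" for v
  have u: "u v = quarter_turn (w v)" for v by (simp add: w_def quarter_turn_linear)
  have "redrawing w"
    unfolding redrawing_def equivariant_def
  proof (intro conjI ballI allI impI)
    show "w (s v) = \<rho> *v w v" if "v \<in> V" for v
      using sym[OF that] by (simp add: w_def linear_neg[OF matrix_vector_mul_linear])
    show "cross (w i - w j) (q i - q j) = 0" if "{i, j} \<in> E" for i j
      using motion[OF that] unfolding u
      by (simp add: inner_quarter_turn[symmetric] quarter_turn_linear inner_commute)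
  qed
  then obtain l c where "\<rho> *v c = c" "\<forall>v\<in>V. w v = l *\<^sub>R q v + c"
    using redrawing_trivial by blast
  then show ?thesis
    by (intro exI[of _ l] exI[of _ c]) (simp add: u quarter_turn_linear)
qed

text \<open>Positions are extended from \<open>R\<close> by \<open>\<tau>\<close> and velocities by \<open>\<sigma>\<close>, which is \<open>\<tau>\<close> or \<open>- \<tau>\<close> according to the
  symmetry type of the motion.\<close>

definition edge_stretch ::
    "('v \<Rightarrow> 'v) \<Rightarrow> 'v set \<Rightarrow> real^2^2 \<Rightarrow> real^2^2 \<Rightarrow> ('v \<Rightarrow> real^2) \<Rightarrow> ('v \<Rightarrow> real^2) \<Rightarrow> 'v \<Rightarrow> 'v \<Rightarrow> real" where
  "edge_stretch s R \<tau> \<sigma> x u i j =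
     (symmetric_extension s R \<tau> x i - symmetric_extension s R \<tau> x j) \<bullet>
     (symmetric_extension s R \<sigma> u i - symmetric_extension s R \<sigma> u j)"

text \<open>If one configuration \<open>z\<close> has only constant motions, then so has a generic one. The constants in
  question form the set \<open>D\<close>. Requiring the coordinates in \<open>P\<close> of the velocity of one vertex to vanish
  excludes them, which turns the claim into triviality of a kernel.\<close>

lemma (in transversal_graph) constant_motions_at_generic:
  assumes K: "{0, 1, -1} \<subseteq> K" and gen: "generic_over K R p"
    and \<tau>_K: "\<And>i j. \<tau> $ i $ j \<in> K" and \<sigma>_K: "\<And>i j. \<sigma> $ i $ j \<in> K"
    and D_fixed: "\<And>t. t \<in> D \<Longrightarrow> \<sigma> *v t = t"
    and D_ex: "\<And>y. \<exists>t\<in>D. \<forall>k\<in>P. (y - t) $ k = 0"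
    and D_unique: "\<And>t. t \<in> D \<Longrightarrow> (\<And>k. k \<in> P \<Longrightarrow> t $ k = 0) \<Longrightarrow> t = 0"
    and z: "\<And>u. (\<And>i j. {i, j} \<in> E \<Longrightarrow> edge_stretch s R \<tau> \<sigma> z u i j = 0) \<Longrightarrow> \<exists>t\<in>D. \<forall>v\<in>R. u v = t"
    and u: "\<And>i j. {i, j} \<in> E \<Longrightarrow> edge_stretch s R \<tau> \<sigma> p u i j = 0"
  shows "\<exists>t\<in>D. \<forall>v\<in>R. u v = t"
proof (cases "R = {}")
  case True
  then show ?thesis using D_ex by auto
next
  case False
  then obtain r where r: "r \<in> R" by blast
  obtain t where t: "t \<in> D" "\<And>k. k \<in> P \<Longrightarrow> (u r - t) $ k = 0" using D_ex by metis
  let ?A = "{(i, j). {i, j} \<in> E}"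
  let ?Y = "(\<lambda>(i, j) x u. edge_stretch s R \<tau> \<sigma> x u i j) ` ?A \<union> (\<lambda>k x u. u r $ k) ` P"
  have V: "i \<in> V" "j \<in> V" if "{i, j} \<in> E" for i j using edge[OF that] by auto
  have shift: "edge_stretch s R \<tau> \<sigma> p (\<lambda>v. u v - t) i j = edge_stretch s R \<tau> \<sigma> p u i j" for i j
  proof -
    have "symmetric_extension s R \<sigma> (\<lambda>v. u v - t) i = symmetric_extension s R \<sigma> u i - t" for i
      using D_fixed[OF t(1)] by (simp add: symmetric_extension_def matrix_vector_mult_diff_distrib)
    then show ?thesis by (simp add: edge_stretch_def)
  qed
  have "\<forall>v\<in>R. u v - t = 0"
  proof (rule kernel_trivial_at_generic_forms[where L = "\<lambda>y. y" and Y = ?Y and x = z, OF K gen finite_R])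
    show "linear_form_on R (y x)" if "y \<in> ?Y" for y x
      using that
    proof
      assume "y \<in> (\<lambda>k x u. u r $ k) ` P"
      then show ?thesis using r by (auto simp: linear_form_on_def)
    next
      assume "y \<in> (\<lambda>(i, j) x u. edge_stretch s R \<tau> \<sigma> x u i j) ` ?A"
      then obtain i j where y: "{i, j} \<in> E" "y = (\<lambda>x u. edge_stretch s R \<tau> \<sigma> x u i j)" by auto
      show ?thesis
        unfolding linear_form_on_def y(2) edge_stretch_def
      proof (intro conjI allI impI)
        fix u w :: "_ \<Rightarrow> real^2" assume "\<forall>i\<in>R. u i = w i"
        then have "symmetric_extension s R \<sigma> u v = symmetric_extension s R \<sigma> w v" if "v \<in> V" for v
          using that extend_cong[of u w] by auto
        then show "(symmetric_extension s R \<tau> x i - symmetric_extension s R \<tau> x j) \<bullet>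
            (symmetric_extension s R \<sigma> u i - symmetric_extension s R \<sigma> u j) =
          (symmetric_extension s R \<tau> x i - symmetric_extension s R \<tau> x j) \<bullet>
            (symmetric_extension s R \<sigma> w i - symmetric_extension s R \<sigma> w j)"
          using V[OF y(1)] by simp
      qed (simp_all add: extend_add extend_scaleR inner_add_right inner_diff_right algebra_simps)
    qed
    show "(\<lambda>x. y x (unit_velocity c)) \<in> polynomial_functions K R" if "y \<in> ?Y" for y c
      using that
    proof
      assume "y \<in> (\<lambda>k x u. u r $ k) ` P"
      then show ?thesis
        using K by (auto simp: unit_velocity_def axis_def intro!: polynomial_functions.const)
    next
      assume "y \<in> (\<lambda>(i, j) x u. edge_stretch s R \<tau> \<sigma> x u i j) ` ?A"
      then obtain i j where y: "{i, j} \<in> E" "y = (\<lambda>x u. edge_stretch s R \<tau> \<sigma> x u i j)" by auto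
      have "-1 \<in> K" "{0, 1} \<subseteq> K" using K by auto
      then show ?thesis
        unfolding y(2) edge_stretch_def
        by (intro polynomial_functions_inner polynomial_functions_vector_diff
            extend_coord_polynomial extend_unit_velocity_polynomial \<tau>_K \<sigma>_K V[OF y(1)])
    qed
    show "\<forall>v\<in>R. w v = 0" if w: "\<And>y. y \<in> ?Y \<Longrightarrow> y z w = 0" for w
    proof -
      have "edge_stretch s R \<tau> \<sigma> z w i j = 0" if "{i, j} \<in> E" for i j
        using w[of "\<lambda>x u. edge_stretch s R \<tau> \<sigma> x u i j"] that by force
      then obtain t' where t': "t' \<in> D" "\<forall>v\<in>R. w v = t'" using z by blast
      have "w r $ k = 0" if "k \<in> P" for k
        using w[of "\<lambda>x u. u r $ k"] that by blast
      then have "t' = 0" using t' r by (intro D_unique) auto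
      then show ?thesis using t' by simp
    qed
    show "y p (\<lambda>v. u v - t) = 0" if "y \<in> ?Y" for y
      using that u t(2) by (auto simp: shift)
  qed
  then show ?thesis using t(1) by auto
qed

context mixed_7_transversal_graph
begin

lemma generic_half_turn_configuration:
  assumes "{0, 1, -1} \<subseteq> K" "generic_over K R x"
  shows "generic_symmetric_configuration V E s R (- mat 1) K x"
proof unfold_locales
  show "(- mat 1 :: real^2^2) $ i $ j \<in> K" for i j using assms by (auto simp: mat_def)
  show "\<exists>n. \<forall>z. n \<bullet> z = 0 \<longrightarrow> z + - mat 1 *v z = (0 :: real^2)"
    by (simp add: uminus_mat_1_mult)
qed (use assms in \<open>simp_all add: uminus_mat_1_mult\<close>)

lemma generic_reflection_configuration:
  assumes "{0, 1, -1} \<subseteq> K" "generic_over K R x" "d \<bullet> d = 1" "\<And>i j. reflection_in_line d $ i $ j \<in> K"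
  shows "generic_symmetric_configuration V E s R (reflection_in_line d) K x"
proof unfold_locales
  show "\<exists>n. \<forall>z. n \<bullet> z = 0 \<longrightarrow> z + reflection_in_line d *v z = 0"
    using reflection_in_line_normal[OF assms(3)] by blast
qed (use assms in \<open>simp_all add: reflection_in_line_involution reflection_in_line_isometry\<close>)

text \<open>The projective map sends a symmetric motion of the image configuration back to a symmetric motion for the
  half-turn at the generic configuration \<open>x\<close>. This is a rotation about the origin, which
  corresponds to a translation along the mirror.\<close>

lemma reflection_symmetric_motion_constant:
  assumes K: "{0, 1, -1} \<subseteq> K" and gen: "generic_over K R x" and d: "d \<bullet> d = 1"
    and nz: "\<And>v. v \<in> R \<Longrightarrow> x v \<bullet> quarter_turn d \<noteq> 0"
    and motion: "\<And>i j. {i, j} \<in> E \<Longrightarrow>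
      edge_stretch s R (reflection_in_line d) (reflection_in_line d) (\<lambda>v. proj_point d (x v)) u i j = 0"
  shows "\<exists>t. \<forall>v\<in>R. u v = t *\<^sub>R d"
proof -
  let ?\<tau> = "reflection_in_line d"
  interpret half_turn: generic_symmetric_configuration V E s R "- mat 1" K x
    by (rule generic_half_turn_configuration[OF K gen])
  let ?q = "symmetric_extension s R (- mat 1) x"
  let ?z = "symmetric_extension s R ?\<tau> (\<lambda>v. proj_point d (x v))"
  let ?u = "symmetric_extension s R ?\<tau> u"
  define w where "w v = proj_velocity d (?z v) (?u v)" for v
  have z: "?z v = proj_point d (?q v)" for v
    by (simp add: symmetric_extension_def uminus_mat_1_mult proj_point_reflection[OF d])
  have q_nz: "?q v \<bullet> quarter_turn d \<noteq> 0" if "v \<in> V" for v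
    using that nz s_in_R by (auto simp: symmetric_extension_def uminus_mat_1_mult)
  then have z_nz: "?z v \<bullet> quarter_turn d \<noteq> 0" if "v \<in> V" for v
    using that by (simp add: z proj_point_inner[OF d])
  have q: "?q v = proj_point d (?z v)" if "v \<in> V" for v
    using that q_nz by (simp add: z proj_point_involution[OF d])
  have u: "?u v = proj_velocity d (?q v) (w v)" if "v \<in> V" for v
    using proj_velocity_involution[OF d z_nz[OF that]] that by (simp add: w_def q)
  have "\<exists>l c. - mat 1 *v c = c \<and> (\<forall>v\<in>V. w v = l *\<^sub>R quarter_turn (?q v) + quarter_turn c)"
  proof (rule half_turn.twisted_motion_trivial)
    fix v assume v: "v \<in> V"
    have "?z (s v) = ?\<tau> *v ?z v" "?u (s v) = ?\<tau> *v ?u v"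
      using v by (simp_all add: extend_s reflection_in_line_involution[OF d])
    then have "w (s v) = - w v" by (simp add: w_def proj_velocity_reflection[OF d])
    then show "quarter_turn (w (s v)) = - mat 1 *v quarter_turn (w v)"
      by (simp add: uminus_mat_1_mult quarter_turn_linear)
  next
    fix i j assume e: "{i, j} \<in> E"
    then have V: "i \<in> V" "j \<in> V" using edge by auto
    show "(?q i - ?q j) \<bullet> (w i - w j) = 0"
      using motion[OF e] z_nz V by (simp add: q w_def proj_edge[OF d] edge_stretch_def)
  qed
  then obtain l c where c: "- mat 1 *v c = c" "\<And>v. v \<in> V \<Longrightarrow> w v = l *\<^sub>R quarter_turn (?q v) + quarter_turn c"
    by blast
  have "c = 0" using c(1) unfolding uminus_mat_1_mult by (simp add: vec_eq_iff)
  have "u v = (- l) *\<^sub>R d" if "v \<in> R" for v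
  proof -
    have v: "v \<in> V" using that R_subset by blast
    have "?u v = proj_velocity d (?q v) (l *\<^sub>R quarter_turn (?q v) + 0 *\<^sub>R quarter_turn d)"
      using c(2)[OF v] u[OF v] \<open>c = 0\<close> by (simp add: quarter_turn_zero)
    then show ?thesis
      unfolding proj_velocity_trivial[OF d q_nz[OF v]] using that by (simp add: extend_R)
  qed
  then show ?thesis by blast
qed

text \<open>Here the motion at \<open>x\<close> is antisymmetric for a reflection: a combination of a rotation and
  a translation across the mirror, which the projective map turns into translations.\<close>

lemma half_turn_antisymmetric_motion_constant:
  assumes K: "{0, 1, -1} \<subseteq> K" and gen: "generic_over K R x" and d: "d \<bullet> d = 1"
    and d_K: "\<And>i j. reflection_in_line d $ i $ j \<in> K"
    and nz: "\<And>v. v \<in> R \<Longrightarrow> x v \<bullet> quarter_turn d \<noteq> 0"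
    and motion: "\<And>i j. {i, j} \<in> E \<Longrightarrow>
      edge_stretch s R (- mat 1) (mat 1) (\<lambda>v. proj_point d (x v)) u i j = 0"
  shows "\<exists>t. \<forall>v\<in>R. u v = t"
proof -
  let ?\<tau> = "reflection_in_line d"
  interpret reflection: generic_symmetric_configuration V E s R ?\<tau> K x
    by (rule generic_reflection_configuration[OF K gen d d_K])
  let ?q = "symmetric_extension s R ?\<tau> x"
  let ?z = "symmetric_extension s R (- mat 1) (\<lambda>v. proj_point d (x v))"
  let ?u = "symmetric_extension s R (mat 1) u"
  define w where "w v = proj_velocity d (?z v) (?u v)" for v
  have z: "?z v = proj_point d (?q v)" for v
    by (simp add: symmetric_extension_def uminus_mat_1_mult proj_point_reflection[OF d])
  have q_nz: "?q v \<bullet> quarter_turn d \<noteq> 0" if "v \<in> V" for v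
    using that nz s_in_R by (auto simp: symmetric_extension_def reflection_in_line_inner[OF d])
  then have z_nz: "?z v \<bullet> quarter_turn d \<noteq> 0" if "v \<in> V" for v
    using that by (simp add: z proj_point_inner[OF d])
  have q: "?q v = proj_point d (?z v)" if "v \<in> V" for v
    using that q_nz by (simp add: z proj_point_involution[OF d])
  have u: "?u v = proj_velocity d (?q v) (w v)" if "v \<in> V" for v
    using proj_velocity_involution[OF d z_nz[OF that]] that by (simp add: w_def q)
  have "\<exists>l c. ?\<tau> *v c = c \<and> (\<forall>v\<in>V. w v = l *\<^sub>R quarter_turn (?q v) + quarter_turn c)"
  proof (rule reflection.twisted_motion_trivial)
    fix v assume v: "v \<in> V"
    have "?z (s v) = - ?z v" "?u (s v) = ?u v"
      using v by (simp_all add: extend_s uminus_mat_1_mult)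
    then have "w (s v) = - (?\<tau> *v w v)" by (simp add: w_def proj_velocity_reflection[OF d])
    then show "quarter_turn (w (s v)) = ?\<tau> *v quarter_turn (w v)"
      by (simp add: quarter_turn_linear reflection_in_line_quarter_turn[OF d])
  next
    fix i j assume e: "{i, j} \<in> E"
    then have V: "i \<in> V" "j \<in> V" using edge by auto
    show "(?q i - ?q j) \<bullet> (w i - w j) = 0"
      using motion[OF e] z_nz V by (simp add: q w_def proj_edge[OF d] edge_stretch_def)
  qed
  then obtain l c where c: "?\<tau> *v c = c" "\<And>v. v \<in> V \<Longrightarrow> w v = l *\<^sub>R quarter_turn (?q v) + quarter_turn c"
    by blast
  have "c \<bullet> quarter_turn d = 0"
    using reflection_in_line_inner(2)[OF d, of c] c(1) by simp
  then have "c = (c \<bullet> d) *\<^sub>R d" using frame_expand[OF d, of c] by simp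
  then have qc: "quarter_turn c = (c \<bullet> d) *\<^sub>R quarter_turn d" by (metis quarter_turn_linear(4))
  have "u v = (- l) *\<^sub>R d - (c \<bullet> d) *\<^sub>R quarter_turn d" if "v \<in> R" for v
  proof -
    have v: "v \<in> V" using that R_subset by blast
    have "?u v = proj_velocity d (?q v) (l *\<^sub>R quarter_turn (?q v) + (c \<bullet> d) *\<^sub>R quarter_turn d)"
      using c(2)[OF v] u[OF v] qc by simp
    then show ?thesis
      unfolding proj_velocity_trivial[OF d q_nz[OF v]] using that by (simp add: extend_R)
  qed
  then show ?thesis by blast
qed

lemma trivial_motion_sum:
  assumes "\<forall>v\<in>V. u1 v = l *\<^sub>R quarter_turn (p v) + t" "\<forall>v\<in>V. u2 v = t'"
    "\<And>v. v \<in> V \<Longrightarrow> u v = u1 v + u2 v"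
  shows "trivial_motion V p u"
proof -
  let ?S = "vector [vector [0, - l], vector [l, 0]] :: real^2^2"
  have "transpose ?S = - ?S" by (simp add: transpose_def vec_eq_iff forall_2)
  moreover have "?S *v x = l *\<^sub>R quarter_turn x" for x
    by (simp add: vec_eq_iff matrix_vector_2 forall_2)
  then have "\<forall>v\<in>V. u v = ?S *v p v + (t + t')" using assms by (simp add: add_ac)
  ultimately show ?thesis unfolding trivial_motion_def by blast
qed

text \<open>Averaging with the mirror image of the motion, with sign \<open>+\<close> or \<open>-\<close>. The mirror image is a motion as the
  edge set is symmetric and \<open>\<rho>\<close> is an isometry.\<close>

lemma motion_decomposition:
  fixes \<rho> :: "real^2^2" and p u :: "'v \<Rightarrow> real^2"
  assumes \<rho>_\<rho>: "\<And>x. \<rho> *v (\<rho> *v x) = x" and \<rho>_inner: "\<And>x y. (\<rho> *v x) \<bullet> (\<rho> *v y) = x \<bullet> y"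
    and p: "\<And>v. v \<in> V \<Longrightarrow> p (s v) = \<rho> *v p v"
    and u: "\<And>i j. {i, j} \<in> E \<Longrightarrow> (p i - p j) \<bullet> (u i - u j) = 0"
  obtains u1 u2 where "\<And>v. u v = u1 v + u2 v"
    and "\<And>v. v \<in> V \<Longrightarrow> u1 (s v) = \<rho> *v u1 v" and "\<And>v. v \<in> V \<Longrightarrow> u2 (s v) = - (\<rho> *v u2 v)"
    and "\<And>i j. {i, j} \<in> E \<Longrightarrow> (p i - p j) \<bullet> (u1 i - u1 j) = 0"
    and "\<And>i j. {i, j} \<in> E \<Longrightarrow> (p i - p j) \<bullet> (u2 i - u2 j) = 0"
proof
  let ?u1 = "\<lambda>v. (1/2) *\<^sub>R (u v + \<rho> *v u (s v))" and ?u2 = "\<lambda>v. (1/2) *\<^sub>R (u v - \<rho> *v u (s v))"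
  show "u v = ?u1 v + ?u2 v" for v
    by (simp add: vec_eq_iff field_simps)
  show "?u1 (s v) = \<rho> *v ?u1 v" "?u2 (s v) = - (\<rho> *v ?u2 v)" if "v \<in> V" for v
    using s_s[OF that]
    by (simp_all add: matrix_vector_mult_scaleR matrix_vector_right_distrib
        matrix_vector_mult_diff_distrib \<rho>_\<rho> add.commute flip: scaleR_minus_right)
  have image: "(p i - p j) \<bullet> (\<rho> *v u (s i) - \<rho> *v u (s j)) = 0" if e: "{i, j} \<in> E" for i j
  proof -
    have V: "i \<in> V" "j \<in> V" using e edge by auto
    have "(p (s i) - p (s j)) \<bullet> (u (s i) - u (s j)) = 0"
      using u s_edge[OF e] by simp
    then have "(\<rho> *v (p i - p j)) \<bullet> (\<rho> *v (\<rho> *v (u (s i) - u (s j)))) = 0"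
      using p V by (simp add: \<rho>_\<rho> matrix_vector_mult_diff_distrib)
    then show ?thesis unfolding \<rho>_inner by (simp add: matrix_vector_mult_diff_distrib)
  qed
  show "(p i - p j) \<bullet> (?u1 i - ?u1 j) = 0" "(p i - p j) \<bullet> (?u2 i - ?u2 j) = 0" if "{i, j} \<in> E" for i j
  proof -
    have "?u1 i - ?u1 j = (1/2) *\<^sub>R ((u i - u j) + (\<rho> *v u (s i) - \<rho> *v u (s j)))"
      "?u2 i - ?u2 j = (1/2) *\<^sub>R ((u i - u j) - (\<rho> *v u (s i) - \<rho> *v u (s j)))"
      by (simp_all add: algebra_simps)
    then show "(p i - p j) \<bullet> (?u1 i - ?u1 j) = 0" "(p i - p j) \<bullet> (?u2 i - ?u2 j) = 0"
      using u[OF that] image[OF that]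
      by (simp_all only: inner_scaleR_right inner_add_right inner_diff_right[of _ "u i - u j"]) simp_all
  qed
qed

text \<open>The antisymmetric part is a redrawing up to a right-angled turn. For the symmetric
  part, the configuration with the projective image of \<open>p\<close> on \<open>R\<close> has only translations along the
  mirror as motions; it is defined as no point of \<open>p\<close>
  lies on the mirror.\<close>

lemma reflection_rigid:
  assumes K: "{0, 1, -1} \<subseteq> K" and gen: "generic_over K R p" and d: "d \<bullet> d = 1"
    and d_K: "\<And>i j. reflection_in_line d $ i $ j \<in> K"
    and p: "\<And>v. v \<in> V \<Longrightarrow> p (s v) = reflection_in_line d *v p v"
    and p_s: "\<And>v. v \<in> V \<Longrightarrow> p (s v) \<noteq> p v"
    and u: "\<And>i j. {i, j} \<in> E \<Longrightarrow> (p i - p j) \<bullet> (u i - u j) = 0"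
  shows "trivial_motion V p u"
proof -
  let ?\<tau> = "reflection_in_line d"
  interpret reflection: generic_symmetric_configuration V E s R ?\<tau> K p
    by (rule generic_reflection_configuration[OF K gen d d_K])
  obtain u1 u2 where dec: "\<And>v. u v = u1 v + u2 v"
    and sym: "\<And>v. v \<in> V \<Longrightarrow> u1 (s v) = ?\<tau> *v u1 v" "\<And>v. v \<in> V \<Longrightarrow> u2 (s v) = - (?\<tau> *v u2 v)"
    and motion: "\<And>i j. {i, j} \<in> E \<Longrightarrow> (p i - p j) \<bullet> (u1 i - u1 j) = 0"
      "\<And>i j. {i, j} \<in> E \<Longrightarrow> (p i - p j) \<bullet> (u2 i - u2 j) = 0"
    using motion_decomposition[where \<rho> = ?\<tau> and p = p and u = u, OF reflection_in_line_involution[OF d] reflection_in_line_isometry[OF d] p u]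
    by blast
  have V: "i \<in> V" "j \<in> V" if "{i, j} \<in> E" for i j using edge[OF that] by auto
  have q: "symmetric_extension s R ?\<tau> p v = p v" "symmetric_extension s R ?\<tau> u1 v = u1 v" if "v \<in> V" for v
    using that p sym(1) by (auto intro: extend_equivariant)
  have "\<exists>l c. ?\<tau> *v c = c \<and>
      (\<forall>v\<in>V. u2 v = l *\<^sub>R quarter_turn (symmetric_extension s R ?\<tau> p v) + quarter_turn c)"
    by (rule reflection.twisted_motion_trivial)
      (use motion(2) V in \<open>auto simp: sym q quarter_turn_linear reflection_in_line_quarter_turn[OF d]\<close>)
  then obtain l c where u2: "\<forall>v\<in>V. u2 v = l *\<^sub>R quarter_turn (p v) + quarter_turn c"
    using q by auto
  \<comment> \<open>A coordinate in which translations along \<open>d\<close> are visible.\<close>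
  obtain k where k: "d $ k \<noteq> 0" using d by (metis inner_eq_zero_iff vec_eq_iff zero_index zero_neq_one)
  let ?D = "range (\<lambda>t. t *\<^sub>R d)"
  have fixed: "?\<tau> *v t = t" if "t \<in> ?D" for t
    using that d by (auto simp: reflection_in_line_mult frame_orthonormal)
  have nz: "p v \<bullet> quarter_turn d \<noteq> 0" if "v \<in> R" for v
  proof
    assume "p v \<bullet> quarter_turn d = 0"
    then have "?\<tau> *v p v = p v"
      using frame_expand[OF d, of "p v"] by (simp add: reflection_in_line_mult[OF d])
    then show False using p p_s that R_subset by auto
  qed
  have "\<exists>t\<in>?D. \<forall>v\<in>R. u1 v = t"
  proof (rule constant_motions_at_generic[OF K gen d_K d_K fixed,
        where P = "{k}" and z = "\<lambda>v. proj_point d (p v)"])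
    show "\<exists>t\<in>?D. \<forall>k\<in>{k}. (y - t) $ k = 0" for y
      using k by (intro bexI[of _ "(y $ k / d $ k) *\<^sub>R d"]) auto
    show "t = 0" if "t \<in> ?D" "\<And>k'. k' \<in> {k} \<Longrightarrow> t $ k' = 0" for t
      using that k by auto
    show "\<exists>t\<in>?D. \<forall>v\<in>R. w v = t"
      if "\<And>i j. {i, j} \<in> E \<Longrightarrow> edge_stretch s R ?\<tau> ?\<tau> (\<lambda>v. proj_point d (p v)) w i j = 0" for w
      using reflection_symmetric_motion_constant[OF K gen d nz that] by auto
    show "edge_stretch s R ?\<tau> ?\<tau> p u1 i j = 0" if "{i, j} \<in> E" for i j
      using motion(1)[OF that] V[OF that] by (simp add: edge_stretch_def q)
  qed
  then obtain t where t: "t \<in> ?D" "\<And>v. v \<in> R \<Longrightarrow> u1 v = t" by blast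
  have "u1 v = t" if "v \<in> V" for v
    using t(2) s_in_R[OF that] fixed[OF t(1)] q(2)[OF that]
    by (cases "v \<in> R") (auto simp: symmetric_extension_def)
  then show ?thesis using trivial_motion_sum[OF u2, of u1 t u] dec by (simp add: add.commute)
qed

text \<open>For the antisymmetric part, the mirror of the auxiliary reflection is the first coordinate
  axis: its matrix has entries \<open>0\<close>, \<open>1\<close>, \<open>-1\<close>, so \<open>p\<close> is generic with respect to it as well.\<close>

lemma half_turn_rigid:
  assumes K: "{0, 1, -1} \<subseteq> K" and gen: "generic_over K R p"
    and p: "\<And>v. v \<in> V \<Longrightarrow> p (s v) = - mat 1 *v p v"
    and u: "\<And>i j. {i, j} \<in> E \<Longrightarrow> (p i - p j) \<bullet> (u i - u j) = 0"
  shows "trivial_motion V p u"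
proof -
  let ?\<tau> = "- mat 1 :: real^2^2"
  interpret half_turn: generic_symmetric_configuration V E s R ?\<tau> K p
    by (rule generic_half_turn_configuration[OF K gen])
  obtain u1 u2 where dec: "\<And>v. u v = u1 v + u2 v"
    and sym: "\<And>v. v \<in> V \<Longrightarrow> u1 (s v) = ?\<tau> *v u1 v" "\<And>v. v \<in> V \<Longrightarrow> u2 (s v) = - (?\<tau> *v u2 v)"
    and motion: "\<And>i j. {i, j} \<in> E \<Longrightarrow> (p i - p j) \<bullet> (u1 i - u1 j) = 0"
      "\<And>i j. {i, j} \<in> E \<Longrightarrow> (p i - p j) \<bullet> (u2 i - u2 j) = 0"
    using motion_decomposition[where \<rho> = ?\<tau> and p = p and u = u, OF half_turn.\<rho>_\<rho> half_turn.\<rho>_inner p u] by blast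
  have V: "i \<in> V" "j \<in> V" if "{i, j} \<in> E" for i j using edge[OF that] by auto
  have q: "symmetric_extension s R ?\<tau> p v = p v" "symmetric_extension s R (mat 1) u2 v = u2 v" if "v \<in> V" for v
    using that p sym(2) by (auto intro!: extend_equivariant simp: uminus_mat_1_mult)
  have "\<exists>l c. ?\<tau> *v c = c \<and>
      (\<forall>v\<in>V. u1 v = l *\<^sub>R quarter_turn (symmetric_extension s R ?\<tau> p v) + quarter_turn c)"
    by (rule half_turn.twisted_motion_trivial)
      (use motion(1) V in \<open>auto simp: sym q quarter_turn_linear uminus_mat_1_mult\<close>)
  then obtain l c where u1: "\<forall>v\<in>V. u1 v = l *\<^sub>R quarter_turn (p v) + quarter_turn c"
    using q by auto
  let ?d = "axis 1 1 :: real^2"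
  have d: "?d \<bullet> ?d = 1" by (simp add: inner_axis_axis)
  have ax: "?d $ 1 = 1" "?d $ 2 = 0" "(axis 2 1 :: real^2) $ 1 = 0" "(axis 2 1 :: real^2) $ 2 = 1"
    by (simp_all add: axis_def)
  have turn_d: "quarter_turn ?d = axis 2 1" by (simp add: vec_eq_iff forall_2 ax)
  have d_mult: "reflection_in_line ?d *v x = vector [x $ 1, - x $ 2]" for x
    unfolding reflection_in_line_mult[OF d] turn_d by (simp add: vec_eq_iff forall_2 inner_axis ax)
  have "reflection_in_line ?d $ i $ j = (reflection_in_line ?d *v axis j 1) $ i" for i j
    by (simp add: matrix_vector_mult_basis column_def)
  then have d_K: "reflection_in_line ?d $ i $ j \<in> K" for i j
    using K exhaust_2[of i] exhaust_2[of j] unfolding d_mult by (auto simp: ax)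
  have nz: "p v \<bullet> quarter_turn ?d \<noteq> 0" if "v \<in> R" for v
    using half_turn.generic_coordinate[OF that, of 2] turn_d by (simp add: inner_axis)
  have mat_K: "(mat 1 :: real^2^2) $ i $ j \<in> K" "?\<tau> $ i $ j \<in> K" for i j
    using K by (auto simp: mat_def)
  have "\<exists>t\<in>UNIV. \<forall>v\<in>R. u2 v = t"
  proof (rule constant_motions_at_generic[OF K gen mat_K(2) mat_K(1),
        where P = UNIV and z = "\<lambda>v. proj_point ?d (p v)"])
    show "\<exists>t\<in>UNIV. \<forall>k\<in>UNIV. (y - t) $ k = 0" for y :: "real^2"
      by (intro bexI[of _ y]) auto
    show "t = 0" if "\<And>k. k \<in> UNIV \<Longrightarrow> t $ k = 0" for t :: "real^2"
      using that by (simp add: vec_eq_iff)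
    show "\<exists>t\<in>UNIV. \<forall>v\<in>R. w v = t"
      if "\<And>i j. {i, j} \<in> E \<Longrightarrow> edge_stretch s R ?\<tau> (mat 1) (\<lambda>v. proj_point ?d (p v)) w i j = 0" for w
      using half_turn_antisymmetric_motion_constant[OF K gen d d_K nz that] by auto
    show "edge_stretch s R ?\<tau> (mat 1) p u2 i j = 0" if "{i, j} \<in> E" for i j
      using motion(2)[OF that] V[OF that] by (simp add: edge_stretch_def q)
  qed auto
  then obtain t where t: "\<And>v. v \<in> R \<Longrightarrow> u2 v = t" by blast
  have "u2 v = t" if "v \<in> V" for v
    using t s_in_R[OF that] q(2)[OF that]
    by (cases "v \<in> R") (auto simp: symmetric_extension_def)
  then show ?thesis using trivial_motion_sum[OF u1, of u2 t u] dec by simp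
qed

end

section \<open>Symmetric frameworks\<close>

lemma symmetry_field_subring:
  shows "{0, 1, -1} \<subseteq> symmetry_field \<Gamma> \<tau>"
    and "\<And>c d. c \<in> symmetry_field \<Gamma> \<tau> \<Longrightarrow> d \<in> symmetry_field \<Gamma> \<tau> \<Longrightarrow> c + d \<in> symmetry_field \<Gamma> \<tau>"
    and "\<And>c d. c \<in> symmetry_field \<Gamma> \<tau> \<Longrightarrow> d \<in> symmetry_field \<Gamma> \<tau> \<Longrightarrow> c * d \<in> symmetry_field \<Gamma> \<tau>"
    and "\<And>\<gamma> a b. \<gamma> \<in> carrier \<Gamma> \<Longrightarrow> \<tau> \<gamma> $ a $ b \<in> symmetry_field \<Gamma> \<tau>"
proof -
  let ?F = "ring_of_type_algebra :: real ring"
  interpret F: field ?F by (rule field_from_type_algebra)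
  let ?H = "{\<tau> \<gamma> $ a $ b | \<gamma> a b. \<gamma> \<in> carrier \<Gamma>}"
  have one: "1 \<in> generate_field ?F ?H"
    using generate_field.one[of ?F ?H] by (simp add: ring_of_type_algebra_def)
  have minus: "\<ominus>\<^bsub>?F\<^esub> 1 = (-1 :: real)"
    using F.l_neg[of 1] by (simp add: ring_of_type_algebra_def eq_neg_iff_add_eq_0)
  have "-1 \<in> generate_field ?F ?H"
    using generate_field.a_inv[OF one] minus by simp
  moreover have "0 \<in> generate_field ?F ?H"
    using F.zero_in_generate[of ?H] by (simp add: ring_of_type_algebra_def)
  ultimately show "{0, 1, -1} \<subseteq> symmetry_field \<Gamma> \<tau>"
    using one by (simp add: symmetry_field_def)
  show "c + d \<in> symmetry_field \<Gamma> \<tau>" "c * d \<in> symmetry_field \<Gamma> \<tau>"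
    if "c \<in> symmetry_field \<Gamma> \<tau>" "d \<in> symmetry_field \<Gamma> \<tau>" for c d
    using that generate_field.eng_add[of c ?F ?H d] generate_field.eng_mult[of c ?F ?H d]
    by (simp_all add: symmetry_field_def ring_of_type_algebra_def)
  show "\<tau> \<gamma> $ a $ b \<in> symmetry_field \<Gamma> \<tau>" if "\<gamma> \<in> carrier \<Gamma>" for \<gamma> a b
    unfolding symmetry_field_def by (rule generate_field.incl) (use that in blast)
qed

lemma reflection_in_line_scale:
  assumes "k \<noteq> 0"
  shows "reflection_in_line (k *\<^sub>R d) = reflection_in_line d"
  using assms by (simp add: reflection_in_line_def)

lemma rotation_pi: "rotation pi = - mat 1"
  by (simp add: rotation_def vec_eq_iff forall_2 mat_def)

lemma orthogonal_matrix_idempotent: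
  assumes "orthogonal_matrix A" "A ** A = A"
  shows "A = (mat 1 :: real^2^2)"
proof -
  have "transpose A ** (A ** A) = transpose A ** A" using assms(2) by simp
  then show ?thesis
    using assms(1) by (simp add: matrix_mul_assoc orthogonal_matrix_def)
qed

theorem theorem3p2:
  fixes \<Gamma> :: "('g, 'm) monoid_scheme"
    and V :: "'v set" and E E\<^sub>l :: "'v set set"
    and \<theta> :: "'g \<Rightarrow> 'v \<Rightarrow> 'v" and \<tau> :: "'g \<Rightarrow> real^2^2"
    and p :: "'v \<Rightarrow> real^2" and s :: 'g
  assumes "group \<Gamma>" and "order \<Gamma> = 2"
    and "finite_simple_graph V E"
    and "graph_action \<Gamma> V E \<theta>" and "free_on \<Gamma> V \<theta>"
    and "\<tau> \<in> hom \<Gamma> orthogonal_group"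
    and "is_Cs (\<tau> ` carrier \<Gamma>) \<or> is_C2 (\<tau> ` carrier \<Gamma>)"
    and "generic_framework \<Gamma> V \<theta> \<tau> p"
    and "s \<in> carrier \<Gamma>" and "s \<noteq> \<one>\<^bsub>\<Gamma>\<^esub>"
    and "E\<^sub>l = fixed_edges \<theta> s E"
    and "mixed_connected 7 V (E - E\<^sub>l)"
  shows "infinitesimally_rigid V E p"
proof -
  interpret group \<Gamma> by fact
  let ?s = "\<theta> s" and ?E = "E - E\<^sub>l" and ?K = "symmetry_field \<Gamma> \<tau>"
  have "card (carrier \<Gamma>) = 2" using assms(2) by (simp add: order_def)
  then obtain x y where "carrier \<Gamma> = {x, y}" by (auto simp: card_2_iff)
  then have carrier: "carrier \<Gamma> = {\<one>\<^bsub>\<Gamma>\<^esub>, s}"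
    using assms(9,10) one_closed by auto
  have ss: "s \<otimes>\<^bsub>\<Gamma>\<^esub> s = \<one>\<^bsub>\<Gamma>\<^esub>"
    using assms(9,10) carrier m_closed[of s s] r_cancel_one[of s s] by auto
  have hom: "\<theta> \<in> hom \<Gamma> (graph_aut_group V E)" using assms(4) by (simp add: graph_action_def)
  then have aut: "\<theta> \<gamma> \<in> Bij V" "\<And>i j. i \<in> V \<Longrightarrow> j \<in> V \<Longrightarrow> {\<theta> \<gamma> i, \<theta> \<gamma> j} \<in> E \<longleftrightarrow> {i, j} \<in> E"
    if "\<gamma> \<in> carrier \<Gamma>" for \<gamma>
    using that by (auto simp: hom_def graph_aut_group_def)
  have bij: "bij_betw (\<theta> \<gamma>) V V" if "\<gamma> \<in> carrier \<Gamma>" for \<gamma>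
    using aut(1)[OF that] by (simp add: Bij_def)
  have comp: "\<theta> (\<gamma> \<otimes>\<^bsub>\<Gamma>\<^esub> \<delta>) v = \<theta> \<gamma> (\<theta> \<delta> v)" if "\<gamma> \<in> carrier \<Gamma>" "\<delta> \<in> carrier \<Gamma>" "v \<in> V" for \<gamma> \<delta> v
  proof -
    have "\<theta> (\<gamma> \<otimes>\<^bsub>\<Gamma>\<^esub> \<delta>) = \<theta> \<gamma> \<otimes>\<^bsub>graph_aut_group V E\<^esub> \<theta> \<delta>"
      using hom that by (simp add: hom_mult)
    then show ?thesis
      using aut(1)[OF that(1)] aut(1)[OF that(2)] that(3)
      by (simp add: graph_aut_group_def BijGroup_def compose_def)
  qed
  have \<theta>_in: "\<theta> \<gamma> v \<in> V" if "\<gamma> \<in> carrier \<Gamma>" "v \<in> V" for \<gamma> v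
    using bij[OF that(1)] that(2) bij_betwE by blast
  have \<theta>_one: "\<theta> \<one>\<^bsub>\<Gamma>\<^esub> v = v" if v: "v \<in> V" for v
  proof -
    have "\<theta> \<one>\<^bsub>\<Gamma>\<^esub> (\<theta> \<one>\<^bsub>\<Gamma>\<^esub> v) = \<theta> \<one>\<^bsub>\<Gamma>\<^esub> v"
      using comp[OF one_closed one_closed v] by simp
    then show ?thesis
      using bij[OF one_closed] v \<theta>_in[OF one_closed v] by (auto simp: bij_betw_def inj_on_def)
  qed
  have s_s: "?s (?s v) = v" if "v \<in> V" for v
    using comp[OF assms(9) assms(9) that] ss \<theta>_one[OF that] by simp
  have s_free: "?s v \<noteq> v" if "v \<in> V" for v
    using assms(5,9,10) that by (auto simp: free_on_def)
  have graph: "finite V" "\<And>e. e \<in> E \<Longrightarrow> e \<subseteq> V \<and> card e = 2"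
    using assms(3) by (auto simp: finite_simple_graph_def)
  have fixed_iff: "e \<in> E\<^sub>l \<longleftrightarrow> ?s ` e = e" if e: "e \<in> E" for e
  proof -
    obtain i j where ij: "e = {i, j}" "i \<noteq> j" using graph(2)[OF e] by (auto simp: card_2_iff)
    then have V: "i \<in> V" "j \<in> V" using graph(2)[OF e] by auto
    have "e \<in> E\<^sub>l \<longleftrightarrow> (\<exists>k l. e = {k, l} \<and> ?s k = l \<and> ?s l = k)"
      using e by (simp add: assms(11) fixed_edges_def)
    also have "\<dots> \<longleftrightarrow> ?s i = j"
      using ij s_s[OF V(1)] s_s[OF V(2)] by (auto simp: doubleton_eq_iff)
    also have "\<dots> \<longleftrightarrow> ?s ` e = e"
      using ij s_free[OF V(1)] s_s[OF V(1)] by (auto simp: doubleton_eq_iff)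
    finally show ?thesis .
  qed
  have s_edge: "?s ` e \<in> ?E" "?s ` e \<noteq> e" if e: "e \<in> ?E" for e
  proof -
    obtain i j where ij: "e = {i, j}" using graph(2)[of e] e by (auto simp: card_2_iff)
    then have V: "i \<in> V" "j \<in> V" using graph(2)[of e] e by auto
    then have E: "?s ` e \<in> E" using aut(2)[OF assms(9)] e ij by simp
    show ne: "?s ` e \<noteq> e" using fixed_iff e by auto
    have "?s ` ?s ` e = e" using ij V s_s by simp
    then show "?s ` e \<in> ?E" using E ne fixed_iff[OF E] by auto
  qed
  obtain R where R: "orbit_representatives \<Gamma> V \<theta> R"
    and indep: "algebraically_independent ?K (R \<times> (UNIV :: 2 set)) (\<lambda>(i, k). p i $ k)"
    and frame: "symmetric_framework \<Gamma> V \<theta> \<tau> p"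
    using assms(8) by (auto simp: generic_framework_def)
  have orbit_eq: "orbit \<Gamma> \<theta> v = {v, ?s v}" if "v \<in> V" for v
  proof -
    have "orbit \<Gamma> \<theta> v = (\<lambda>\<gamma>. \<theta> \<gamma> v) ` carrier \<Gamma>" by (auto simp: orbit_def)
    then show ?thesis using \<theta>_one[OF that] by (simp add: carrier)
  qed
  have R_orbit: "\<exists>!r. r \<in> R \<inter> {v, ?s v}" if "v \<in> V" for v
  proof -
    have "orbit \<Gamma> \<theta> v \<in> orbits \<Gamma> V \<theta>" using that by (auto simp: orbits_def)
    then have "\<exists>!r. r \<in> R \<inter> orbit \<Gamma> \<theta> v" using R unfolding orbit_representatives_def by blast
    then show ?thesis by (simp only: orbit_eq[OF that])
  qed
  have R_sub: "R \<subseteq> V" using R by (simp add: orbit_representatives_def)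
  interpret mixed_7_transversal_graph V ?E ?s R
  proof unfold_locales
    show "V = R \<union> ?s ` R"
    proof (intro equalityI subsetI)
      fix v assume v: "v \<in> V"
      then obtain r where "r \<in> R" "r = v \<or> r = ?s v" using R_orbit[OF v] by auto
      then show "v \<in> R \<union> ?s ` R" using s_s[OF v] by (metis UnCI imageI)
    qed (use R_sub \<theta>_in[OF assms(9)] in auto)
    show "R \<inter> ?s ` R = {}"
    proof (rule ccontr)
      assume "\<not> ?thesis"
      then obtain v where v: "v \<in> R" "?s v \<in> R" by blast
      then have "?s v = v" using R_orbit[of v] R_sub by blast
      then show False using s_free v R_sub by blast
    qed
  qed (use graph s_edge s_s s_free \<theta>_in[OF assms(9)] assms(12) in auto)
  have gen: "generic_over ?K R p"
    using symmetry_field_subring[where \<Gamma> = \<Gamma> and \<tau> = \<tau>] indep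
    by (intro generic_over_if_algebraically_independent) auto
  have p_s: "p (?s v) = \<tau> s *v p v" if "v \<in> V" for v
    using frame assms(9) that by (simp add: symmetric_framework_def)
  have p_ne: "p (?s v) \<noteq> p v" if "v \<in> V" for v
    using frame s_free[OF that] that \<theta>_in[OF assms(9) that]
    by (auto simp: symmetric_framework_def framework_def inj_on_def)
  have "orthogonal_matrix (\<tau> \<one>\<^bsub>\<Gamma>\<^esub>)" "\<tau> \<one>\<^bsub>\<Gamma>\<^esub> ** \<tau> \<one>\<^bsub>\<Gamma>\<^esub> = \<tau> \<one>\<^bsub>\<Gamma>\<^esub>"
    using assms(6) one_closed hom_mult[OF assms(6) one_closed one_closed]
    by (auto simp: hom_def orthogonal_group_def)
  then have \<tau>_one: "\<tau> \<one>\<^bsub>\<Gamma>\<^esub> = mat 1" by (rule orthogonal_matrix_idempotent)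
  \<comment> \<open>As the image has just these two elements, any generator of it other than the identity is \<open>\<tau> s\<close>.\<close>
  have image: "\<tau> ` carrier \<Gamma> = {mat 1, \<tau> s}" using carrier \<tau>_one by simp
  show ?thesis
    unfolding infinitesimally_rigid_def
  proof (intro allI impI)
    fix u assume "infinitesimal_motion E p u"
    then have u: "(p i - p j) \<bullet> (u i - u j) = 0" if "{i, j} \<in> ?E" for i j
      using that by (auto simp: infinitesimal_motion_def)
    from assms(7) show "trivial_motion V p u"
    proof
      assume "is_C2 (\<tau> ` carrier \<Gamma>)"
      then have "rotation pi \<in> {mat 1, \<tau> s}"
        unfolding is_C2_def image by (auto intro: generate.incl)
      moreover have "- mat 1 \<noteq> (mat 1 :: real^2^2)"
        by (simp add: vec_eq_iff forall_2 mat_def)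
      ultimately have "\<tau> s = - mat 1" by (auto simp: rotation_pi)
      then show ?thesis
        using p_s by (intro half_turn_rigid[OF symmetry_field_subring(1) gen _ u]) auto
    next
      assume "is_Cs (\<tau> ` carrier \<Gamma>)"
      then obtain d0 where d0: "d0 \<noteq> 0" "reflection_in_line d0 \<in> {mat 1, \<tau> s}"
        unfolding is_Cs_def image by (auto intro: generate.incl)
      define d where "d = (1 / norm d0) *\<^sub>R d0"
      have d: "d \<bullet> d = 1"
        using d0(1) by (simp add: d_def dot_square_norm power2_eq_square)
      have refl: "reflection_in_line d = reflection_in_line d0"
        unfolding d_def using d0(1) by (intro reflection_in_line_scale) simp
      have "reflection_in_line d *v quarter_turn d = - quarter_turn d"
        unfolding reflection_in_line_mult[OF d] by (simp add: frame_orthonormal(1,3)[OF d])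
      moreover have "quarter_turn d \<noteq> - quarter_turn d"
        using frame_orthonormal(1)[OF d] by (auto simp: vec_eq_iff forall_2 inner_2)
      ultimately have "reflection_in_line d \<noteq> mat 1" by auto
      then have \<tau>_s: "\<tau> s = reflection_in_line d" using d0(2) refl by auto
      show ?thesis
      proof (rule reflection_rigid[OF symmetry_field_subring(1) gen d _ _ p_ne u])
        show "reflection_in_line d $ i $ j \<in> ?K" for i j
          using symmetry_field_subring(4)[OF assms(9), where \<tau> = \<tau> and a = i and b = j] \<tau>_s by simp
      qed (use p_s \<tau>_s in auto)
    qed
  qed
qed

end
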